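(* Let $u$ be a weak solution of the Euler equations on the whole space $\mathbb{R}^3$, on the time interval $[0,T]$, that satisfies $u\in L^3(0,T;W^{\alpha,3}(\mathbb{R}^3))$ for some $\alpha>1/3$, i.e. $u\in L^3(0,T;L^3(\mathbb{R}^3))$ and $$\int_0^T\int_{\mathbb{R}^3}\int_{\mathbb{R}^3}\frac{|u(x,t)-u(y,t)|^3}{|x-y|^{3+3\alpha}}\,dx\,dy\,dt<\infty .$$ Then energy is conserved.
   Context: $T>0$ is fixed and $D=\mathbb{R}^3$. $\mathcal{S}(D)$ is the Schwartz space and $\mathcal{D}(D)$ the space of $C^\infty$ compactly supported functions; $\mathcal{S}_\sigma(D)$, $\mathcal{D}_\sigma(D)$ are the sets of divergence-free vector fields in them. $H_\sigma$ is the closure of $\mathcal{D}_\sigma(D)$ (equivalently of $\mathcal{S}_\sigma(D)$) in $L^2(D)$. $C_{\rm w}([0,T];H_\sigma)$ is the set of $u:[0,T]\to H_\sigma$ such that $t\mapsto\langle u(t),\phi\rangle$ is continuous for every $\phi\in L^2(D)$. $\mathcal{S}_\sigma^T:=\{\psi\in C^\infty(D\times[0,T]):\psi(\cdot,t)\in\mathcal{S}_\sigma(D)\text{ for all }t\in[0,T]\}$. Notation: $\langle f,g\rangle=\int_Df_ig_i\,dx$, $\langle F:G\rangle=\int_DF_{ij}G_{ij}\,dx$ (summation convention). Weak solution: $u\in C_{\rm w}([0,T];H_\sigma)$ is a weak solution of the Euler equations on $[0,T]$, arising from $u(0)\in H_\sigma$, if $$\langle u(t),\psi(t)\rangle-\langle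 u(0),\psi(0)\rangle-\int_0^t\langle u(\tau),\partial_t\psi(\tau)\rangle\,d\tau=\int_0^t\langle u(\tau)\otimes u(\tau):\nabla\psi(\tau)\rangle\,d\tau$$ for every $t\in[0,T]$ and every $\psi\in\mathcal{S}_\sigma^T$. Energy is conserved means $\|u(t)\|_{L^2(\mathbb{R}^3)}=\|u(0)\|_{L^2(\mathbb{R}^3)}$ for every $t\in[0,T]$. *)

theory Defs
  imports "HOL-Analysis.Analysis"
begin

type_synonym vec_field = "real^3 \<Rightarrow> real^3"

text \<open>
  Derivatives are taken within \<open>S\<close>, so that on \<open>\<real>\<^sup>3 \<times> [0,T]\<close> the time derivatives at
  \<open>t = 0\<close> and \<open>t = T\<close> are one-sided and values outside \<open>[0,T]\<close> play no role.
\<close>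

fun iter_deriv :: "'a::euclidean_space set \<Rightarrow> 'a list \<Rightarrow> ('a \<Rightarrow> 'b::real_normed_vector) \<Rightarrow> 'a \<Rightarrow> 'b" where
  "iter_deriv S [] f = f"
| "iter_deriv S (v # vs) f = (\<lambda>x. frechet_derivative (iter_deriv S vs f) (at x within S) v)"

definition smooth_on :: "'a::euclidean_space set \<Rightarrow> ('a \<Rightarrow> 'b::real_normed_vector) \<Rightarrow> bool" where
  "smooth_on S f \<longleftrightarrow> (\<forall>vs. set vs \<subseteq> Basis \<longrightarrow> iter_deriv S vs f differentiable_on S)"

definition divergence :: "vec_field \<Rightarrow> real^3 \<Rightarrow> real" where
  "divergence f x = (\<Sum>i\<in>UNIV. frechet_derivative f (at x) (axis i 1) $ i)"

definition schwartz :: "vec_field set" where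
  "schwartz = {f. smooth_on UNIV f \<and>
     (\<forall>k vs. set vs \<subseteq> Basis \<longrightarrow> (\<exists>C. \<forall>x. norm x ^ k * norm (iter_deriv UNIV vs f x) \<le> C))}"

definition schwartz_sigma :: "vec_field set" where
  "schwartz_sigma = {f \<in> schwartz. \<forall>x. divergence f x = 0}"

definition test_sigma :: "vec_field set" where
  "test_sigma = {f. smooth_on UNIV f \<and> compact (closure {x. f x \<noteq> 0}) \<and> (\<forall>x. divergence f x = 0)}"

text \<open>
  Elements of \<open>L\<^sup>2\<close> are represented by Borel functions, not by classes modulo null sets; every
  notion below depends on the almost-everywhere class of each \<open>u t\<close> only.
\<close>

definition L2 :: "vec_field set" where
  "L2 = {f. f \<in> borel_measurable lborel \<and> integrable lborel (\<lambda>x. (norm (f x))\<^sup>2)}"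

definition L2_norm :: "vec_field \<Rightarrow> real" where
  "L2_norm f = sqrt (LINT x|lborel. (norm (f x))\<^sup>2)"

text \<open>
  For \<open>'b = real^3^3\<close> the inner product is \<open>\<Sum>i j. F $ i $ j * G $ i $ j\<close>, so the same
  definition gives both \<open>\<langle>f, g\<rangle>\<close> and \<open>\<langle>F : G\<rangle>\<close>.
\<close>

definition pairing :: "(real^3 \<Rightarrow> 'b::euclidean_space) \<Rightarrow> (real^3 \<Rightarrow> 'b) \<Rightarrow> real" where
  "pairing f g = (LINT x|lborel. f x \<bullet> g x)"

definition H_sigma :: "vec_field set" where
  "H_sigma = {f \<in> L2. \<forall>e>0. \<exists>g\<in>test_sigma. L2_norm (\<lambda>x. f x - g x) < e}"

definition C_weak :: "real \<Rightarrow> (real \<Rightarrow> vec_field) set" where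
  "C_weak T = {u. (\<forall>t\<in>{0..T}. u t \<in> H_sigma) \<and>
     (\<forall>\<phi>\<in>L2. continuous_on {0..T} (\<lambda>t. pairing (u t) \<phi>))}"

definition schwartz_sigma_T :: "real \<Rightarrow> (real \<Rightarrow> vec_field) set" where
  "schwartz_sigma_T T = {\<psi>. smooth_on (UNIV \<times> {0..T}) (\<lambda>(x, t). \<psi> t x) \<and>
     (\<forall>t\<in>{0..T}. \<psi> t \<in> schwartz_sigma)}"

definition time_deriv :: "real \<Rightarrow> (real \<Rightarrow> vec_field) \<Rightarrow> real \<Rightarrow> vec_field" where
  "time_deriv T \<psi> t x = vector_derivative (\<lambda>s. \<psi> s x) (at t within {0..T})"

definition tensor :: "vec_field \<Rightarrow> vec_field \<Rightarrow> real^3 \<Rightarrow> real^3^3" where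
  "tensor f g x = (\<chi> i j. f x $ i * g x $ j)"

definition grad :: "vec_field \<Rightarrow> real^3 \<Rightarrow> real^3^3" where
  "grad f x = (\<chi> i j. frechet_derivative f (at x) (axis i 1) $ j)"

text \<open>
  Membership in \<open>schwartz_sigma_T T\<close> bounds the Schwartz seminorms of \<open>\<psi> t\<close> for each \<open>t\<close>
  separately, not uniformly in \<open>t\<close>, and does not bound those of \<open>\<partial>\<^sub>t \<psi>\<close>. Hence the two space-time
  integrals in the weak formulation need not converge for every such \<open>\<psi>\<close>. The weak formulation
  is required whenever they converge absolutely; without this proviso a divergent integral
  would enter the identity with the default value 0.
\<close>

definition weak_form_converges :: "real \<Rightarrow> (real \<Rightarrow> vec_field) \<Rightarrow> (real \<Rightarrow> vec_field) \<Rightarrow> real \<Rightarrow> bool" where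
  "weak_form_converges T u \<psi> t \<longleftrightarrow>
     (\<integral>\<^sup>+\<tau>\<in>{0..t}. (\<integral>\<^sup>+x. ennreal \<bar>u \<tau> x \<bullet> time_deriv T \<psi> \<tau> x\<bar> \<partial>lborel) \<partial>lborel) < \<infinity> \<and>
     (\<integral>\<^sup>+\<tau>\<in>{0..t}. (\<integral>\<^sup>+x. ennreal \<bar>tensor (u \<tau>) (u \<tau>) x \<bullet> grad (\<psi> \<tau>) x\<bar> \<partial>lborel) \<partial>lborel) < \<infinity>"

definition weak_euler_solution :: "real \<Rightarrow> (real \<Rightarrow> vec_field) \<Rightarrow> bool" where
  "weak_euler_solution T u \<longleftrightarrow> u \<in> C_weak T \<and>
     (\<forall>t\<in>{0..T}. \<forall>\<psi>\<in>schwartz_sigma_T T. weak_form_converges T u \<psi> t \<longrightarrow>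
        pairing (u t) (\<psi> t) - pairing (u 0) (\<psi> 0)
          - (LINT \<tau>:{0..t}|lborel. pairing (u \<tau>) (time_deriv T \<psi> \<tau>))
        = (LINT \<tau>:{0..t}|lborel. pairing (tensor (u \<tau>) (u \<tau>)) (grad (\<psi> \<tau>))))"

definition energy_conserved :: "real \<Rightarrow> (real \<Rightarrow> vec_field) \<Rightarrow> bool" where
  "energy_conserved T u \<longleftrightarrow> (\<forall>t\<in>{0..T}. L2_norm (u t) = L2_norm (u 0))"

end

theory Submission
  imports Defs
begin

text \<open>
  Let \<open>J\<close> be convolution with an even \<open>C\<^sup>1\<close> kernel \<open>\<phi>\<close> supported in a ball of radius \<open>\<epsilon>\<close>, and let
  \<open>K = \<nabla>\<phi>\<close>. For a divergence-free test field \<open>g\<close> the field \<open>J g\<close> is again a test field (all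
  derivatives fall on \<open>g\<close>), and by density of test fields in \<open>H\<^sub>\<sigma>\<close> the weak formulation extends to
  \<open>\<psi> = J (u s)\<close> for every fixed time \<open>s\<close>. As \<open>J\<close> is symmetric, summing the increments of
  \<open>\<langle>u(t), J u(s)\<rangle>\<close> over a partition gives
  \<open>\<langle>u(t), J u(t)\<rangle> - \<langle>u(0), J u(0)\<rangle> = 2 \<integral> \<langle>u \<otimes> u : \<nabla> J u\<rangle> d\<tau>\<close>.
  The flux on the right equals
  \<open>- 1/4 \<integral>\<integral> \<bar>u(x) - u(y)\<bar>\<^sup>2 (u(x) - u(y)) \<bullet> K(x - y) dx dy\<close>, which is at most a constant times
  \<open>\<epsilon>\<close> to the power \<open>3 \<alpha> - 1\<close> times the Gagliardo integral, because \<open>\<bar>K(z)\<bar>\<close> is bounded by a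
  multiple of \<open>\<epsilon>\<close> to the power \<open>- 4\<close>. Now let \<open>\<epsilon>\<close> tend to \<open>0\<close>.

  No joint measurability of \<open>u\<close> in space and time is available; measurability in time of the
  fluxes comes from weak continuity.
\<close>

section \<open>Square-integrable fields\<close>

text \<open>The obstacle is time regularity: \<open>u\<close> is only weakly continuous, so its
  mollification has no time derivative that a test function could use.

  Weak continuity gives no norm bound directly, yet every majorant in time needs one. This is why
  completeness of \<open>L2\<close> and a uniform boundedness principle come early.

  The kernel is fixed while the balance is derived, so constants such as \<open>L2_norm K\<close>
  may blow up with the radius. Two estimates must survive the limit: the bound of
  \<open>moll_form\<close> by the product of the norms, whose constant is 1 because the kernel has
  mass one, and the flux bound, whose power of the radius is positive exactly for \<alpha> > 1/3.

  Separating the cubic flux expression into its terms requires the field to be in L^3 at the time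
  considered. This is available at every time with finite Gagliardo integral; at the other times the
  flux bound is trivial.\<close>

lemma Cauchy_Schwarz_integral:
  fixes f g :: "'a \<Rightarrow> real"
  assumes [measurable]: "f \<in> borel_measurable M" "g \<in> borel_measurable M"
    and f: "integrable M (\<lambda>x. (f x)\<^sup>2)" and g: "integrable M (\<lambda>x. (g x)\<^sup>2)"
  shows "integrable M (\<lambda>x. f x * g x)"
    and "(LINT x|M. \<bar>f x * g x\<bar>) \<le> sqrt (LINT x|M. (f x)\<^sup>2) * sqrt (LINT x|M. (g x)\<^sup>2)"
proof -
  show i: "integrable M (\<lambda>x. f x * g x)"
  proof (rule Bochner_Integration.integrable_bound[OF Bochner_Integration.integrable_add[OF f g]])
    show "AE x in M. norm (f x * g x) \<le> norm ((f x)\<^sup>2 + (g x)\<^sup>2)"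
    proof (rule AE_I2)
      fix x
      have "2 * \<bar>f x\<bar> * \<bar>g x\<bar> \<le> (f x)\<^sup>2 + (g x)\<^sup>2"
        using sum_squares_bound[of "\<bar>f x\<bar>" "\<bar>g x\<bar>"] by simp
      moreover have "0 \<le> \<bar>f x\<bar> * \<bar>g x\<bar>" by simp
      ultimately have "\<bar>f x\<bar> * \<bar>g x\<bar> \<le> (f x)\<^sup>2 + (g x)\<^sup>2" by linarith
      then show "norm (f x * g x) \<le> norm ((f x)\<^sup>2 + (g x)\<^sup>2)"
        by (simp add: abs_mult)
    qed
  qed simp
  let ?F = "LINT x|M. (f x)\<^sup>2" and ?G = "LINT x|M. (g x)\<^sup>2" and ?H = "LINT x|M. \<bar>f x * g x\<bar>"
  have "(\<integral>\<^sup>+x. ennreal \<bar>f x\<bar> * ennreal \<bar>g x\<bar> \<partial>M)\<^sup>2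
      \<le> (\<integral>\<^sup>+x. (ennreal \<bar>f x\<bar>)\<^sup>2 \<partial>M) * (\<integral>\<^sup>+x. (ennreal \<bar>g x\<bar>)\<^sup>2 \<partial>M)"
    by (rule Cauchy_Schwarz_nn_integral) auto
  also have "(\<integral>\<^sup>+x. ennreal \<bar>f x\<bar> * ennreal \<bar>g x\<bar> \<partial>M) = ennreal ?H"
    using integrable_abs[OF i]
    by (subst nn_integral_eq_integral[symmetric]) (auto simp: abs_mult ennreal_mult)
  also have "(\<integral>\<^sup>+x. (ennreal \<bar>f x\<bar>)\<^sup>2 \<partial>M) = ennreal ?F"
    using f by (subst nn_integral_eq_integral[symmetric]) (auto simp: ennreal_power)
  also have "(\<integral>\<^sup>+x. (ennreal \<bar>g x\<bar>)\<^sup>2 \<partial>M) = ennreal ?G"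
    using g by (subst nn_integral_eq_integral[symmetric]) (auto simp: ennreal_power)
  finally have "ennreal (?H\<^sup>2) \<le> ennreal (?F * ?G)"
    by (simp add: ennreal_power ennreal_mult)
  then have "?H\<^sup>2 \<le> ?F * ?G" by (simp add: ennreal_le_iff)
  then show "?H \<le> sqrt ?F * sqrt ?G"
    by (simp add: real_le_rsqrt flip: real_sqrt_mult)
qed

lemma L2_measurable [measurable_dest]: "f \<in> L2 \<Longrightarrow> f \<in> borel_measurable borel"
  by (simp add: L2_def)

lemma L2_integrable: "f \<in> L2 \<Longrightarrow> integrable lborel (\<lambda>x. (norm (f x))\<^sup>2)"
  by (simp add: L2_def)

lemma L2_I:
  assumes "f \<in> borel_measurable borel" "integrable lborel (\<lambda>x. (norm (f x))\<^sup>2)"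
  shows "f \<in> L2"
  using assms by (simp add: L2_def)

lemma L2_norm_nonneg [simp]: "0 \<le> L2_norm f"
  by (simp add: L2_norm_def)

lemma L2_norm_sq: "(L2_norm f)\<^sup>2 = (LINT x|lborel. (norm (f x))\<^sup>2)"
  by (simp add: L2_norm_def)

lemma L2_norm_sq_pairing: "(L2_norm f)\<^sup>2 = pairing f f"
  by (simp add: L2_norm_sq pairing_def power2_norm_eq_inner)

lemma L2_integrable_norm_mult:
  assumes "f \<in> L2" "g \<in> L2"
  shows "integrable lborel (\<lambda>x. norm (f x) * norm (g x))"
    and "(LINT x|lborel. norm (f x) * norm (g x)) \<le> L2_norm f * L2_norm g"
  using Cauchy_Schwarz_integral[of "\<lambda>x. norm (f x)" lborel "\<lambda>x. norm (g x)"] assms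
  by (auto simp: L2_def L2_norm_def)

lemma L2_integrable_inner:
  assumes [measurable]: "f \<in> L2" "g \<in> L2"
  shows "integrable lborel (\<lambda>x. f x \<bullet> g x)"
  by (rule Bochner_Integration.integrable_bound[OF L2_integrable_norm_mult(1)[OF assms]])
     (auto simp: Cauchy_Schwarz_ineq2)

lemma abs_pairing_le:
  assumes "f \<in> L2" "g \<in> L2"
  shows "\<bar>pairing f g\<bar> \<le> L2_norm f * L2_norm g"
proof -
  have "\<bar>pairing f g\<bar> \<le> (LINT x|lborel. norm (f x) * norm (g x))"
    unfolding pairing_def real_norm_def[symmetric]
    by (rule Bochner_Integration.integral_norm_bound_integral)
       (use assms in \<open>auto simp: L2_integrable_inner L2_integrable_norm_mult Cauchy_Schwarz_ineq2\<close>)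
  then show ?thesis using L2_integrable_norm_mult(2)[OF assms] by linarith
qed

lemma L2_scaleR:
  assumes [measurable]: "f \<in> L2"
  shows "(\<lambda>x. c *\<^sub>R f x) \<in> L2"
  using L2_integrable[OF assms] by (intro L2_I) (auto simp: power_mult_distrib)

lemma L2_add:
  assumes [measurable]: "f \<in> L2" "g \<in> L2"
  shows "(\<lambda>x. f x + g x) \<in> L2"
proof (rule L2_I)
  show "integrable lborel (\<lambda>x. (norm (f x + g x))\<^sup>2)"
    unfolding power2_norm_eq_inner inner_add_left inner_add_right
    using assms by (auto intro!: Bochner_Integration.integrable_add L2_integrable_inner)
qed simp

lemma L2_diff:
  assumes "f \<in> L2" "g \<in> L2"
  shows "(\<lambda>x. f x - g x) \<in> L2"
  using L2_add[OF assms(1) L2_scaleR[OF assms(2), of "-1"]] by simp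

lemma pairing_commute: "pairing f g = pairing g f"
  by (simp add: pairing_def inner_commute)

lemma pairing_diff_left:
  "\<lbrakk>f \<in> L2; g \<in> L2; h \<in> L2\<rbrakk> \<Longrightarrow> pairing (\<lambda>x. f x - g x) h = pairing f h - pairing g h"
  unfolding pairing_def inner_diff_left
  by (rule Bochner_Integration.integral_diff) (auto simp: L2_integrable_inner)

lemma pairing_diff_right:
  "\<lbrakk>f \<in> L2; g \<in> L2; h \<in> L2\<rbrakk> \<Longrightarrow> pairing h (\<lambda>x. f x - g x) = pairing h f - pairing h g"
  unfolding pairing_commute[of h] by (rule pairing_diff_left)

lemma pairing_scaleR_right: "pairing f (\<lambda>x. c *\<^sub>R g x) = c * pairing f g"
  by (simp add: pairing_def)

lemma L2_norm_scaleR: "L2_norm (\<lambda>x. c *\<^sub>R f x) = \<bar>c\<bar> * L2_norm f"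
  by (simp add: L2_norm_def power_mult_distrib real_sqrt_mult)

text \<open>Expand \<open>pairing f f\<close> along f = (f - g) + g, apply Cauchy-Schwarz to both
  terms and divide by \<open>L2_norm f\<close>.\<close>

lemma L2_norm_triangle:
  assumes "f \<in> L2" "g \<in> L2"
  shows "L2_norm f \<le> L2_norm (\<lambda>x. f x - g x) + L2_norm g"
proof -
  let ?h = "\<lambda>x. f x - g x"
  have h: "?h \<in> L2" using assms by (rule L2_diff)
  have "(L2_norm f)\<^sup>2 = pairing f f" by (rule L2_norm_sq_pairing)
  also have "\<dots> = pairing ?h f + pairing g f"
    using assms by (simp add: pairing_diff_left)
  also have "\<dots> \<le> (L2_norm ?h + L2_norm g) * L2_norm f"
    using abs_pairing_le[OF h assms(1)] abs_pairing_le[OF assms(2,1)]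
    by (simp add: distrib_right)
  finally have *: "L2_norm f * L2_norm f \<le> (L2_norm ?h + L2_norm g) * L2_norm f"
    by (simp add: power2_eq_square)
  then show ?thesis
    by (cases "L2_norm f = 0") (auto simp: less_le)
qed

lemma integrable_bounded_support:
  fixes f :: "'a::euclidean_space \<Rightarrow> 'b::{banach,second_countable_topology}"
  assumes "f \<in> borel_measurable borel" "\<And>x. norm (f x) \<le> C" "\<And>x. norm x > R \<Longrightarrow> f x = 0"
  shows "integrable lborel f"
proof (rule Bochner_Integration.integrable_bound)
  show "integrable lborel (\<lambda>x::'a. C * indicator (cball 0 R) x :: real)"
    by (intro integrable_mult_right integrable_real_indicator)
       (use emeasure_lborel_cball_finite[of "0::'a" R] in \<open>auto simp: less_top\<close>)
  show "AE x in lborel. norm (f x) \<le> norm (C * indicator (cball 0 R) x :: real)"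
  proof (rule AE_I2)
    fix x
    show "norm (f x) \<le> norm (C * indicator (cball 0 R) x :: real)"
      using assms(2)[of x] assms(3)[of x] by (cases "norm x > R") auto
  qed
qed (use assms in simp)

lemma L2_bounded_support:
  assumes [measurable]: "f \<in> borel_measurable borel"
    and C: "\<And>x. norm (f x) \<le> C" and R: "\<And>x. norm x > R \<Longrightarrow> f x = 0"
  shows "f \<in> L2"
proof (rule L2_I)
  show "integrable lborel (\<lambda>x. (norm (f x))\<^sup>2)"
    by (rule integrable_bounded_support[where C="C\<^sup>2" and R=R])
       (use R in \<open>auto intro!: power_mono C\<close>)
qed simp

section \<open>Completeness of \<open>L2\<close> and uniform boundedness\<close>

lemma L2_norm_add_le:
  assumes "f \<in> L2" "g \<in> L2"
  shows "L2_norm (\<lambda>x. f x + g x) \<le> L2_norm f + L2_norm g"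
  using L2_norm_triangle[OF L2_add[OF assms] assms(2)] by simp

text \<open>The right-hand side is the exact geometric sum from \<open>n\<close> to
  \<open>m - 1\<close>. Keeping the subtracted term is what lets the induction close; it is dropped
  only on use.\<close>

lemma L2_tail_bound:
  assumes x: "\<And>n. x n \<in> L2" and d: "\<And>n. L2_norm (\<lambda>y. x (Suc n) y - x n y) \<le> (1/3)^n"
    and "n \<le> m"
  shows "L2_norm (\<lambda>y. x m y - x n y) \<le> 3/2 * (1/3)^n - 3/2 * (1/3)^m"
  using \<open>n \<le> m\<close>
proof (induction m rule: dec_induct)
  case base
  then show ?case by (simp add: L2_norm_def)
next
  case (step m)
  have "L2_norm (\<lambda>y. x (Suc m) y - x n y)
      \<le> L2_norm (\<lambda>y. x (Suc m) y - x m y) + L2_norm (\<lambda>y. x m y - x n y)"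
    using L2_norm_add_le[OF L2_diff[OF x x] L2_diff[OF x x], of "Suc m" m m n] by simp
  also have "\<dots> \<le> (1/3)^m + (3/2 * (1/3)^n - 3/2 * (1/3)^m)"
    using d[of m] step.IH by linarith
  also have "\<dots> = 3/2 * (1/3)^n - 3/2 * (1/3)^Suc m"
    by simp
  finally show ?case .
qed

text \<open>The Riesz-Fischer argument. The squared increments have integral at most (1/9)^n, so
  they stay summable after multiplication by 3^n. The weighted sum is thus finite almost everywhere,
  and there the telescoping series converges absolutely. The limit is a Borel function, as
  representatives require.\<close>

lemma L2_complete_geometric:
  assumes x: "\<And>n. x n \<in> L2" and d: "\<And>n. L2_norm (\<lambda>y. x (Suc n) y - x n y) \<le> (1/3)^n"
  obtains \<phi> where "\<phi> \<in> L2" "\<And>n. L2_norm (\<lambda>y. \<phi> y - x n y) \<le> 3/2 * (1/3)^n"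
proof -
  note [measurable] = L2_measurable[OF x]
  define \<phi> where "\<phi> y = lim (\<lambda>n. x n y)" for y
  have [measurable]: "\<phi> \<in> borel_measurable borel"
    unfolding \<phi>_def[abs_def] by (rule borel_measurable_lim_metric) simp
  have "(\<integral>\<^sup>+y. (\<Sum>n. ennreal (3^n * (norm (x (Suc n) y - x n y))\<^sup>2)) \<partial>lborel)
      = (\<Sum>n. \<integral>\<^sup>+y. ennreal (3^n * (norm (x (Suc n) y - x n y))\<^sup>2) \<partial>lborel)"
    by (rule nn_integral_suminf) simp
  also have "\<dots> \<le> (\<Sum>n. ennreal ((1/3)^n))"
  proof (rule suminf_le)
    fix n
    have "(\<integral>\<^sup>+y. ennreal (3^n * (norm (x (Suc n) y - x n y))\<^sup>2) \<partial>lborel)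
        = ennreal (3^n * (L2_norm (\<lambda>y. x (Suc n) y - x n y))\<^sup>2)"
      unfolding L2_norm_sq using L2_integrable[OF L2_diff[OF x x, of "Suc n" n]]
      by (subst nn_integral_eq_integral) (auto simp: less_imp_le)
    also have "\<dots> \<le> ennreal (3^n * ((1/3)^n)\<^sup>2)"
      by (intro ennreal_leI mult_left_mono power_mono d) auto
    also have "3^n * ((1/3)^n)\<^sup>2 = (1/3::real)^n"
      by (simp add: power2_eq_square flip: power_mult_distrib)
    finally show "(\<integral>\<^sup>+y. ennreal (3^n * (norm (x (Suc n) y - x n y))\<^sup>2) \<partial>lborel) \<le> ennreal ((1/3)^n)" .
  qed auto
  also have "\<dots> < \<infinity>"
    by (subst suminf_ennreal2) (auto simp: summable_geometric)
  finally have fin: "(\<integral>\<^sup>+y. (\<Sum>n. ennreal (3^n * (norm (x (Suc n) y - x n y))\<^sup>2)) \<partial>lborel) \<noteq> \<infinity>"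
    by simp
  have "AE y in lborel. (\<Sum>n. ennreal (3^n * (norm (x (Suc n) y - x n y))\<^sup>2)) \<noteq> \<infinity>"
    by (rule nn_integral_PInf_AE[OF _ fin]) simp
  then have ae: "AE y in lborel. (\<lambda>n. x n y) \<longlonglongrightarrow> \<phi> y"
  proof (rule AE_mp, intro AE_I2 impI)
    fix y
    assume "(\<Sum>n. ennreal (3^n * (norm (x (Suc n) y - x n y))\<^sup>2)) \<noteq> \<infinity>"
    then have s: "summable (\<lambda>n. 3^n * (norm (x (Suc n) y - x n y))\<^sup>2)"
      by (intro summable_suminf_not_top) (auto simp: top_ennreal_def)
    have "summable (\<lambda>n. x (Suc n) y - x n y)"
    proof (rule summable_norm_cancel, rule summable_comparison_test')
      show "summable (\<lambda>n. (1/3)^n + 3^n * (norm (x (Suc n) y - x n y))\<^sup>2)"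
        by (intro summable_add s summable_geometric) simp
      fix n :: nat
      let ?a = "norm (x (Suc n) y - x n y)"
      have "1 = (1/3)^n * (3::real)^n" by (simp flip: power_mult_distrib)
      \<comment> \<open>Follows from (3^n a - 1)^2 >= 0, and turns weighted square summability into
        absolute summability.\<close>
      then have "?a \<le> (1/3)^n + 3^n * ?a\<^sup>2"
      proof -
        let ?q = "(3::real)^n"
        have q: "0 < ?q" "(1/3)^n = 1 / ?q" by (simp_all add: power_one_over)
        have "0 \<le> (?q * ?a - 1)\<^sup>2" by simp
        then have "2 * ?q * ?a \<le> ?q\<^sup>2 * ?a\<^sup>2 + 1"
          by (simp add: power2_eq_square algebra_simps)
        moreover have "0 \<le> ?q * ?a" by simp
        ultimately have "?q * ?a \<le> ?q\<^sup>2 * ?a\<^sup>2 + 1" by linarith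
        then show ?thesis using q by (simp add: field_simps power2_eq_square)
      qed
      then show "norm ?a \<le> (1/3)^n + 3^n * ?a\<^sup>2" by simp
    qed
    then have "convergent (\<lambda>n. \<Sum>k<n. x (Suc k) y - x k y)"
      by (simp add: summable_iff_convergent)
    then have "convergent (\<lambda>n. x n y - x 0 y)"
      by (simp only: sum_lessThan_telescope[of "\<lambda>k. x k y"])
    then have "convergent (\<lambda>n. x n y - x 0 y + x 0 y)"
      by (rule convergent_add[OF _ convergent_const])
    then show "(\<lambda>n. x n y) \<longlonglongrightarrow> \<phi> y"
      by (simp add: \<phi>_def convergent_LIMSEQ_iff)
  qed
  \<comment> \<open>Fatou's lemma in \<open>m\<close> for fixed \<open>n\<close>: the tail bound
    does not depend on \<open>m\<close>.\<close>
  have bound: "(\<integral>\<^sup>+y. ennreal ((norm (\<phi> y - x n y))\<^sup>2) \<partial>lborel) \<le> ennreal ((3/2 * (1/3)^n)\<^sup>2)" for n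
  proof -
    have "(\<integral>\<^sup>+y. ennreal ((norm (\<phi> y - x n y))\<^sup>2) \<partial>lborel)
        = (\<integral>\<^sup>+y. liminf (\<lambda>m. ennreal ((norm (x m y - x n y))\<^sup>2)) \<partial>lborel)"
    proof (rule nn_integral_cong_AE, use ae in eventually_elim)
      fix y assume "(\<lambda>m. x m y) \<longlonglongrightarrow> \<phi> y"
      then have "(\<lambda>m. ennreal ((norm (x m y - x n y))\<^sup>2)) \<longlonglongrightarrow> ennreal ((norm (\<phi> y - x n y))\<^sup>2)"
        by (intro tendsto_ennrealI tendsto_intros)
      then show "ennreal ((norm (\<phi> y - x n y))\<^sup>2) = liminf (\<lambda>m. ennreal ((norm (x m y - x n y))\<^sup>2))"
        by (rule lim_imp_Liminf[OF sequentially_bot, symmetric])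
    qed
    also have "\<dots> \<le> liminf (\<lambda>m. \<integral>\<^sup>+y. ennreal ((norm (x m y - x n y))\<^sup>2) \<partial>lborel)"
      by (rule nn_integral_liminf) simp
    also have "\<dots> \<le> ennreal ((3/2 * (1/3)^n)\<^sup>2)"
    proof (rule Liminf_le[OF sequentially_bot], rule eventually_sequentiallyI[of n])
      fix m assume "n \<le> m"
      have "(\<integral>\<^sup>+y. ennreal ((norm (x m y - x n y))\<^sup>2) \<partial>lborel) = ennreal ((L2_norm (\<lambda>y. x m y - x n y))\<^sup>2)"
        unfolding L2_norm_sq using L2_integrable[OF L2_diff[OF x x, of m n]]
        by (subst nn_integral_eq_integral) auto
      also have "\<dots> \<le> ennreal ((3/2 * (1/3)^n)\<^sup>2)"
      proof (intro ennreal_leI power_mono L2_norm_nonneg)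
        have "0 \<le> 3/2 * (1/3::real)^m" by simp
        then show "L2_norm (\<lambda>y. x m y - x n y) \<le> 3/2 * (1/3)^n"
          using L2_tail_bound[of x, OF x d \<open>n \<le> m\<close>] by linarith
      qed
      finally show "(\<integral>\<^sup>+y. ennreal ((norm (x m y - x n y))\<^sup>2) \<partial>lborel) \<le> ennreal ((3/2 * (1/3)^n)\<^sup>2)" .
    qed
    finally show ?thesis .
  qed
  have diff: "(\<lambda>y. \<phi> y - x n y) \<in> L2" for n
  proof (rule L2_I)
    have "(\<integral>\<^sup>+y. ennreal ((norm (\<phi> y - x n y))\<^sup>2) \<partial>lborel) < \<infinity>"
      using bound[of n] by (rule order_le_less_trans) simp
    then show "integrable lborel (\<lambda>y. (norm (\<phi> y - x n y))\<^sup>2)"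
      by (intro integrableI_nonneg) auto
  qed simp
  show thesis
  proof
    show "\<phi> \<in> L2" using L2_add[OF diff[of 0] x[of 0]] by simp
    fix n
    have "ennreal ((L2_norm (\<lambda>y. \<phi> y - x n y))\<^sup>2) = (\<integral>\<^sup>+y. ennreal ((norm (\<phi> y - x n y))\<^sup>2) \<partial>lborel)"
      unfolding L2_norm_sq using L2_integrable[OF diff[of n]]
      by (subst nn_integral_eq_integral) auto
    then have "ennreal ((L2_norm (\<lambda>y. \<phi> y - x n y))\<^sup>2) \<le> ennreal ((3/2 * (1/3)^n)\<^sup>2)"
      using bound[of n] by (simp only:)
    then have "(L2_norm (\<lambda>y. \<phi> y - x n y))\<^sup>2 \<le> (3/2 * (1/3)^n)\<^sup>2"
      by (simp only: ennreal_le_iff zero_le_power2)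
    then show "L2_norm (\<lambda>y. \<phi> y - x n y) \<le> 3/2 * (1/3)^n"
      by (rule power2_le_imp_le) simp
  qed
qed

text \<open>The elementary (Baire-free) argument of Sokal for the uniform boundedness principle.\<close>

lemma L2_uniform_boundedness:
  assumes u: "\<And>i. i \<in> S \<Longrightarrow> u i \<in> L2"
    and bdd: "\<And>\<phi>. \<phi> \<in> L2 \<Longrightarrow> \<exists>C. \<forall>i\<in>S. \<bar>pairing (u i) \<phi>\<bar> \<le> C"
  shows "\<exists>M. \<forall>i\<in>S. L2_norm (u i) \<le> M"
proof (rule ccontr)
  assume "\<not> ?thesis"
  \<comment> \<open>The growth has to beat 3^n, because step \<open>n\<close> of the construction
    below moves by (1/3)^n only and must still produce a pairing of size about n + 1.\<close>
  then have "\<forall>n. \<exists>i\<in>S. L2_norm (u i) > real (Suc n) * 3^n"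
    by (meson not_le)
  then obtain \<iota> where \<iota>: "\<And>n. \<iota> n \<in> S" "\<And>n. L2_norm (u (\<iota> n)) > real (Suc n) * 3^n"
    by metis
  define v where "v n = u (\<iota> n)" for n
  have v: "v n \<in> L2" and nv: "L2_norm (v n) > real (Suc n) * 3^n" for n
    using \<iota> u by (auto simp: v_def)
  have pos: "0 < L2_norm (v n)" for n
    using nv[of n] by (rule le_less_trans[rotated]) simp
  \<comment> \<open>The step along \<open>v n\<close> has norm (1/3)^n, and its sign agrees with
    that of the pairing already present, so the new contribution cannot be cancelled by the earlier
    ones.\<close>
  define c where "c n f = (if 0 \<le> pairing (v n) f then 1 else -1) * (1/3)^n / L2_norm (v n)" for n f
  define x where "x = rec_nat (\<lambda>_. 0) (\<lambda>n f y. f y + c n f *\<^sub>R v n y)"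
  have x0: "x 0 = (\<lambda>_. 0)" and xS: "x (Suc n) = (\<lambda>y. x n y + c n (x n) *\<^sub>R v n y)" for n
    by (simp_all add: x_def)
  have x: "x n \<in> L2" for n
    by (induction n) (auto simp: x0 xS intro!: L2_add L2_scaleR v L2_bounded_support[where C=0])
  have "L2_norm (\<lambda>y. x (Suc n) y - x n y) \<le> (1/3)^n" for n
    using pos[of n] by (simp add: xS L2_norm_scaleR c_def abs_mult)
  then obtain \<phi> where \<phi>: "\<phi> \<in> L2" and close: "\<And>n. L2_norm (\<lambda>y. \<phi> y - x n y) \<le> 3/2 * (1/3)^n"
    using L2_complete_geometric[of x] x by blast
  obtain C where C: "\<And>n. \<bar>pairing (v n) \<phi>\<bar> \<le> C"
    using bdd[OF \<phi>] \<iota>(1) unfolding v_def by blast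
  have big: "real (Suc n) / 2 \<le> C" for n
  proof -
    let ?N = "L2_norm (v n)"
    have "pairing (v n) (x (Suc n)) = pairing (v n) (x n) + c n (x n) * ?N\<^sup>2"
    proof -
      have "pairing (v n) (\<lambda>y. x (Suc n) y - x n y) = c n (x n) * ?N\<^sup>2"
        by (simp add: xS pairing_scaleR_right L2_norm_sq_pairing)
      then show ?thesis using v x by (simp add: pairing_diff_right)
    qed
    moreover have "c n (x n) * ?N\<^sup>2 = (if 0 \<le> pairing (v n) (x n) then 1 else -1) * ((1/3)^n * ?N)"
      using pos[of n] by (simp add: c_def power2_eq_square)
    moreover have "0 \<le> (1/3)^n * ?N" by simp
    ultimately have "(1/3)^n * ?N \<le> \<bar>pairing (v n) (x (Suc n))\<bar>"
      by (auto split: if_splits)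
    \<comment> \<open>All later steps together move by at most 3/2 * (1/3)^(n+1), half of step
      \<open>n\<close>, so they destroy at most half of what step \<open>n\<close> achieved.\<close>
    moreover have "\<bar>pairing (v n) \<phi> - pairing (v n) (x (Suc n))\<bar> \<le> ?N * (1/2 * (1/3)^n)"
    proof -
      have "\<bar>pairing (v n) (\<lambda>y. \<phi> y - x (Suc n) y)\<bar> \<le> ?N * L2_norm (\<lambda>y. \<phi> y - x (Suc n) y)"
        by (intro abs_pairing_le v L2_diff \<phi> x)
      also have "\<dots> \<le> ?N * (1/2 * (1/3)^n)"
        by (intro mult_left_mono) (use close[of "Suc n"] in auto)
      finally show ?thesis using v x \<phi> by (simp add: pairing_diff_right)
    qed
    moreover have "?N * (1/2 * (1/3)^n) = (1/3)^n * ?N / 2" by simp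
    ultimately have "(1/3)^n * ?N / 2 \<le> C" using C[of n] by linarith
    moreover have "real (Suc n) \<le> (1/3)^n * ?N"
      using nv[of n] by (simp add: power_one_over field_simps)
    ultimately show ?thesis
      by (meson divide_right_mono order_trans zero_le_numeral)
  qed
  obtain n :: nat where "2 * C < n" using reals_Archimedean2 by blast
  with big[of n] show False by simp
qed

lemma C_weak_L2: "\<lbrakk>u \<in> C_weak T; t \<in> {0..T}\<rbrakk> \<Longrightarrow> u t \<in> L2"
  by (auto simp: C_weak_def H_sigma_def)

text \<open>Compactness of \<open>{0..T}\<close> bounds each single pairing; uniform boundedness
  upgrades this to the norms. The resulting \<open>M\<close> enters every majorant in time
  below.\<close>

lemma C_weak_bounded:
  assumes "u \<in> C_weak T"
  shows "\<exists>M. \<forall>t\<in>{0..T}. L2_norm (u t) \<le> M"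
proof (rule L2_uniform_boundedness)
  fix \<phi> assume "\<phi> \<in> L2"
  then have "continuous_on {0..T} (\<lambda>t. pairing (u t) \<phi>)"
    using assms by (auto simp: C_weak_def)
  then have "bounded ((\<lambda>t. pairing (u t) \<phi>) ` {0..T})"
    by (intro compact_imp_bounded compact_continuous_image) auto
  then show "\<exists>C. \<forall>t\<in>{0..T}. \<bar>pairing (u t) \<phi>\<bar> \<le> C"
    by (auto simp: bounded_iff)
qed (use assms C_weak_L2 in auto)

section \<open>Quadratic forms along a weakly continuous curve\<close>

lemma tensor_inner: "tensor f g x \<bullet> M = f x \<bullet> (M *v g x)"
  by (simp add: tensor_def inner_vec_def matrix_vector_mult_def sum_distrib_left mult_ac)

lemma norm_tensor: "norm (tensor f g x) = norm (f x) * norm (g x)"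
proof -
  have "tensor f g x \<bullet> tensor f g x = (f x \<bullet> f x) * (g x \<bullet> g x)"
    by (simp add: tensor_def inner_vec_def sum_product mult_ac)
  then have "(norm (tensor f g x))\<^sup>2 = (norm (f x) * norm (g x))\<^sup>2"
    by (simp add: power2_norm_eq_inner power_mult_distrib)
  then show ?thesis by simp
qed

text \<open>\<open>norm\<close> on \<open>real^3^3\<close> is the Frobenius norm. Pairing
  \<open>M\<close> with the rank-one matrix formed from \<open>M *v y\<close> and \<open>y\<close>
  gives the square of the norm of \<open>M *v y\<close>; apply Cauchy-Schwarz and divide.\<close>

lemma norm_matrix_vector_le: "norm (M *v (y::real^3)) \<le> norm (M::real^3^3) * norm y"
proof -
  have "(norm (M *v y))\<^sup>2 = tensor (\<lambda>_. M *v y) (\<lambda>_. y) 0 \<bullet> M"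
    by (simp add: tensor_inner power2_norm_eq_inner)
  also have "\<dots> \<le> norm (M *v y) * norm y * norm M"
    by (metis norm_cauchy_schwarz norm_tensor)
  finally show ?thesis
    by (cases "norm (M *v y) = 0") (auto simp: power2_eq_square less_le mult_ac)
qed

lemma norm_vector_matrix_le: "norm ((y::real^3) v* (M::real^3^3)) \<le> norm M * norm y"
proof -
  have "(norm (y v* M))\<^sup>2 = tensor (\<lambda>_. y) (\<lambda>_. y v* M) 0 \<bullet> M"
    by (simp add: tensor_inner power2_norm_eq_inner dot_lmul_matrix)
  also have "\<dots> \<le> norm y * norm (y v* M) * norm M"
    by (metis norm_cauchy_schwarz norm_tensor)
  finally show ?thesis
    by (cases "norm (y v* M) = 0") (auto simp: power2_eq_square less_le mult_ac)
qed

lemma borel_measurable_matrix_vector [measurable]: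
  fixes A :: "'a \<Rightarrow> real^3^3"
  assumes [measurable]: "A \<in> borel_measurable M" "f \<in> borel_measurable M"
  shows "(\<lambda>x. A x *v f x) \<in> borel_measurable M" "(\<lambda>x. f x v* A x) \<in> borel_measurable M"
proof -
  have c: "(\<lambda>x. f x $ i) \<in> borel_measurable M" "(\<lambda>x. A x $ i $ j) \<in> borel_measurable M" for i j
    by (auto intro!: borel_measurable_continuous_on[of "\<lambda>y. y $ i" f]
          borel_measurable_continuous_on[of "\<lambda>y. y $ i $ j" A] continuous_intros)
  have v: "f \<in> borel_measurable M" if "\<And>i. (\<lambda>x. f x $ i) \<in> borel_measurable M" for f :: "'a \<Rightarrow> real^3"
    using that by (subst borel_measurable_euclidean_space) (auto simp: Basis_vec_def inner_axis)
  show "(\<lambda>x. A x *v f x) \<in> borel_measurable M" "(\<lambda>x. f x v* A x) \<in> borel_measurable M"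
    by (rule v; simp add: matrix_vector_mult_def vector_matrix_mult_def;
        intro borel_measurable_sum borel_measurable_times c)+
qed

lemma L2_bounded_matrix:
  assumes [measurable]: "A \<in> borel_measurable borel" "f \<in> L2" and c: "\<And>x. norm (A x) \<le> c"
  shows "(\<lambda>x. A x *v f x) \<in> L2" "(\<lambda>x. f x v* A x) \<in> L2"
proof -
  have c0: "0 \<le> c" using c[of 0] norm_ge_zero order_trans by blast
  have *: "g \<in> L2" if "g \<in> borel_measurable borel" "\<And>x. norm (g x) \<le> norm (A x) * norm (f x)" for g
  proof (rule L2_I)
    show "integrable lborel (\<lambda>x. (norm (g x))\<^sup>2)"
    proof (rule Bochner_Integration.integrable_bound)
      show "integrable lborel (\<lambda>x. c\<^sup>2 * (norm (f x))\<^sup>2)"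
        using L2_integrable[OF assms(2)] by simp
      have "norm (g x) \<le> c * norm (f x)" for x
        using that(2)[of x] mult_right_mono[OF c[of x], of "norm (f x)"] by simp
      then show "AE x in lborel. norm ((norm (g x))\<^sup>2) \<le> norm (c\<^sup>2 * (norm (f x))\<^sup>2)"
        by (auto simp: c0 intro!: power_mono simp flip: power_mult_distrib)
    qed (use that in simp)
  qed (fact that)
  show "(\<lambda>x. A x *v f x) \<in> L2" "(\<lambda>x. f x v* A x) \<in> L2"
    by (rule *, simp, rule norm_matrix_vector_le norm_vector_matrix_le)+
qed

text \<open>A nonnegative quadratic form is the supremum of its affine minorants
  \<open>b (\<cdot>, g) - q g\<close>, hence weakly lower semicontinuous.\<close>

lemma quadratic_form_borel_nonneg:
  fixes A :: "real^3 \<Rightarrow> real^3^3"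
  assumes u: "u \<in> C_weak T" and A[measurable]: "A \<in> borel_measurable borel"
    and c: "\<And>x. norm (A x) \<le> c" and d: "c \<le> d"
  shows "(\<lambda>\<tau>. LINT x|lborel. u \<tau> x \<bullet> (A x *v u \<tau> x) + d * (u \<tau> x \<bullet> u \<tau> x))
    \<in> borel_measurable (restrict_space borel {0..T})"
proof -
  define q where "q f = (LINT x|lborel. f x \<bullet> (A x *v f x) + d * (f x \<bullet> f x))" for f
  \<comment> \<open>The gradient of the form at \<open>g\<close>. The matrix need not be symmetric,
    so both \<open>A\<close> and its transpose act on \<open>g\<close>.\<close>
  define w where "w g x = A x *v g x + g x v* A x + (2 * d) *\<^sub>R g x" for g x
  have int: "integrable lborel (\<lambda>x. f x \<bullet> (A x *v f x) + d * (f x \<bullet> f x))" if "f \<in> L2" for f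
    using that by (intro Bochner_Integration.integrable_add integrable_mult_right
      L2_integrable_inner L2_bounded_matrix[OF A _ c])
  have w: "w g \<in> L2" if "g \<in> L2" for g
    unfolding w_def[abs_def] by (intro L2_add L2_scaleR L2_bounded_matrix[OF A _ c] that)
  have alg: "f x \<bullet> w g x = (f x \<bullet> (A x *v f x) + d * (f x \<bullet> f x)) + (g x \<bullet> (A x *v g x) + d * (g x \<bullet> g x))
      - ((f x - g x) \<bullet> (A x *v (f x - g x)) + d * ((f x - g x) \<bullet> (f x - g x)))" for f g x
  proof -
    have "f x \<bullet> (g x v* A x) = g x \<bullet> (A x *v f x)"
      by (metis dot_lmul_matrix inner_commute)
    then show ?thesis
      by (simp add: w_def matrix_vector_mult_diff_distrib inner_diff_left inner_diff_right
          inner_add_right inner_commute algebra_simps)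
  qed
  have pos: "0 \<le> y \<bullet> (A x *v y) + d * (y \<bullet> y)" for x y
  proof -
    have "\<bar>y \<bullet> (A x *v y)\<bar> \<le> norm y * (norm (A x) * norm y)"
      by (rule order_trans[OF Cauchy_Schwarz_ineq2]) (intro mult_left_mono norm_matrix_vector_le norm_ge_zero)
    also have "\<dots> = norm (A x) * (norm y * norm y)" by simp
    also have "\<dots> \<le> d * (norm y * norm y)"
      using c[of x] d by (intro mult_right_mono) auto
    finally show ?thesis by (simp add: dot_square_norm power2_eq_square)
  qed
  have le: "pairing f (w g) - q g \<le> q f" if "f \<in> L2" "g \<in> L2" for f g
  proof -
    have "pairing f (w g) \<le> (LINT x|lborel. (f x \<bullet> (A x *v f x) + d * (f x \<bullet> f x))
        + (g x \<bullet> (A x *v g x) + d * (g x \<bullet> g x)))"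
      unfolding pairing_def
    proof (rule integral_mono)
      show "f x \<bullet> w g x \<le> (f x \<bullet> (A x *v f x) + d * (f x \<bullet> f x))
          + (g x \<bullet> (A x *v g x) + d * (g x \<bullet> g x))" for x
        using pos[of "f x - g x" x] unfolding alg by linarith
    qed (use that in \<open>auto intro!: Bochner_Integration.integrable_add int L2_integrable_inner w
          simp del: inner_diff_left\<close>)
    also have "\<dots> = q f + q g"
      unfolding q_def by (rule Bochner_Integration.integral_add[OF int int]) (fact that)+
    finally have "pairing f (w g) \<le> q f + q g" .
    then show ?thesis by simp
  qed
  have eq: "pairing f (w f) - q f = q f" if "f \<in> L2" for f
  proof -
    have "pairing f (w f) = q f + q f"
      unfolding pairing_def q_def
      by (subst Bochner_Integration.integral_add[symmetric]) (use that in \<open>auto intro!: int simp: alg\<close>)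
    then show ?thesis by simp
  qed
  have "q \<circ> u \<in> borel_measurable (restrict_space borel {0..T})"
    unfolding borel_measurable_iff_greater
  proof
    fix a
    let ?O = "\<lambda>g. {\<tau>\<in>{0..T}. pairing (u \<tau>) (w g) \<in> {a + q g<..}}"
    have uL: "u \<tau> \<in> L2" if "\<tau> \<in> {0..T}" for \<tau> using u that by (auto simp: C_weak_def H_sigma_def)
    have "openin (top_of_set {0..T}) (?O g)" if "g \<in> L2" for g
      using u w[OF that] by (intro continuous_openin_preimage_gen[of "{0..T}" _ "{a + q g<..}", unfolded vimage_def Int_def mem_Collect_eq])
        (auto simp: C_weak_def)
    then have "openin (top_of_set {0..T}) (\<Union>g\<in>L2. ?O g)" by blast
    moreover have "{\<tau>\<in>{0..T}. a < q (u \<tau>)} = (\<Union>g\<in>L2. ?O g)"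
    proof (intro equalityI subsetI)
      fix \<tau> assume "\<tau> \<in> {\<tau>\<in>{0..T}. a < q (u \<tau>)}"
      then show "\<tau> \<in> (\<Union>g\<in>L2. ?O g)"
        using eq[OF uL, of \<tau>] uL[of \<tau>] by (intro UN_I[of "u \<tau>"]) auto
    next
      fix \<tau> assume "\<tau> \<in> (\<Union>g\<in>L2. ?O g)"
      then show "\<tau> \<in> {\<tau>\<in>{0..T}. a < q (u \<tau>)}"
        using le[OF uL] by fastforce
    qed
    ultimately have "{\<tau>\<in>{0..T}. a < q (u \<tau>)} \<in> sets (restrict_space borel {0..T})"
      by (auto simp: openin_open sets_restrict_space)
    then show "{\<tau> \<in> space (restrict_space borel {0..T}). a < (q \<circ> u) \<tau>} \<in> sets (restrict_space borel {0..T})"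
      by (simp add: space_restrict_space)
  qed
  then show ?thesis by (simp add: q_def[abs_def] comp_def)
qed

text \<open>Adding \<open>c\<close> times the energy makes the form nonnegative. The energy is
  itself such a form, with zero matrix and factor 1, so both are Borel in time and so is their
  difference.\<close>

lemma quadratic_form_borel:
  fixes A :: "real^3 \<Rightarrow> real^3^3"
  assumes u: "u \<in> C_weak T" and A[measurable]: "A \<in> borel_measurable borel"
    and c: "\<And>x. norm (A x) \<le> c"
  shows "(\<lambda>\<tau>. indicator {0..T} \<tau> * pairing (tensor (u \<tau>) (u \<tau>)) A) \<in> borel_measurable borel"
proof -
  let ?R = "restrict_space borel {0..T}"
  have "(\<lambda>\<tau>. LINT x|lborel. u \<tau> x \<bullet> (0 *v u \<tau> x) + 1 * (u \<tau> x \<bullet> u \<tau> x)) \<in> borel_measurable ?R"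
    by (rule quadratic_form_borel_nonneg[OF u, of "\<lambda>_. 0" 0]) auto
  then have 1: "(\<lambda>\<tau>. pairing (u \<tau>) (u \<tau>)) \<in> borel_measurable ?R"
    by (simp add: pairing_def)
  have "(\<lambda>\<tau>. (LINT x|lborel. u \<tau> x \<bullet> (A x *v u \<tau> x) + c * (u \<tau> x \<bullet> u \<tau> x))
      - c * pairing (u \<tau>) (u \<tau>)) \<in> borel_measurable ?R"
    by (intro borel_measurable_diff borel_measurable_times borel_measurable_const 1
        quadratic_form_borel_nonneg[OF u A c order_refl])
  also have "?this \<longleftrightarrow> (\<lambda>\<tau>. pairing (tensor (u \<tau>) (u \<tau>)) A) \<in> borel_measurable ?R"
  proof (rule measurable_cong)
    fix \<tau> assume "\<tau> \<in> space ?R"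
    then have uL: "u \<tau> \<in> L2" using u by (auto simp: C_weak_def H_sigma_def space_restrict_space)
    then show "(LINT x|lborel. u \<tau> x \<bullet> (A x *v u \<tau> x) + c * (u \<tau> x \<bullet> u \<tau> x))
      - c * pairing (u \<tau>) (u \<tau>) = pairing (tensor (u \<tau>) (u \<tau>)) A"
      by (subst Bochner_Integration.integral_add)
         (auto simp: pairing_def tensor_inner intro!: L2_integrable_inner L2_bounded_matrix[OF A _ c])
  qed
  finally show ?thesis by (simp add: borel_measurable_restrict_space_iff)
qed

section \<open>Increments along the diagonal of a symmetric function of two times\<close>

lemma set_lebesgue_integral_Ioc:
  fixes f :: "real \<Rightarrow> real"
  assumes f: "set_integrable lborel {0..t} f" and ab: "0 \<le> a" "a \<le> b" "b \<le> t"
  shows "(LINT \<tau>:{0..b}|lborel. f \<tau>) - (LINT \<tau>:{0..a}|lborel. f \<tau>) = (LINT \<tau>:{a<..b}|lborel. f \<tau>)"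
proof -
  have "set_integrable lborel {0..a} f" "set_integrable lborel {a<..b} f"
    using ab by (auto intro!: set_integrable_subset[OF f])
  then have "(LINT \<tau>:{0..a} \<union> {a<..b}|lborel. f \<tau>)
      = (LINT \<tau>:{0..a}|lborel. f \<tau>) + (LINT \<tau>:{a<..b}|lborel. f \<tau>)"
    by (intro set_integral_Un) auto
  moreover have "{0..a} \<union> {a<..b} = {0..b}" using ab by auto
  ultimately show ?thesis by simp
qed

text \<open>Chain rule for \<open>s \<mapsto> F s s\<close> without any regularity of \<open>F\<close> in both variables jointly: by
  symmetry the increments of \<open>F\<close> along the diagonal are sums of increments in the first variable.\<close>

lemma symmetric_diagonal_increment:
  fixes F q :: "real \<Rightarrow> real \<Rightarrow> real"
  assumes t: "0 < t"
    and sym: "\<And>a b. \<lbrakk>a \<in> {0..t}; b \<in> {0..t}\<rbrakk> \<Longrightarrow> F a b = F b a"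
    and meas: "\<And>s. s \<in> {0..t} \<Longrightarrow> (\<lambda>\<tau>. indicator {0..t} \<tau> * q \<tau> s) \<in> borel_measurable borel"
    and bound: "\<And>\<tau> s. \<lbrakk>\<tau> \<in> {0..t}; s \<in> {0..t}\<rbrakk> \<Longrightarrow> \<bar>q \<tau> s\<bar> \<le> C"
    and FTC: "\<And>b s. \<lbrakk>b \<in> {0..t}; s \<in> {0..t}\<rbrakk> \<Longrightarrow> F b s - F 0 s = (LINT \<tau>:{0..b}|lborel. q \<tau> s)"
    and cont: "\<And>\<tau>. \<tau> \<in> {0..t} \<Longrightarrow> continuous_on {0..t} (q \<tau>)"
  shows "F t t - F 0 0 = 2 * (LINT \<tau>:{0<..t}|lborel. q \<tau> \<tau>)"
proof -
  have int: "set_integrable lborel {0..t} (\<lambda>\<tau>. q \<tau> s)" if s: "s \<in> {0..t}" for s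
    unfolding set_integrable_def
  proof (rule Bochner_Integration.integrable_bound)
    show "integrable lborel (\<lambda>\<tau>. indicator {0..t} \<tau> * C :: real)"
      by (intro integrable_mult_left integrable_real_indicator) (use t in auto)
    show "AE \<tau> in lborel. norm (indicator {0..t} \<tau> *\<^sub>R q \<tau> s) \<le> norm (indicator {0..t} \<tau> * C :: real)"
      using bound[OF _ s] by (intro AE_I2) (fastforce split: split_indicator)
  qed (use meas[OF s] in simp)
  have incr: "F b s - F a s = (LINT \<tau>:{a<..b}|lborel. q \<tau> s)"
    if "0 \<le> a" "a \<le> b" "b \<le> t" "s \<in> {0..t}" for a b s
    using set_lebesgue_integral_Ioc[OF int that(1-3), OF that(4)] FTC[of a s] FTC[of b s] that by simp
  define p where "p n k = real k * t / real n" for n k :: nat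
  have p: "p n k \<in> {0..t}" if "k \<le> n" "0 < n" for n k
    using that t by (simp add: p_def field_simps)
  have p_mono: "p n k \<le> p n j" if "k \<le> j" "0 < n" for n k j
    using that t by (simp add: p_def field_simps)
  \<comment> \<open>Half-open cells tile \<open>{0<..t}\<close> without overlap, so each time lies
    in exactly one of them.\<close>
  define I where "I n k = {p n k<..p n (Suc k)}" for n k
  define g where "g n \<tau> = (\<Sum>k<n. indicator (I n k) \<tau> * (q \<tau> (p n k) + q \<tau> (p n (Suc k))))" for n \<tau>
  have I_sub: "I n k \<subseteq> {0<..t}" if "k < n" for n k
    using p[of k n] p[of "Suc k" n] that by (auto simp: I_def)
  have int': "integrable lborel (\<lambda>\<tau>. indicator (I n k) \<tau> * q \<tau> s)"
    if "k < n" "s \<in> {0..t}" for n k s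
  proof -
    have "I n k \<subseteq> {0..t}" using I_sub[OF that(1)] by auto
    then have "set_integrable lborel (I n k) (\<lambda>\<tau>. q \<tau> s)"
      by (intro set_integrable_subset[OF int[OF that(2)]]) (auto simp: I_def)
    then show ?thesis by (simp add: set_integrable_def)
  qed
  have g_int: "integrable lborel (g n)" for n
    unfolding g_def[abs_def] distrib_left
    by (intro Bochner_Integration.integrable_sum Bochner_Integration.integrable_add int' p) auto
  have total: "F t t - F 0 0 = (LINT \<tau>|lborel. g n \<tau>)" if n: "0 < n" for n
  proof -
    have step: "F (p n (Suc k)) (p n (Suc k)) - F (p n k) (p n k)
        = (LINT \<tau>|lborel. indicator (I n k) \<tau> * (q \<tau> (p n k) + q \<tau> (p n (Suc k))))"
      if k: "k < n" for k
    proof -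
      let ?a = "p n k" and ?b = "p n (Suc k)"
      have ab: "?a \<in> {0..t}" "?b \<in> {0..t}" "?a \<le> ?b" using p p_mono n k by auto
      \<comment> \<open>Symmetry trades the increment in the second variable for one in the first,
        with the second frozen once at each endpoint of the cell. Both contributions tend to the
        diagonal value, which explains the factor 2.\<close>
      have "F ?b ?b - F ?a ?a = (F ?b ?a - F ?a ?a) + (F ?b ?b - F ?a ?b)"
        using sym[of ?a ?b] ab by simp
      also have "\<dots> = (LINT \<tau>:{?a<..?b}|lborel. q \<tau> ?a) + (LINT \<tau>:{?a<..?b}|lborel. q \<tau> ?b)"
        using ab by (simp add: incr)
      also have "\<dots> = (LINT \<tau>|lborel. indicator (I n k) \<tau> * q \<tau> ?a + indicator (I n k) \<tau> * q \<tau> ?b)"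
        using int'[OF k ab(1)] int'[OF k ab(2)]
        by (subst Bochner_Integration.integral_add) (auto simp: set_lebesgue_integral_def I_def)
      finally show ?thesis by (simp add: distrib_left)
    qed
    have "(LINT \<tau>|lborel. g n \<tau>)
        = (\<Sum>k<n. LINT \<tau>|lborel. indicator (I n k) \<tau> * (q \<tau> (p n k) + q \<tau> (p n (Suc k))))"
      unfolding g_def distrib_left
      by (intro Bochner_Integration.integral_sum Bochner_Integration.integrable_add int' p) auto
    also have "\<dots> = (\<Sum>k<n. F (p n (Suc k)) (p n (Suc k)) - F (p n k) (p n k))"
      using step by (intro sum.cong) auto
    also have "\<dots> = F (p n n) (p n n) - F (p n 0) (p n 0)"
      by (rule sum_lessThan_telescope[of "\<lambda>k. F (p n k) (p n k)"])
    finally show ?thesis using n by (simp add: p_def)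
  qed
  have g_eq: "\<exists>a\<in>{0..t}. \<exists>b\<in>{0..t}. \<bar>a - \<tau>\<bar> \<le> t / n \<and> \<bar>b - \<tau>\<bar> \<le> t / n \<and> g n \<tau> = q \<tau> a + q \<tau> b"
    if \<tau>: "\<tau> \<in> {0<..t}" and n: "0 < n" for \<tau> and n :: nat
  proof -
    \<comment> \<open>The cells are closed on the right, so a partition point belongs to the cell on
      its left: a ceiling minus one and not a floor.\<close>
    define k where "k = nat (\<lceil>\<tau> * n / t\<rceil> - 1)"
    have pos: "0 < \<tau> * n / t" using \<tau> n t by simp
    have k1: "real k < \<tau> * n / t" "\<tau> * n / t \<le> real (Suc k)"
      unfolding k_def using pos by linarith+
    have "\<tau> * n / t \<le> n" using \<tau> n t by (simp add: field_simps)
    with k1 have "real k < real n" by linarith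
    then have kn: "k < n" by simp
    have \<tau>I: "\<tau> \<in> I n k" using k1 n t by (simp add: I_def p_def field_simps)
    have uniq: "\<tau> \<notin> I n j" if "j \<noteq> k" for j
    proof
      assume j: "\<tau> \<in> I n j"
      consider "Suc j \<le> k" | "Suc k \<le> j" using \<open>j \<noteq> k\<close> by linarith
      then show False
        by cases (use p_mono[of "Suc j" k n] p_mono[of "Suc k" j n] n \<tau>I j in \<open>auto simp: I_def\<close>)
    qed
    have "g n \<tau> = (\<Sum>j<n. if j = k then q \<tau> (p n j) + q \<tau> (p n (Suc j)) else 0)"
      unfolding g_def by (rule sum.cong) (use uniq \<tau>I in auto)
    also have "\<dots> = q \<tau> (p n k) + q \<tau> (p n (Suc k))" using kn by simp
    finally have "g n \<tau> = q \<tau> (p n k) + q \<tau> (p n (Suc k))" .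
    moreover have "p n (Suc k) = p n k + t / n"
      by (simp add: p_def add_divide_distrib distrib_right)
    then have "\<bar>p n k - \<tau>\<bar> \<le> t / n" "\<bar>p n (Suc k) - \<tau>\<bar> \<le> t / n"
      using \<tau>I by (auto simp: I_def)
    ultimately show ?thesis using p[of k n] p[of "Suc k" n] kn n by (meson less_imp_le Suc_leI)
  qed
  have g_out: "g n \<tau> = 0" if "\<tau> \<notin> {0<..t}" for n \<tau>
  proof -
    have "\<tau> \<notin> I n k" if "k < n" for k
      using I_sub[OF that] \<open>\<tau> \<notin> {0<..t}\<close> by blast
    then show ?thesis unfolding g_def by (intro sum.neutral) simp
  qed
  define h where "h \<tau> = indicator {0<..t} \<tau> * (2 * q \<tau> \<tau>)" for \<tau>
  have lim: "(\<lambda>n. g (Suc n) \<tau>) \<longlonglongrightarrow> h \<tau>" for \<tau>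
  proof (cases "\<tau> \<in> {0<..t}")
    case False
    then show ?thesis by (simp add: g_out h_def)
  next
    case True
    then obtain a b where ab: "\<And>n. a n \<in> {0..t}" "\<And>n. b n \<in> {0..t}"
      "\<And>n. \<bar>a n - \<tau>\<bar> \<le> t / real (Suc n)" "\<And>n. \<bar>b n - \<tau>\<bar> \<le> t / real (Suc n)"
      "\<And>n. g (Suc n) \<tau> = q \<tau> (a n) + q \<tau> (b n)"
      using g_eq[of \<tau> "Suc n" for n] by (metis zero_less_Suc)
    have 0: "(\<lambda>n. t / real (Suc n)) \<longlonglongrightarrow> 0"
      using tendsto_mult[OF tendsto_const[of t] LIMSEQ_inverse_real_of_nat] by (simp add: divide_inverse)
    have "(\<lambda>n. a n - \<tau>) \<longlonglongrightarrow> 0" "(\<lambda>n. b n - \<tau>) \<longlonglongrightarrow> 0"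
      using ab by (auto intro!: Lim_null_comparison[OF _ 0])
    then have "a \<longlonglongrightarrow> \<tau>" "b \<longlonglongrightarrow> \<tau>" by (simp_all add: LIM_zero_cancel)
    then have "(\<lambda>n. q \<tau> (a n)) \<longlonglongrightarrow> q \<tau> \<tau>" "(\<lambda>n. q \<tau> (b n)) \<longlonglongrightarrow> q \<tau> \<tau>"
      using cont[of \<tau>] True ab by (auto simp: continuous_on_sequentially o_def)
    from tendsto_add[OF this] show ?thesis using True by (simp add: ab h_def)
  qed
  have "(\<lambda>n. LINT \<tau>|lborel. g (Suc n) \<tau>) \<longlonglongrightarrow> (LINT \<tau>|lborel. h \<tau>)"
  proof (rule integral_dominated_convergence[where w="\<lambda>\<tau>. indicator {0..t} \<tau> * (2 * C)"])
    have [measurable]: "g n \<in> borel_measurable lborel" for n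
      by (rule borel_measurable_integrable[OF g_int])
    show "g (Suc n) \<in> borel_measurable lborel" for n by simp
    \<comment> \<open>Measurability of the diagonal is not a hypothesis; it is inherited from the
      step approximations.\<close>
    show "h \<in> borel_measurable lborel"
      using lim by (rule borel_measurable_LIMSEQ_real) simp
    show "integrable lborel (\<lambda>\<tau>. indicator {0..t} \<tau> * (2 * C) :: real)"
      by (intro integrable_mult_left integrable_real_indicator) (use t in auto)
    show "AE \<tau> in lborel. (\<lambda>n. g (Suc n) \<tau>) \<longlonglongrightarrow> h \<tau>" using lim by simp
    fix n
    show "AE \<tau> in lborel. norm (g (Suc n) \<tau>) \<le> indicator {0..t} \<tau> * (2 * C)"
    proof (rule AE_I2)
      fix \<tau>
      show "norm (g (Suc n) \<tau>) \<le> indicator {0..t} \<tau> * (2 * C)"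
      proof (cases "\<tau> \<in> {0<..t}")
        case True
        then obtain a b where "a \<in> {0..t}" "b \<in> {0..t}" "g (Suc n) \<tau> = q \<tau> a + q \<tau> b"
          using g_eq[of \<tau> "Suc n"] by (metis zero_less_Suc)
        then show ?thesis using True bound[of \<tau> a] bound[of \<tau> b] by auto
      next
        case False
        have "0 \<le> C" using bound[of 0 0] t by auto
        then show ?thesis using False by (simp add: g_out)
      qed
    qed
  qed
  then have "(\<lambda>n::nat. F t t - F 0 0) \<longlonglongrightarrow> (LINT \<tau>|lborel. h \<tau>)"
    by (simp only: total[OF zero_less_Suc, symmetric])
  then have "F t t - F 0 0 = (LINT \<tau>|lborel. h \<tau>)"
    by (rule LIMSEQ_unique[OF tendsto_const])
  then show ?thesis
    by (simp add: h_def set_lebesgue_integral_def mult.left_commute[of _ 2])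
qed

section \<open>Convolution and smooth test fields\<close>

lemma lborel_distr_reflect: "distr lborel borel (\<lambda>y. x - y) = (lborel :: 'a::euclidean_space measure)"
  by (subst (2) lborel_affine[of "-1" x]) (auto simp: density_1)

lemma borel_measurable_reflect [measurable]:
  "f \<in> borel_measurable borel \<Longrightarrow> (\<lambda>y. f (x - y :: 'a::euclidean_space)) \<in> borel_measurable borel"
  by simp

lemma lborel_integral_reflect:
  fixes f :: "'a::euclidean_space \<Rightarrow> 'b::{banach,second_countable_topology}"
  assumes "f \<in> borel_measurable borel"
  shows "(LINT y|lborel. f (x - y)) = (LINT y|lborel. f y)"
  using integral_distr[of "\<lambda>y. x - y" lborel borel f] assms by (simp add: lborel_distr_reflect)

lemma lborel_integrable_reflect:
  fixes f :: "'a::euclidean_space \<Rightarrow> 'b::{banach,second_countable_topology}"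
  assumes "f \<in> borel_measurable borel"
  shows "integrable lborel (\<lambda>y. f (x - y)) \<longleftrightarrow> integrable lborel f"
  using integrable_distr_eq[of "\<lambda>y. x - y" lborel borel f] assms by (simp add: lborel_distr_reflect)

lemma continuous_support_bounded:
  fixes f :: "'a::euclidean_space \<Rightarrow> 'b::real_normed_vector"
  assumes "continuous_on UNIV f" and R: "\<And>x. norm x > R \<Longrightarrow> f x = 0"
  obtains C where "0 \<le> C" "\<And>x. norm (f x) \<le> C"
proof -
  have "bounded (f ` cball 0 R)"
    using assms(1) by (intro compact_imp_bounded compact_continuous_image)
      (auto intro: continuous_on_subset)
  then obtain C where "0 < C" "\<And>x. x \<in> cball 0 R \<Longrightarrow> norm (f x) \<le> C"
    by (auto simp: bounded_pos)
  then have "norm (f x) \<le> C" for x using R[of x] by (cases "norm x > R") auto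
  then show thesis using that \<open>0 < C\<close> by (meson less_imp_le)
qed

text \<open>The unit margin around the support settles the mixed case: if one of two points at
  distance below 1 has norm above \<open>R + 1\<close>, both have norm above \<open>R\<close> and
  \<open>f\<close> vanishes at both.\<close>

lemma continuous_support_uniformly:
  fixes f :: "'a::euclidean_space \<Rightarrow> 'b::real_normed_vector"
  assumes "continuous_on UNIV f" and R: "\<And>x. norm x > R \<Longrightarrow> f x = 0" and "0 < e"
  obtains d where "0 < d" "\<And>x y. dist x y < d \<Longrightarrow> dist (f x) (f y) < e"
proof -
  have "uniformly_continuous_on (cball 0 (R + 1)) f"
    using assms(1) by (intro compact_uniformly_continuous) (auto intro: continuous_on_subset)
  then obtain d where d: "0 < d"
    "\<And>x y. \<lbrakk>x \<in> cball 0 (R+1); y \<in> cball 0 (R+1); dist x y < d\<rbrakk> \<Longrightarrow> dist (f x) (f y) < e"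
    unfolding uniformly_continuous_on_def using \<open>0 < e\<close> by (metis dist_commute)
  show thesis
  proof
    show "0 < min d 1" using d by simp
    fix x y :: 'a
    assume xy: "dist x y < min d 1"
    have n: "norm x \<le> norm y + dist x y" "norm y \<le> norm x + dist x y"
      using norm_triangle_sub[of x y] norm_triangle_sub[of y x]
      by (simp_all add: dist_norm norm_minus_commute)
    show "dist (f x) (f y) < e"
    proof (cases "norm x \<le> R + 1 \<and> norm y \<le> R + 1")
      case True
      then show ?thesis using d(2)[of x y] xy by simp
    next
      case False
      then have "norm x > R" "norm y > R" using n xy by auto
      then show ?thesis using R \<open>0 < e\<close> by simp
    qed
  qed
qed

lemma integrable_scaleR_bounded:
  fixes a :: "'a::euclidean_space \<Rightarrow> real" and k :: "'a \<Rightarrow> 'b::{banach,second_countable_topology}"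
  assumes a: "integrable lborel a" and [measurable]: "k \<in> borel_measurable borel"
    and C: "\<And>y. norm (k y) \<le> C"
  shows "integrable lborel (\<lambda>y. a y *\<^sub>R k y)"
proof (rule Bochner_Integration.integrable_bound)
  show "integrable lborel (\<lambda>y. a y * C)" using a by simp
  show "AE y in lborel. norm (a y *\<^sub>R k y) \<le> norm (a y * C)"
  proof (rule AE_I2)
    fix y
    have "norm (k y) \<le> \<bar>C\<bar>" using C[of y] by linarith
    then show "norm (a y *\<^sub>R k y) \<le> norm (a y * C)" by (simp add: abs_mult mult_left_mono)
  qed
  have [measurable]: "a \<in> borel_measurable borel" using a by auto
  show "(\<lambda>y. a y *\<^sub>R k y) \<in> borel_measurable lborel" by simp
qed

section \<open>Differentiation of a convolution\<close>

lemma linear_norm_le_sum_Basis: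
  fixes L :: "'a::euclidean_space \<Rightarrow> 'b::real_normed_vector"
  assumes "linear L"
  shows "norm (L w) \<le> (\<Sum>b\<in>Basis. norm (L b)) * norm w"
proof -
  have "L w = (\<Sum>b\<in>Basis. (w \<bullet> b) *\<^sub>R L b)"
    using assms by (subst euclidean_representation[of w, symmetric])
      (simp add: linear_sum linear_scale)
  also have "norm \<dots> \<le> (\<Sum>b\<in>Basis. norm (L b) * norm w)"
    by (rule order_trans[OF norm_sum sum_mono])
       (simp add: Basis_le_norm mult.commute[of _ "norm w"] mult_right_mono)
  finally show ?thesis by (simp add: sum_distrib_right)
qed

text \<open>The weight \<open>a\<close> is merely integrable and all regularity sits in
  \<open>h\<close>. It is used in both directions: with the kernel as weight, to differentiate the
  test field repeatedly, and with a component of the test field as weight, to move one derivative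
  onto the kernel.\<close>

lemma has_derivative_convolution:
  fixes h :: "'a::euclidean_space \<Rightarrow> 'b::euclidean_space"
  assumes a: "integrable lborel a"
    and h: "\<And>x. (h has_derivative D x) (at x)"
    and D: "\<And>b. b \<in> Basis \<Longrightarrow> continuous_on UNIV (\<lambda>x. D x b)"
    and R: "\<And>x. norm x > R \<Longrightarrow> h x = 0"
  shows "((\<lambda>x. LINT y|lborel. a y *\<^sub>R h (x - y)) has_derivative
    (\<lambda>w. LINT y|lborel. a y *\<^sub>R D (x - y) w)) (at x)"
proof -
  have linD: "linear (D x)" for x using h has_derivative_linear by blast
  have Dw: "D x w = (\<Sum>b\<in>Basis. (w \<bullet> b) *\<^sub>R D x b)" for x w
    using linD[of x] by (subst euclidean_representation[of w, symmetric])
      (simp add: linear_sum linear_scale)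
  have hc: "continuous_on UNIV h"
    using h by (meson continuous_at_imp_continuous_on has_derivative_continuous)
  have DR: "D x b = 0" if "norm x > R" for x b
  proof -
    have "((\<lambda>_. 0) has_derivative D x) (at x)"
      using h[of x] by (rule has_derivative_transform_within_open[where s="{x. norm x > R}"])
        (use that R in \<open>auto intro: open_Collect_less continuous_intros\<close>)
    then have "D x = (\<lambda>_. 0)" using has_derivative_const has_derivative_unique by blast
    then show ?thesis by simp
  qed
  have [measurable]: "h \<in> borel_measurable borel"
    using hc by (rule borel_measurable_continuous_onI)
  have [measurable]: "(\<lambda>x. D x w) \<in> borel_measurable borel" for w
    unfolding Dw[of _ w] by (intro borel_measurable_sum borel_measurable_scaleR borel_measurable_const
      borel_measurable_continuous_onI D)
  obtain Ch where Ch: "\<And>x. norm (h x) \<le> Ch"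
    using continuous_support_bounded[OF hc R] by metis
  have "\<exists>C. 0 \<le> C \<and> (\<forall>x. norm (D x b) \<le> C)" if b: "b \<in> Basis" for b
    using continuous_support_bounded[OF D[OF b], of R] DR by metis
  then obtain CD where CD: "\<And>b. b \<in> Basis \<Longrightarrow> 0 \<le> CD b" "\<And>b x. b \<in> Basis \<Longrightarrow> norm (D x b) \<le> CD b"
    by metis
  define C where "C = (\<Sum>b\<in>Basis. CD b)"
  have C: "norm (D x w) \<le> C * norm w" for x w
    using linear_norm_le_sum_Basis[OF linD, of x w]
      mult_right_mono[OF sum_mono[of Basis "\<lambda>b. norm (D x b)" CD], of "norm w"] CD by (force simp: C_def)
  have ih: "integrable lborel (\<lambda>y. a y *\<^sub>R h (x - y))" for x
    by (rule integrable_scaleR_bounded[OF a _ Ch]) simp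
  have iD: "integrable lborel (\<lambda>y. a y *\<^sub>R D (x - y) w)" for x w
    by (rule integrable_scaleR_bounded[OF a _ C[of _ w]]) simp
  let ?A = "LINT y|lborel. \<bar>a y\<bar>"
  have A: "0 \<le> ?A" by simp
  have ia: "integrable lborel (\<lambda>y. \<bar>a y\<bar>)" using a by simp
  have bl: "bounded_linear (\<lambda>w. LINT y|lborel. a y *\<^sub>R D (x - y) w)"
  proof (rule bounded_linear_intro)
    show "(LINT y|lborel. a y *\<^sub>R D (x - y) (v + w))
        = (LINT y|lborel. a y *\<^sub>R D (x - y) v) + (LINT y|lborel. a y *\<^sub>R D (x - y) w)" for v w
      by (simp add: linear_add[OF linD] scaleR_add_right iD)
    show "(LINT y|lborel. a y *\<^sub>R D (x - y) (r *\<^sub>R w)) = r *\<^sub>R (LINT y|lborel. a y *\<^sub>R D (x - y) w)" for r w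
      by (simp only: linear_scale[OF linD] scaleR_left_commute[of _ r] integral_scaleR_right iD)
    show "norm (LINT y|lborel. a y *\<^sub>R D (x - y) w) \<le> norm w * (?A * C)" for w
    proof -
      have "norm (LINT y|lborel. a y *\<^sub>R D (x - y) w) \<le> (LINT y|lborel. \<bar>a y\<bar> * (C * norm w))"
        by (rule Bochner_Integration.integral_norm_bound_integral)
           (use iD ia C in \<open>auto intro!: mult_left_mono\<close>)
      also have "\<dots> = norm w * (?A * C)" by (simp add: mult_ac)
      finally show ?thesis .
    qed
  qed
  show ?thesis
    unfolding has_derivative_at_alt
  proof (intro conjI allI impI bl)
    fix e :: real assume e: "0 < e"
    \<comment> \<open>The error is collected over all basis directions and multiplied by the L^1
      norm of \<open>a\<close>; the added 1 keeps the denominator positive when that norm is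
      0.\<close>
    define e' where "e' = e / ((?A + 1) * (DIM('a)))"
    have e': "0 < e'" using e A by (simp add: e'_def add_nonneg_pos)
    have "\<exists>d>0. \<forall>x y. dist x y < d \<longrightarrow> dist (D x b) (D y b) < e'" if b: "b \<in> Basis" for b
      using continuous_support_uniformly[OF D[OF b], of R e'] DR e' by metis
    then obtain d where d: "\<And>b. b \<in> Basis \<Longrightarrow> 0 < d b"
      "\<And>b x y. \<lbrakk>b \<in> Basis; dist x y < d b\<rbrakk> \<Longrightarrow> dist (D x b) (D y b) < e'"
      by metis
    define \<delta> where "\<delta> = Min (d ` Basis)"
    have \<delta>: "0 < \<delta>" "\<And>b. b \<in> Basis \<Longrightarrow> \<delta> \<le> d b"
      using d by (auto simp: \<delta>_def)
    \<comment> \<open>Mean value inequality on a ball around \<open>z\<close>. Uniform continuity of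
      the partial derivatives makes \<delta> independent of \<open>z\<close>, as integration over
      all translates requires.\<close>
    have rem: "norm (h (z + w) - h z - D z w) \<le> norm w * (DIM('a) * e')" if w: "norm w < \<delta>" for z w
    proof -
      have "norm (h (z + w) - h z - D z ((z + w) - z)) \<le> norm ((z + w) - z) * (DIM('a) * e')"
      proof (rule differentiable_bound_linearization[where S="ball z \<delta>" and f'=D])
        show "z + t *\<^sub>R (z + w - z) \<in> ball z \<delta>" if "t \<in> {0..1}" for t
          using w that by (auto simp: dist_norm intro: le_less_trans[OF mult_left_le_one_le])
        show "(h has_derivative D x) (at x within ball z \<delta>)" for x
          using h has_derivative_at_withinI by blast
        show "z \<in> ball z \<delta>" using \<delta> by simp
        show "onorm (D x - D z) \<le> DIM('a) * e'" if x: "x \<in> ball z \<delta>" for x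
        proof (rule onorm_bound)
          show "norm ((D x - D z) v) \<le> DIM('a) * e' * norm v" for v
          proof -
            have "linear (\<lambda>v. D x v - D z v)" by (intro linear_compose_sub linD)
            from linear_norm_le_sum_Basis[OF this, of v]
            have "norm ((D x - D z) v) \<le> (\<Sum>b\<in>Basis. norm (D x b - D z b)) * norm v"
              by simp
            also have "\<dots> \<le> (\<Sum>b\<in>(Basis::'a set). e') * norm v"
            proof (intro mult_right_mono sum_mono norm_ge_zero)
              fix b :: 'a assume b: "b \<in> Basis"
              have "dist x z < d b" using x \<delta>(2)[OF b] by (simp add: dist_commute)
              then show "norm (D x b - D z b) \<le> e'" using d(2)[OF b] by (fastforce simp: dist_norm)
            qed
            finally show ?thesis by simp
          qed
        qed (use e' in simp)
      qed
      then show ?thesis by simp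
    qed
    show "\<exists>d>0. \<forall>y. norm (y - x) < d \<longrightarrow>
        norm ((LINT ya|lborel. a ya *\<^sub>R h (y - ya)) - (LINT y|lborel. a y *\<^sub>R h (x - y))
          - (LINT ya|lborel. a ya *\<^sub>R D (x - ya) (y - x))) \<le> e * norm (y - x)"
    proof (intro exI[of _ \<delta>] conjI allI impI \<delta>)
      fix z assume z: "norm (z - x) < \<delta>"
      define w where "w = z - x"
      have "norm ((LINT y|lborel. a y *\<^sub>R h (z - y)) - (LINT y|lborel. a y *\<^sub>R h (x - y))
          - (LINT y|lborel. a y *\<^sub>R D (x - y) w))
        = norm (LINT y|lborel. a y *\<^sub>R (h ((x - y) + w) - h (x - y) - D (x - y) w))"
        using ih[of z] ih[of x] iD[of x w]
        by (simp add: scaleR_diff_right w_def algebra_simps flip: Bochner_Integration.integral_diff)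
      also have "\<dots> \<le> (LINT y|lborel. \<bar>a y\<bar> * (norm w * (DIM('a) * e')))"
      proof (rule Bochner_Integration.integral_norm_bound_integral)
        show "integrable lborel (\<lambda>y. a y *\<^sub>R (h ((x - y) + w) - h (x - y) - D (x - y) w))"
          using ih[of z] ih[of x] iD[of x w]
          by (auto simp: scaleR_diff_right w_def algebra_simps intro!: Bochner_Integration.integrable_diff)
        show "norm (a y *\<^sub>R (h ((x - y) + w) - h (x - y) - D (x - y) w))
            \<le> \<bar>a y\<bar> * (norm w * (DIM('a) * e'))" for y
          unfolding norm_scaleR using z by (intro mult_left_mono rem abs_ge_zero) (simp add: w_def)
      qed (use ia in simp)
      also have "\<dots> = ?A * (norm w * (DIM('a) * e'))" by simp
      also have "\<dots> = ?A / (?A + 1) * (e * norm w)"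
      proof -
        have "DIM('a) * e' = e / (?A + 1)" by (simp add: e'_def)
        then show ?thesis by simp
      qed
      also have "\<dots> \<le> 1 * (e * norm w)"
      proof (rule mult_right_mono)
        have "a / (a + 1) \<le> 1" if "0 \<le> a" for a :: real
          using that by simp
        then show "?A / (?A + 1) \<le> 1" using A .
      qed (use e in simp)
      finally show "norm ((LINT y|lborel. a y *\<^sub>R h (z - y)) - (LINT y|lborel. a y *\<^sub>R h (x - y))
          - (LINT y|lborel. a y *\<^sub>R D (x - y) (z - x))) \<le> e * norm (z - x)"
        by (simp add: w_def)
    qed
  qed
qed

section \<open>Iterated derivatives and fixed-time test fields\<close>

lemma smooth_on_iter_deriv:
  assumes "smooth_on UNIV f" "set vs \<subseteq> Basis"
  shows "(iter_deriv UNIV vs f has_derivative frechet_derivative (iter_deriv UNIV vs f) (at x)) (at x)"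
    and "continuous_on UNIV (iter_deriv UNIV vs f)"
    and "b \<in> Basis \<Longrightarrow> continuous_on UNIV (\<lambda>x. frechet_derivative (iter_deriv UNIV vs f) (at x) b)"
proof -
  show 1: "(iter_deriv UNIV vs f has_derivative frechet_derivative (iter_deriv UNIV vs f) (at x)) (at x)"
    using assms by (auto simp: smooth_on_def differentiable_on_def frechet_derivative_works[symmetric])
  have c: "continuous_on UNIV (iter_deriv UNIV ws f)" if "set ws \<subseteq> Basis" for ws
    using assms(1) that by (intro differentiable_imp_continuous_on) (simp add: smooth_on_def)
  show "continuous_on UNIV (iter_deriv UNIV vs f)" using c assms(2) .
  show "continuous_on UNIV (\<lambda>x. frechet_derivative (iter_deriv UNIV vs f) (at x) b)" if "b \<in> Basis"
    using c[of "b # vs"] that assms(2) by simp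
qed

lemma iter_deriv_support:
  fixes f :: "'a::euclidean_space \<Rightarrow> 'b::real_normed_vector"
  assumes "\<And>x. norm x > R \<Longrightarrow> f x = 0" "norm x > R"
  shows "iter_deriv UNIV vs f x = 0"
  using assms(2)
proof (induction vs arbitrary: x)
  case Nil
  then show ?case using assms(1) by simp
next
  case (Cons v vs)
  have "((\<lambda>_. 0) has_derivative (\<lambda>_. 0)) (at x)" by (rule has_derivative_const)
  then have "(iter_deriv UNIV vs f has_derivative (\<lambda>_. 0)) (at x)"
    by (rule has_derivative_transform_within_open[where s="{x. norm x > R}"])
      (use Cons in \<open>auto intro: open_Collect_less continuous_intros\<close>)
  then have "frechet_derivative (iter_deriv UNIV vs f) (at x) = (\<lambda>_. 0)"
    by (rule frechet_derivative_at[symmetric])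
  then show ?case by simp
qed

lemma test_sigma_support:
  assumes "f \<in> test_sigma"
  obtains R where "0 < R" "\<And>x. norm x > R \<Longrightarrow> f x = 0"
proof -
  have "bounded (closure {x. f x \<noteq> 0})" using assms by (auto simp: test_sigma_def compact_imp_bounded)
  then obtain R where "0 < R" "\<And>x. x \<in> closure {x. f x \<noteq> 0} \<Longrightarrow> norm x \<le> R"
    by (auto simp: bounded_pos)
  then show thesis using closure_subset[of "{x. f x \<noteq> 0}"] by (intro that[of R]) force+
qed

lemma test_sigmaI:
  assumes "smooth_on UNIV f" "\<And>x. norm x > R \<Longrightarrow> f x = 0" "\<And>x. divergence f x = 0"
  shows "f \<in> test_sigma"
proof -
  have "{x. f x \<noteq> 0} \<subseteq> cball 0 R" using assms(2) by (force simp: not_le)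
  then have "bounded {x. f x \<noteq> 0}" by (rule bounded_subset[OF bounded_cball])
  then show ?thesis using assms by (simp add: test_sigma_def)
qed

lemma test_sigma_L2:
  assumes "f \<in> test_sigma"
  shows "f \<in> L2"
proof -
  obtain R where R: "\<And>x. norm x > R \<Longrightarrow> f x = 0" using test_sigma_support[OF assms] by metis
  have c: "continuous_on UNIV f"
    using assms smooth_on_iter_deriv(2)[of f "[]"] by (simp add: test_sigma_def)
  obtain C where "\<And>x. norm (f x) \<le> C" using continuous_support_bounded[OF c R] by metis
  with R show ?thesis
    by (intro L2_bounded_support[of f C R] borel_measurable_continuous_onI c)
qed

lemma test_sigma_schwartz:
  assumes "f \<in> test_sigma"
  shows "f \<in> schwartz_sigma"
proof -
  obtain R where R: "0 < R" "\<And>x. norm x > R \<Longrightarrow> f x = 0" using test_sigma_support[OF assms] by metis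
  have "\<exists>C. \<forall>x. norm x ^ k * norm (iter_deriv UNIV vs f x) \<le> C" if "set vs \<subseteq> Basis" for k vs
  proof -
    have c: "continuous_on UNIV (iter_deriv UNIV vs f)"
      using assms that by (intro smooth_on_iter_deriv) (auto simp: test_sigma_def)
    obtain C where C: "0 \<le> C" "\<And>x. norm (iter_deriv UNIV vs f x) \<le> C"
      using continuous_support_bounded[OF c iter_deriv_support[of R f]] R by metis
    have "norm x ^ k * norm (iter_deriv UNIV vs f x) \<le> R ^ k * C" for x
    proof (cases "norm x > R")
      case True
      then show ?thesis using R C by (simp add: iter_deriv_support[of R f])
    next
      case False
      then show ?thesis using R C by (intro mult_mono power_mono) auto
    qed
    then show ?thesis by blast
  qed
  then show ?thesis using assms by (simp add: schwartz_sigma_def schwartz_def test_sigma_def)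
qed

text \<open>Space-time basis vectors project to spatial basis vectors or, for the time direction, to
  0. A zero direction annihilates the derivative and everything differentiated after it.\<close>

lemma smooth_on_iter_deriv_zero_direction:
  assumes "smooth_on UNIV f" "set ws \<subseteq> insert 0 Basis"
  shows "(\<exists>vs. set vs \<subseteq> Basis \<and> iter_deriv UNIV ws f = iter_deriv UNIV vs f) \<or> iter_deriv UNIV ws f = (\<lambda>_. 0)"
  using assms(2)
proof (induction ws)
  case Nil
  show ?case by (rule disjI1, rule exI[of _ "[]"]) simp
next
  case (Cons w ws)
  then consider vs where "set vs \<subseteq> Basis" "iter_deriv UNIV ws f = iter_deriv UNIV vs f"
    | "iter_deriv UNIV ws f = (\<lambda>_. 0)" by auto
  then show ?case
  proof cases
    case 1
    show ?thesis
    proof (cases "w = 0")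
      case True
      have "frechet_derivative (iter_deriv UNIV vs f) (at x) 0 = 0" for x
        using smooth_on_iter_deriv(1)[OF assms(1) 1(1), of x] has_derivative_linear linear_0 by blast
      then show ?thesis using True 1 by simp
    next
      case False
      then have "set (w # vs) \<subseteq> Basis" using 1 Cons by simp
      moreover have "iter_deriv UNIV (w # ws) f = iter_deriv UNIV (w # vs) f" using 1 by simp
      ultimately show ?thesis by blast
    qed
  next
    case 2
    then show ?thesis by simp
  qed
qed

text \<open>Derivatives are taken within the closed slab, so uniqueness of the derivative has to be
  secured at the boundary times as well; then every iterated derivative reduces to one in space
  along the projected directions.\<close>

lemma schwartz_sigma_T_const:
  assumes T: "0 < T" and f: "f \<in> schwartz_sigma"
  shows "(\<lambda>_. f) \<in> schwartz_sigma_T T"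
proof -
  let ?S = "UNIV \<times> {0..T} :: ((real^3) \<times> real) set"
  let ?k = "\<lambda>(x, t::real). f x"
  have sm: "smooth_on UNIV f" using f by (simp add: schwartz_sigma_def schwartz_def)
  have der: "(iter_deriv UNIV ws f has_derivative frechet_derivative (iter_deriv UNIV ws f) (at x)) (at x)"
    if "set ws \<subseteq> insert 0 Basis" for ws x
    using smooth_on_iter_deriv_zero_direction[OF sm that] smooth_on_iter_deriv(1)[OF sm] by auto
  have fst_Basis: "set (map fst vs) \<subseteq> insert 0 Basis" if "set vs \<subseteq> Basis" for vs :: "((real^3) \<times> real) list"
    using that by (auto simp: Basis_prod_def)
  have comp: "((iter_deriv UNIV (map fst vs) f \<circ> fst) has_derivative
      (frechet_derivative (iter_deriv UNIV (map fst vs) f) (at (fst p)) \<circ> fst)) (at p within ?S)"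
    if "set vs \<subseteq> Basis" for vs :: "((real^3) \<times> real) list" and p
    by (rule has_derivative_compose[unfolded o_def[symmetric], of fst fst p ?S])
       (auto intro!: has_derivative_fst der[OF fst_Basis[OF that]] simp: o_def)
  have eq: "iter_deriv ?S vs ?k p = iter_deriv UNIV (map fst vs) f (fst p)"
    if "set vs \<subseteq> Basis" "p \<in> ?S" for vs p
    using that
  proof (induction vs arbitrary: p)
    case Nil
    then show ?case by (simp add: case_prod_beta)
  next
    case (Cons v vs)
    have D: "(iter_deriv ?S vs ?k has_derivative
        (frechet_derivative (iter_deriv UNIV (map fst vs) f) (at (fst p)) \<circ> fst)) (at p within ?S)"
      using Cons by (intro has_derivative_transform[OF _ _ comp]) auto
    have "frechet_derivative (iter_deriv ?S vs ?k) (at p within ?S)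
        = frechet_derivative (iter_deriv UNIV (map fst vs) f) (at (fst p)) \<circ> fst"
    proof (rule frechet_derivative_unique_within[OF _ D])
      show "(iter_deriv ?S vs ?k has_derivative frechet_derivative (iter_deriv ?S vs ?k) (at p within ?S)) (at p within ?S)"
        using D by (auto simp: frechet_derivative_works[symmetric] differentiable_def)
      fix i :: "(real^3) \<times> real" and e :: real
      assume i: "i \<in> Basis" and e: "0 < e"
      obtain x t where p: "p = (x, t)" "0 \<le> t" "t \<le> T" using Cons.prems(2) by auto
      \<comment> \<open>The increment points into the slab: forward in time unless
        \<open>t = T\<close>, and then backward, which \<open>0 < T\<close> permits.\<close>
      define d where "d = (if t < T then min (e/2) (T - t) else - min (e/2) T)"
      have d: "0 < \<bar>d\<bar>" "\<bar>d\<bar> < e" "t + d \<in> {0..T}"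
        using e T p by (auto simp: d_def min_def)
      have "p + d *\<^sub>R i \<in> ?S"
        using i p d by (auto simp: Basis_prod_def)
      then show "\<exists>d. 0 < \<bar>d\<bar> \<and> \<bar>d\<bar> < e \<and> p + d *\<^sub>R i \<in> ?S"
        using d(1,2) by (intro exI[of _ d] conjI)
    qed
    then show ?case by simp
  qed
  have "iter_deriv ?S vs ?k differentiable_on ?S" if "set vs \<subseteq> Basis" for vs
    unfolding differentiable_on_def
  proof
    fix p assume p: "p \<in> ?S"
    show "iter_deriv ?S vs ?k differentiable (at p within ?S)"
      using has_derivative_transform[OF p _ comp[OF that], of "iter_deriv ?S vs ?k"] eq[OF that]
      by (auto simp: differentiable_def)
  qed
  then show ?thesis using f by (simp add: schwartz_sigma_T_def smooth_on_def)
qed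

text \<open>\<open>vector_derivative\<close> is determined only where the filter within the interval
  is nontrivial; \<open>0 < T\<close> ensures this at both endpoints too.\<close>

lemma time_deriv_const:
  assumes "0 < T" "t \<in> {0..T}"
  shows "time_deriv T (\<lambda>_. f) t = (\<lambda>_. 0)"
proof
  fix x
  have "at t within {0..T} \<noteq> bot"
    using vector_derivative_unique_within_closed_interval[of 0 T t "\<lambda>_. 0::real"] assms
    by (auto simp: trivial_limit_within intro!: islimpt_closure_open[where s="{0<..<T}"])
  then show "time_deriv T (\<lambda>_. f) t x = 0"
    unfolding time_deriv_def by (rule vector_derivative_within) simp
qed

section \<open>Mollification\<close>

lemma eq_zero_if_arbitrarily_small:
  fixes a :: real
  assumes "\<And>e. 0 < e \<Longrightarrow> \<bar>a\<bar> \<le> C * e" and C: "0 \<le> C"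
  shows "a = 0"
proof (rule ccontr)
  assume "a \<noteq> 0"
  then have "\<bar>a\<bar> \<le> C * (\<bar>a\<bar> / (2 * (C + 1)))" using C by (intro assms(1)) simp
  also have "\<dots> = C / (C + 1) * (\<bar>a\<bar> / 2)" by simp
  also have "\<dots> \<le> 1 * (\<bar>a\<bar> / 2)" using C by (intro mult_right_mono) auto
  finally show False using \<open>a \<noteq> 0\<close> by simp
qed

text \<open>The gradient \<open>K\<close> is a parameter of its own, so that its oddness, support
  and continuity can be used as plain facts. Asking for one derivative only admits the explicit
  polynomial bump constructed later.\<close>

locale mollifier =
  fixes \<phi> :: "real^3 \<Rightarrow> real" and K :: vec_field and r :: real
  assumes nonneg: "0 \<le> \<phi> z"
    and even: "\<phi> (- z) = \<phi> z"
    and odd: "K (- z) = - K z"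
    and support: "norm z > r \<Longrightarrow> \<phi> z = 0" "norm z > r \<Longrightarrow> K z = 0"
    and integral_one: "(LINT z|lborel. \<phi> z) = 1"
    and deriv: "(\<phi> has_derivative (\<lambda>w. K z \<bullet> w)) (at z)"
    and K_continuous: "continuous_on UNIV K"
begin

definition conv :: "vec_field \<Rightarrow> vec_field" where
  "conv g x = (LINT y|lborel. \<phi> (x - y) *\<^sub>R g y)"

text \<open>For test fields this is \<open>grad (conv h)\<close>; the derivative is moved onto the kernel so that
  it makes sense on all of \<open>L2\<close>.\<close>

definition conv_grad :: "vec_field \<Rightarrow> real^3 \<Rightarrow> real^3^3" where
  "conv_grad h x = (\<chi> i j. LINT y|lborel. K (x - y) $ i * h y $ j)"

text \<open>This is the pairing of \<open>v\<close> with \<open>conv g\<close>, written as one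
  double integral: it makes sense for all pairs in \<open>L2\<close> without studying
  \<open>conv g\<close> there, and its symmetry is a swap of the variables.\<close>

definition moll_form :: "vec_field \<Rightarrow> vec_field \<Rightarrow> real" where
  "moll_form v g = (LINT p|(lborel \<Otimes>\<^sub>M lborel). \<phi> (fst p - snd p) * (v (fst p) \<bullet> g (snd p)))"

lemma \<phi>_continuous: "continuous_on UNIV \<phi>"
  using deriv by (meson continuous_at_imp_continuous_on has_derivative_continuous)

lemma \<phi>_measurable [measurable]: "\<phi> \<in> borel_measurable borel"
  using \<phi>_continuous by (rule borel_measurable_continuous_onI)

lemma K_measurable [measurable]: "K \<in> borel_measurable borel"
  using K_continuous by (rule borel_measurable_continuous_onI)

lemma nth_measurable: "(\<lambda>y::real^3. y $ i) \<in> borel_measurable borel"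
  by (intro borel_measurable_continuous_onI continuous_intros)

lemma K_nth_measurable [measurable]: "(\<lambda>z. K z $ i) \<in> borel_measurable borel"
  using measurable_comp[OF K_measurable nth_measurable] by (simp add: comp_def)

lemma \<phi>_bounded: obtains C where "0 \<le> C" "\<And>z. \<phi> z \<le> C"
proof -
  obtain C where "0 \<le> C" "\<And>z. norm (\<phi> z) \<le> C"
    using continuous_support_bounded[OF \<phi>_continuous] support(1) by metis
  then show thesis using that nonneg by (metis abs_of_nonneg real_norm_def)
qed

lemma K_bounded: obtains C where "0 \<le> C" "\<And>z. norm (K z) \<le> C"
  using continuous_support_bounded[OF K_continuous] support(2) by metis

lemma \<phi>_integrable: "integrable lborel \<phi>"
  using \<phi>_bounded nonneg support(1)
  by (metis abs_of_nonneg integrable_bounded_support real_norm_def \<phi>_measurable)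

lemma K_integrable: "integrable lborel K"
  using K_bounded support(2) by (metis integrable_bounded_support K_measurable)

lemma K_L2: "K \<in> L2"
  using K_bounded support(2) by (metis L2_bounded_support K_measurable)

lemma integral_\<phi>_shift: "(LINT y|lborel. \<phi> (x - y)) = 1"
  by (simp add: lborel_integral_reflect integral_one)

lemma integrable_\<phi>_shift: "integrable lborel (\<lambda>y. \<phi> (x - y))"
  by (simp add: lborel_integrable_reflect \<phi>_integrable)

lemma integral_K: "(LINT z|lborel. K z) = 0"
proof -
  have "(LINT z|lborel. K z) = (LINT z|lborel. K (0 - z))"
    by (rule lborel_integral_reflect[symmetric]) simp
  also have "\<dots> = - (LINT z|lborel. K z)" by (simp add: odd)
  finally have "(LINT z|lborel. K z) + (LINT z|lborel. K z) = 0" by (simp only: eq_neg_iff_add_eq_0)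
  then have "2 *\<^sub>R (LINT z|lborel. K z) = 0" by (simp only: scaleR_2)
  then show ?thesis unfolding scaleR_eq_0_iff by simp
qed

lemma integral_K_shift: "(LINT y|lborel. K (x - y)) = 0"
  by (simp add: lborel_integral_reflect integral_K)

lemma integrable_K_shift: "integrable lborel (\<lambda>y. K (x - y))"
  by (simp add: lborel_integrable_reflect K_integrable)

lemma L2_K_shift: "(\<lambda>y. K (x - y)) \<in> L2"
proof (rule L2_I)
  show "integrable lborel (\<lambda>y. (norm (K (x - y)))\<^sup>2)"
    using L2_integrable[OF K_L2] lborel_integrable_reflect[of "\<lambda>z. (norm (K z))\<^sup>2" x] by simp
qed simp

lemma L2_norm_K_shift: "L2_norm (\<lambda>y. K (x - y)) = L2_norm K"
  using lborel_integral_reflect[of "\<lambda>z. (norm (K z))\<^sup>2" x] by (simp add: L2_norm_def)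

lemma L2_K_entry:
  shows "(\<lambda>y. K (x - y) $ i *\<^sub>R axis j (1::real)) \<in> L2"
    and "L2_norm (\<lambda>y. K (x - y) $ i *\<^sub>R axis j (1::real)) \<le> L2_norm K"
proof -
  have le: "(norm (K (x - y) $ i *\<^sub>R axis j (1::real)))\<^sup>2 \<le> (norm (K (x - y)))\<^sup>2" for y
    using component_le_norm_cart[of "K (x - y)" i] by (intro power_mono) auto
  have int: "integrable lborel (\<lambda>y. (norm (K (x - y) $ i *\<^sub>R axis j (1::real)))\<^sup>2)"
    by (rule Bochner_Integration.integrable_bound[OF L2_integrable[OF L2_K_shift[of x]]])
       (use le in \<open>auto simp: power_mult_distrib\<close>)
  show "(\<lambda>y. K (x - y) $ i *\<^sub>R axis j (1::real)) \<in> L2"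
    by (rule L2_I[OF _ int]) simp
  have "(LINT y|lborel. (norm (K (x - y) $ i *\<^sub>R axis j (1::real)))\<^sup>2) \<le> (LINT y|lborel. (norm (K (x - y)))\<^sup>2)"
    by (intro integral_mono int L2_integrable L2_K_shift le)
  then show "L2_norm (\<lambda>y. K (x - y) $ i *\<^sub>R axis j (1::real)) \<le> L2_norm K"
    unfolding L2_norm_K_shift[of x, symmetric] by (simp add: L2_norm_def)
qed

text \<open>Each entry is a pairing with a fixed \<open>L2\<close> field, so weak continuity of
  \<open>u\<close> becomes pointwise continuity of the mollified gradient, and Cauchy-Schwarz bounds
  it uniformly in \<open>x\<close>.\<close>

lemma conv_grad_pairing:
  "conv_grad h x $ i $ j = pairing h (\<lambda>y. K (x - y) $ i *\<^sub>R axis j 1)"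
  by (simp add: conv_grad_def pairing_def inner_axis)

lemma integrable_K_entry: "h \<in> L2 \<Longrightarrow> integrable lborel (\<lambda>y. K (x - y) $ i * h y $ j)"
  using L2_integrable_inner[OF _ L2_K_entry(1), of h x i j] by (simp add: inner_axis)

lemma conv_grad_bound:
  assumes "h \<in> L2"
  shows "norm (conv_grad h x) \<le> 9 * L2_norm K * L2_norm h"
proof -
  have e: "\<bar>conv_grad h x $ i $ j\<bar> \<le> L2_norm K * L2_norm h" for i j
  proof -
    have "\<bar>conv_grad h x $ i $ j\<bar> \<le> L2_norm h * L2_norm (\<lambda>y. K (x - y) $ i *\<^sub>R axis j (1::real))"
      unfolding conv_grad_pairing by (intro abs_pairing_le assms L2_K_entry)
    also have "\<dots> \<le> L2_norm h * L2_norm K"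
      by (intro mult_left_mono L2_K_entry L2_norm_nonneg)
    finally show ?thesis by (simp add: mult.commute)
  qed
  \<comment> \<open>Summing the absolute values of the 3 * 3 entries gives the factor 9.\<close>
  have "norm (conv_grad h x) \<le> (\<Sum>i\<in>UNIV. norm (conv_grad h x $ i))"
    unfolding norm_vec_def by (rule L2_set_le_sum) simp
  also have "\<dots> \<le> (\<Sum>i\<in>UNIV. \<Sum>j\<in>UNIV. \<bar>conv_grad h x $ i $ j\<bar>)"
    by (intro sum_mono order_trans[OF norm_le_l1_cart]) simp
  also have "\<dots> \<le> (\<Sum>i\<in>(UNIV::3 set). \<Sum>j\<in>(UNIV::3 set). L2_norm K * L2_norm h)"
    by (intro sum_mono e)
  finally show ?thesis by simp
qed

lemma conv_grad_measurable [measurable]: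
  assumes [measurable]: "h \<in> borel_measurable borel"
  shows "conv_grad h \<in> borel_measurable borel"
proof -
  have [measurable]: "(\<lambda>y. h y $ j) \<in> borel_measurable borel" for j
    using measurable_comp[OF assms nth_measurable] by (simp add: comp_def)
  have c: "(\<lambda>x. conv_grad h x $ i $ j) \<in> borel_measurable borel" for i j
    unfolding conv_grad_def by simp
  show ?thesis
    by (subst borel_measurable_euclidean_space) (auto simp: Basis_vec_def inner_axis c)
qed

lemma conv_grad_diff:
  assumes "f \<in> L2" "g \<in> L2"
  shows "conv_grad (\<lambda>y. f y - g y) x = conv_grad f x - conv_grad g x"
  by (simp add: vec_eq_iff conv_grad_pairing pairing_diff_left L2_K_entry assms)

lemma conv_grad_mult:
  assumes "h \<in> L2"
  shows "w \<bullet> (conv_grad h x *v w) = (LINT y|lborel. (w \<bullet> K (x - y)) * (w \<bullet> h y))"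
proof -
  have "w \<bullet> (conv_grad h x *v w) = (\<Sum>i\<in>UNIV. \<Sum>j\<in>UNIV. w $ i * w $ j * (LINT y|lborel. K (x - y) $ i * h y $ j))"
    by (simp add: inner_vec_def matrix_vector_mult_def conv_grad_def sum_distrib_left mult_ac)
  also have "\<dots> = (LINT y|lborel. (\<Sum>i\<in>UNIV. \<Sum>j\<in>UNIV. w $ i * w $ j * (K (x - y) $ i * h y $ j)))"
    using integrable_K_entry[OF assms] by (simp add: Bochner_Integration.integral_sum)
  also have "\<dots> = (LINT y|lborel. (w \<bullet> K (x - y)) * (w \<bullet> h y))"
    unfolding inner_vec_def sum_product by (simp add: mult_ac)
  finally show ?thesis .
qed

lemma pairing_tensor_bound:
  fixes A :: "real^3 \<Rightarrow> real^3^3"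
  assumes v: "v \<in> L2" and [measurable]: "A \<in> borel_measurable borel" and A: "\<And>x. norm (A x) \<le> c"
  shows "integrable lborel (\<lambda>x. tensor v v x \<bullet> A x)"
    and "\<bar>tensor v v x \<bullet> A x\<bar> \<le> c * (norm (v x))\<^sup>2"
    and "(\<integral>\<^sup>+x. ennreal \<bar>tensor v v x \<bullet> A x\<bar> \<partial>lborel) \<le> ennreal (c * (L2_norm v)\<^sup>2)"
    and "\<bar>pairing (tensor v v) A\<bar> \<le> c * (L2_norm v)\<^sup>2"
proof -
  have le: "norm (tensor v v x \<bullet> A x) \<le> c * (norm (v x))\<^sup>2" for x
  proof -
    have "norm (tensor v v x \<bullet> A x) \<le> norm (tensor v v x) * norm (A x)"
      by (simp add: Cauchy_Schwarz_ineq2)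
    also have "\<dots> \<le> (norm (v x))\<^sup>2 * c"
      by (intro mult_mono A) (auto simp: norm_tensor power2_eq_square)
    finally show ?thesis by (simp add: mult.commute)
  qed
  then show "\<bar>tensor v v x \<bullet> A x\<bar> \<le> c * (norm (v x))\<^sup>2" by simp
  show i: "integrable lborel (\<lambda>x. tensor v v x \<bullet> A x)"
    unfolding tensor_inner by (intro L2_integrable_inner v L2_bounded_matrix(1)[OF _ v A]) simp
  have "norm (pairing (tensor v v) A) \<le> (LINT x|lborel. c * (norm (v x))\<^sup>2)"
    unfolding pairing_def
    by (rule Bochner_Integration.integral_norm_bound_integral[OF i]) (use le L2_integrable[OF v] in auto)
  then show "\<bar>pairing (tensor v v) A\<bar> \<le> c * (L2_norm v)\<^sup>2" by (simp add: L2_norm_sq)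
  have "0 \<le> c" using A[of 0] norm_ge_zero order_trans by blast
  then have "(\<integral>\<^sup>+x. ennreal (c * (norm (v x))\<^sup>2) \<partial>lborel) = ennreal (c * (L2_norm v)\<^sup>2)"
    unfolding L2_norm_sq using L2_integrable[OF v]
    by (subst nn_integral_eq_integral) auto
  then show "(\<integral>\<^sup>+x. ennreal \<bar>tensor v v x \<bullet> A x\<bar> \<partial>lborel) \<le> ennreal (c * (L2_norm v)\<^sup>2)"
    using le by (metis (mono_tags, lifting) ennreal_leI nn_integral_mono real_norm_def)
qed

section \<open>Mollified test fields and incompressibility\<close>

lemma conv_eq: "g \<in> borel_measurable borel \<Longrightarrow> conv g x = (LINT y|lborel. \<phi> y *\<^sub>R g (x - y))"
  using lborel_integral_reflect[of "\<lambda>y. \<phi> (x - y) *\<^sub>R g y" x] by (simp add: conv_def)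

lemma iter_deriv_conv:
  assumes g: "smooth_on UNIV g" and R: "\<And>x. norm x > R \<Longrightarrow> g x = 0" and "set vs \<subseteq> Basis"
  shows "iter_deriv UNIV vs (conv g) = conv (iter_deriv UNIV vs g)"
    and "(iter_deriv UNIV vs (conv g) has_derivative
      (\<lambda>w. LINT y|lborel. \<phi> y *\<^sub>R frechet_derivative (iter_deriv UNIV vs g) (at (x - y)) w)) (at x)"
proof -
  have der: "(conv (iter_deriv UNIV vs g) has_derivative
      (\<lambda>w. LINT y|lborel. \<phi> y *\<^sub>R frechet_derivative (iter_deriv UNIV vs g) (at (x - y)) w)) (at x)"
    if vs: "set vs \<subseteq> Basis" for vs x
  proof -
    have "iter_deriv UNIV vs g \<in> borel_measurable borel"
      by (intro borel_measurable_continuous_onI smooth_on_iter_deriv g vs)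
    then have "conv (iter_deriv UNIV vs g) = (\<lambda>x. LINT y|lborel. \<phi> y *\<^sub>R iter_deriv UNIV vs g (x - y))"
      using conv_eq by blast
    then show ?thesis
      using has_derivative_convolution[OF \<phi>_integrable smooth_on_iter_deriv(1)[OF g vs]
          smooth_on_iter_deriv(3)[OF g vs] iter_deriv_support[of R g]] R by simp
  qed
  show eq: "iter_deriv UNIV vs (conv g) = conv (iter_deriv UNIV vs g)"
    using assms(3)
  proof (induction vs)
    case Nil
    show ?case by simp
  next
    case (Cons v vs)
    then have vs: "set vs \<subseteq> Basis" and v: "v \<in> Basis" by auto
    have m: "(\<lambda>x. frechet_derivative (iter_deriv UNIV vs g) (at x) v) \<in> borel_measurable borel"
      by (intro borel_measurable_continuous_onI smooth_on_iter_deriv g vs v)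
    show ?case
    proof
      fix x
      have "iter_deriv UNIV (v # vs) (conv g) x = frechet_derivative (conv (iter_deriv UNIV vs g)) (at x) v"
        using Cons.IH[OF vs] by simp
      also have "\<dots> = (LINT y|lborel. \<phi> y *\<^sub>R frechet_derivative (iter_deriv UNIV vs g) (at (x - y)) v)"
        by (simp only: frechet_derivative_at[OF der[OF vs], symmetric])
      also have "\<dots> = conv (iter_deriv UNIV (v # vs) g) x"
        by (simp only: iter_deriv.simps conv_eq[OF m])
      finally show "iter_deriv UNIV (v # vs) (conv g) x = conv (iter_deriv UNIV (v # vs) g) x" .
    qed
  qed
  show "(iter_deriv UNIV vs (conv g) has_derivative
      (\<lambda>w. LINT y|lborel. \<phi> y *\<^sub>R frechet_derivative (iter_deriv UNIV vs g) (at (x - y)) w)) (at x)"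
    unfolding eq by (rule der[OF assms(3)])
qed

text \<open>The roles in the convolution are exchanged here: a component of \<open>g\<close> is the
  weight and the kernel is differentiated. Uniqueness of derivatives identifies the result with the
  derivative computed on \<open>g\<close>.\<close>

lemma frechet_derivative_conv_nth:
  assumes g: "g \<in> test_sigma"
  shows "(conv g has_derivative frechet_derivative (conv g) (at x)) (at x)"
    and "frechet_derivative (conv g) (at x) w $ j = (LINT y|lborel. (K (x - y) \<bullet> w) * g y $ j)"
proof -
  obtain R where R: "\<And>x. norm x > R \<Longrightarrow> g x = 0" using test_sigma_support[OF g] by metis
  have sm: "smooth_on UNIV g" using g by (simp add: test_sigma_def)
  have gL: "g \<in> L2" using g by (rule test_sigma_L2)
  have gc: "continuous_on UNIV g" using smooth_on_iter_deriv(2)[OF sm, of "[]"] by simp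
  obtain C where C: "\<And>x. norm (g x) \<le> C" using continuous_support_bounded[OF gc R] by metis
  show D: "(conv g has_derivative frechet_derivative (conv g) (at x)) (at x)"
    using iter_deriv_conv(2)[OF sm, of R "[]" x] R
    by (auto simp: frechet_derivative_works[symmetric] differentiable_def)
  have gi: "integrable lborel g"
    using C R by (intro integrable_bounded_support borel_measurable_continuous_onI gc)
  have gj: "integrable lborel (\<lambda>y. g y $ j)"
    using integrable_inner_left[of "axis j 1" lborel g] gi by (simp add: inner_axis)
  have cj: "conv g x $ j = (LINT y|lborel. g y $ j *\<^sub>R \<phi> (x - y))" for x
  proof -
    obtain B where B: "\<And>z. \<phi> z \<le> B" using \<phi>_bounded by metis
    have "integrable lborel (\<lambda>y. \<phi> (x - y) *\<^sub>R g y)"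
      using C by (intro integrable_scaleR_bounded[OF integrable_\<phi>_shift] borel_measurable_continuous_onI gc)
    then have "conv g x \<bullet> axis j 1 = (LINT y|lborel. (\<phi> (x - y) *\<^sub>R g y) \<bullet> axis j 1)"
      unfolding conv_def by (intro integral_inner_left[symmetric])
    then show ?thesis by (simp add: inner_axis mult.commute)
  qed
  have "((\<lambda>x. LINT y|lborel. g y $ j *\<^sub>R \<phi> (x - y)) has_derivative
      (\<lambda>w. LINT y|lborel. g y $ j *\<^sub>R (K (x - y) \<bullet> w))) (at x)"
    by (rule has_derivative_convolution[OF gj deriv, where R=r])
       (auto intro!: continuous_intros K_continuous support(1))
  moreover have "((\<lambda>x. conv g x $ j) has_derivative (\<lambda>w. frechet_derivative (conv g) (at x) w $ j)) (at x)"
    by (rule bounded_linear.has_derivative[OF bounded_linear_vec_nth D])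
  ultimately have "(\<lambda>w. frechet_derivative (conv g) (at x) w $ j) = (\<lambda>w. LINT y|lborel. g y $ j *\<^sub>R (K (x - y) \<bullet> w))"
    unfolding cj by (rule has_derivative_unique[rotated])
  then show "frechet_derivative (conv g) (at x) w $ j = (LINT y|lborel. (K (x - y) \<bullet> w) * g y $ j)"
    by (simp add: fun_eq_iff mult.commute)
qed

lemma grad_conv:
  assumes "g \<in> test_sigma"
  shows "grad (conv g) = conv_grad g"
  using frechet_derivative_conv_nth(2)[OF assms]
  by (simp add: fun_eq_iff vec_eq_iff grad_def conv_grad_def inner_axis)

text \<open>One divergence computed twice. With the derivative on \<open>g\<close> it is an average
  of the divergence of \<open>g\<close>, hence 0; with the derivative on the kernel it is the
  integral in the second claim.\<close>

lemma divergence_conv: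
  assumes g: "g \<in> test_sigma"
  shows "divergence (conv g) x = 0" "(LINT y|lborel. K (x - y) \<bullet> g y) = 0"
proof -
  obtain R where R: "\<And>x. norm x > R \<Longrightarrow> g x = 0" using test_sigma_support[OF g] by metis
  have sm: "smooth_on UNIV g" using g by (simp add: test_sigma_def)
  have ax: "axis i 1 \<in> (Basis :: (real^3) set)" for i :: 3 by (simp add: axis_in_Basis_iff)
  let ?D = "\<lambda>i y. frechet_derivative g (at y) (axis i 1)"
  have fr: "frechet_derivative (conv g) (at x) w = (LINT y|lborel. \<phi> y *\<^sub>R frechet_derivative g (at (x - y)) w)" for w
    using frechet_derivative_at[OF iter_deriv_conv(2)[OF sm, of R "[]" x]] R by (simp add: fun_eq_iff)
  have c: "continuous_on UNIV (?D i)" for i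
    using smooth_on_iter_deriv(3)[OF sm, of "[]", OF _ ax[of i]] by simp
  have s: "norm y > R \<Longrightarrow> ?D i y = 0" for i y
    using iter_deriv_support[of R g y "[axis i 1]"] R by simp
  have int: "integrable lborel (\<lambda>y. \<phi> y *\<^sub>R ?D i (x - y))" for i
  proof -
    obtain C where C: "\<And>y. norm (?D i y) \<le> C" using continuous_support_bounded[OF c s] by metis
    have "?D i \<in> borel_measurable borel" by (intro borel_measurable_continuous_onI c)
    from borel_measurable_reflect[OF this] show ?thesis
      by (rule integrable_scaleR_bounded[OF \<phi>_integrable _ C])
  qed
  have "divergence (conv g) x = (\<Sum>i\<in>UNIV. (LINT y|lborel. \<phi> y *\<^sub>R ?D i (x - y)) \<bullet> axis i 1)"
    by (simp add: divergence_def fr inner_axis)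
  also have "\<dots> = (\<Sum>i\<in>UNIV. LINT y|lborel. (\<phi> y *\<^sub>R ?D i (x - y)) \<bullet> axis i 1)"
    by (intro sum.cong refl integral_inner_left[symmetric] int)
  also have "\<dots> = (LINT y|lborel. (\<Sum>i\<in>UNIV. (\<phi> y *\<^sub>R ?D i (x - y)) \<bullet> axis i 1))"
    by (rule Bochner_Integration.integral_sum[symmetric]) (intro integrable_inner_left int)
  also have "\<dots> = (LINT y|lborel. \<phi> y * divergence g (x - y))"
    by (simp add: divergence_def inner_axis sum_distrib_left)
  also have "\<dots> = 0" using g by (simp add: test_sigma_def)
  finally show 0: "divergence (conv g) x = 0" .
  have "divergence (conv g) x = (\<Sum>i\<in>UNIV. LINT y|lborel. K (x - y) $ i * g y $ i)"
    by (simp add: divergence_def frechet_derivative_conv_nth(2)[OF g] inner_axis)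
  also have "\<dots> = (LINT y|lborel. K (x - y) \<bullet> g y)"
    using integrable_K_entry[OF test_sigma_L2[OF g]]
    by (simp add: inner_vec_def Bochner_Integration.integral_sum)
  finally show "(LINT y|lborel. K (x - y) \<bullet> g y) = 0" using 0 by simp
qed

lemma conv_test_sigma:
  assumes g: "g \<in> test_sigma"
  shows "conv g \<in> test_sigma"
proof -
  obtain R where R: "\<And>x. norm x > R \<Longrightarrow> g x = 0" using test_sigma_support[OF g] by metis
  have sm: "smooth_on UNIV g" using g by (simp add: test_sigma_def)
  show ?thesis
  proof (rule test_sigmaI[where R="R + r"])
    show "smooth_on UNIV (conv g)"
      using iter_deriv_conv(2)[OF sm, of R] R
      by (auto simp: smooth_on_def differentiable_on_def differentiable_def)
    show "conv g x = 0" if x: "norm x > R + r" for x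
    proof -
      have *: "\<phi> (x - y) *\<^sub>R g y = 0" for y
        using norm_triangle_ineq[of "x - y" y] x R[of y] support(1)[of "x - y"]
        by (cases "norm y > R") auto
      show ?thesis by (simp only: conv_def * Bochner_Integration.integral_zero)
    qed
  qed (rule divergence_conv[OF g])
qed

text \<open>Incompressibility in a form that makes sense without derivatives: orthogonality to the
  translates of \<open>K\<close> is stable under \<open>L2\<close> limits, so it passes from test
  fields to their closure.\<close>

lemma integral_K_inner_eq_0:
  assumes h: "h \<in> H_sigma"
  shows "(LINT y|lborel. K (x - y) \<bullet> h y) = 0"
proof -
  have hL: "h \<in> L2" using h by (simp add: H_sigma_def)
  let ?k = "\<lambda>y. K (x - y)"
  have "\<bar>pairing ?k h\<bar> \<le> L2_norm K * e" if e: "0 < e" for e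
  proof -
    obtain g where g: "g \<in> test_sigma" "L2_norm (\<lambda>y. h y - g y) < e"
      using h e by (auto simp: H_sigma_def)
    have gL: "g \<in> L2" using g(1) by (rule test_sigma_L2)
    have "pairing ?k g = 0" using divergence_conv(2)[OF g(1)] by (simp add: pairing_def)
    then have "\<bar>pairing ?k h\<bar> = \<bar>pairing ?k (\<lambda>y. h y - g y)\<bar>"
      by (simp add: pairing_diff_right hL gL L2_K_shift)
    also have "\<dots> \<le> L2_norm ?k * L2_norm (\<lambda>y. h y - g y)"
      by (intro abs_pairing_le L2_K_shift L2_diff hL gL)
    also have "\<dots> \<le> L2_norm K * e"
      unfolding L2_norm_K_shift using g by (intro mult_left_mono) auto
    finally show ?thesis .
  qed
  then have "pairing ?k h = 0" by (rule eq_zero_if_arbitrarily_small) simp_all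
  then show ?thesis by (simp add: pairing_def)
qed

end

section \<open>Double integrals and the mollified bilinear form\<close>

lemma lborel_pair_integral_swap:
  fixes f :: "'a::euclidean_space \<times> 'a \<Rightarrow> real"
  assumes "f \<in> borel_measurable (lborel \<Otimes>\<^sub>M lborel)"
  shows "(LINT p|(lborel \<Otimes>\<^sub>M lborel). f (snd p, fst p)) = (LINT p|(lborel \<Otimes>\<^sub>M lborel). f p)"
  using lborel_pair.integral_product_swap[OF assms] by (simp add: case_prod_beta')

lemma lborel_pair_integrable_swap:
  fixes f :: "'a::euclidean_space \<times> 'a \<Rightarrow> real"
  assumes "integrable (lborel \<Otimes>\<^sub>M lborel) f"
  shows "integrable (lborel \<Otimes>\<^sub>M lborel) (\<lambda>p. f (snd p, fst p))"
  using lborel_pair.integrable_product_swap[OF assms] by (simp add: case_prod_beta')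

text \<open>Integrate in the second variable first: by translation and reflection invariance the
  inner integral does not depend on \<open>x\<close>.\<close>

lemma integrable_product_kernel:
  fixes f k :: "'a::euclidean_space \<Rightarrow> real"
  assumes f: "integrable lborel f" and k: "integrable lborel k"
  shows "integrable (lborel \<Otimes>\<^sub>M lborel) (\<lambda>p. f (fst p) * k (fst p - snd p))"
    and "(LINT p|(lborel \<Otimes>\<^sub>M lborel). f (fst p) * k (fst p - snd p)) = (LINT x|lborel. f x) * (LINT z|lborel. k z)"
proof -
  have [measurable]: "f \<in> borel_measurable borel" "k \<in> borel_measurable borel"
    using f k by auto
  have ks: "integrable lborel (\<lambda>y. k (x - y))" for x using k by (simp add: lborel_integrable_reflect)
  have ki: "(LINT y|lborel. k (x - y)) = (LINT z|lborel. k z)" for x by (simp add: lborel_integral_reflect)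
  have ka: "(LINT y|lborel. \<bar>k (x - y)\<bar>) = (LINT z|lborel. \<bar>k z\<bar>)" for x
    using lborel_integral_reflect[of "\<lambda>z. \<bar>k z\<bar>" x] by simp
  let ?F = "\<lambda>(x, y). f x * k (x - y)"
  have i: "integrable (lborel \<Otimes>\<^sub>M lborel) ?F"
  proof (rule lborel_pair.Fubini_integrable)
    show "integrable lborel (\<lambda>x. LINT y|lborel. norm (case (x, y) of (x, y) \<Rightarrow> f x * k (x - y)))"
      using f by (simp add: abs_mult ka)
  qed (use ks in \<open>auto simp: case_prod_beta'\<close>)
  then show "integrable (lborel \<Otimes>\<^sub>M lborel) (\<lambda>p. f (fst p) * k (fst p - snd p))"
    by (simp add: case_prod_beta')
  show "(LINT p|(lborel \<Otimes>\<^sub>M lborel). f (fst p) * k (fst p - snd p)) = (LINT x|lborel. f x) * (LINT z|lborel. k z)"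
    using lborel_pair.integral_fst'[OF i] by (simp add: ki case_prod_beta')
qed

context mollifier
begin

text \<open>Nonnegativity allows the kernel to be split into two square roots, one for each field.
  Since the kernel has mass one, each factor has exactly the \<open>L2\<close> norm of its field, so
  the constant is the same for all mollifiers.\<close>

lemma moll_form_Cauchy_Schwarz:
  assumes v: "v \<in> L2" and g: "g \<in> L2"
  shows "integrable (lborel \<Otimes>\<^sub>M lborel) (\<lambda>p. \<phi> (fst p - snd p) * (v (fst p) \<bullet> g (snd p)))"
    and "\<bar>moll_form v g\<bar> \<le> L2_norm v * L2_norm g"
proof -
  let ?P = "lborel \<Otimes>\<^sub>M lborel :: ((real^3) \<times> (real^3)) measure"
  note [measurable] = L2_measurable[OF v] L2_measurable[OF g]
  have sv: "integrable ?P (\<lambda>p. (norm (v (fst p)))\<^sup>2 * \<phi> (fst p - snd p))"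
    "(LINT p|?P. (norm (v (fst p)))\<^sup>2 * \<phi> (fst p - snd p)) = (L2_norm v)\<^sup>2"
    using integrable_product_kernel[OF L2_integrable[OF v] \<phi>_integrable]
    by (simp_all add: integral_one L2_norm_sq)
  have \<phi>_swap: "\<phi> (a - b) = \<phi> (b - a)" for a b using even[of "a - b"] by simp
  have sg0: "integrable ?P (\<lambda>p. (norm (g (fst p)))\<^sup>2 * \<phi> (fst p - snd p))"
    "(LINT p|?P. (norm (g (fst p)))\<^sup>2 * \<phi> (fst p - snd p)) = (L2_norm g)\<^sup>2"
    using integrable_product_kernel[OF L2_integrable[OF g] \<phi>_integrable]
    by (simp_all add: integral_one L2_norm_sq)
  have sg: "integrable ?P (\<lambda>p. (norm (g (snd p)))\<^sup>2 * \<phi> (fst p - snd p))"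
    "(LINT p|?P. (norm (g (snd p)))\<^sup>2 * \<phi> (fst p - snd p)) = (L2_norm g)\<^sup>2"
    using lborel_pair_integrable_swap[OF sg0(1)]
      lborel_pair_integral_swap[OF borel_measurable_integrable[OF sg0(1)]] sg0(2)
    by (simp_all add: \<phi>_swap)
  let ?a = "\<lambda>p. sqrt (\<phi> (fst p - snd p)) * norm (v (fst p))"
  let ?b = "\<lambda>p. sqrt (\<phi> (fst p - snd p)) * norm (g (snd p))"
  have sq: "(\<lambda>p. (?a p)\<^sup>2) = (\<lambda>p. (norm (v (fst p)))\<^sup>2 * \<phi> (fst p - snd p))"
    "(\<lambda>p. (?b p)\<^sup>2) = (\<lambda>p. (norm (g (snd p)))\<^sup>2 * \<phi> (fst p - snd p))"
    by (simp_all add: fun_eq_iff power_mult_distrib nonneg mult.commute)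
  have ab: "?a p * ?b p = \<phi> (fst p - snd p) * (norm (v (fst p)) * norm (g (snd p)))" for p
    using nonneg[of "fst p - snd p"] real_sqrt_mult_self[of "\<phi> (fst p - snd p)"]
    by (simp add: mult_ac)
  have CS: "integrable ?P (\<lambda>p. ?a p * ?b p)"
    "(LINT p|?P. \<bar>?a p * ?b p\<bar>) \<le> sqrt (LINT p|?P. (?a p)\<^sup>2) * sqrt (LINT p|?P. (?b p)\<^sup>2)"
    by (rule Cauchy_Schwarz_integral[of ?a ?P ?b]; simp add: sq sv sg)+
  have le: "norm (\<phi> (fst p - snd p) * (v (fst p) \<bullet> g (snd p))) \<le> \<bar>?a p * ?b p\<bar>" for p
    unfolding ab by (simp add: abs_mult nonneg mult_left_mono Cauchy_Schwarz_ineq2)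
  show i: "integrable ?P (\<lambda>p. \<phi> (fst p - snd p) * (v (fst p) \<bullet> g (snd p)))"
    by (rule Bochner_Integration.integrable_bound[OF CS(1)]) (use le in auto)
  have "norm (moll_form v g) \<le> (LINT p|?P. \<bar>?a p * ?b p\<bar>)"
    unfolding moll_form_def
    by (rule Bochner_Integration.integral_norm_bound_integral[OF i integrable_abs[OF CS(1)] le])
  also have "\<dots> \<le> L2_norm v * L2_norm g"
    using CS(2) unfolding sq sv(2) sg(2) by simp
  finally show "\<bar>moll_form v g\<bar> \<le> L2_norm v * L2_norm g" by simp
qed

lemma moll_form_commute:
  assumes "v \<in> L2" "g \<in> L2"
  shows "moll_form v g = moll_form g v"
proof -
  have \<phi>_swap: "\<phi> (a - b) = \<phi> (b - a)" for a b using even[of "a - b"] by simp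
  show ?thesis
    using lborel_pair_integral_swap[OF borel_measurable_integrable[OF moll_form_Cauchy_Schwarz(1)[OF assms]]]
    by (simp add: moll_form_def \<phi>_swap inner_commute)
qed

lemma moll_form_diff_right:
  assumes "v \<in> L2" "f \<in> L2" "g \<in> L2"
  shows "moll_form v (\<lambda>y. f y - g y) = moll_form v f - moll_form v g"
  unfolding moll_form_def inner_diff_right right_diff_distrib
  by (intro Bochner_Integration.integral_diff moll_form_Cauchy_Schwarz assms)

lemma moll_form_diff_left:
  assumes "v \<in> L2" "f \<in> L2" "g \<in> L2"
  shows "moll_form (\<lambda>y. f y - g y) v = moll_form f v - moll_form g v"
  using assms by (simp add: moll_form_commute[of _ v] L2_diff moll_form_diff_right)

lemma pairing_conv:
  assumes v: "v \<in> L2" and g: "g \<in> L2"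
  shows "pairing v (conv g) = moll_form v g"
proof -
  have int: "integrable lborel (\<lambda>y. \<phi> (x - y) *\<^sub>R g y)" for x
  proof -
    obtain C where C: "0 \<le> C" "\<And>z. \<phi> z \<le> C" using \<phi>_bounded by metis
    note [measurable] = L2_measurable[OF g]
    \<comment> \<open>The product of kernel and field is at most the sum of their squares, and a
      bounded kernel dominates its own square up to the factor \<open>C\<close>.\<close>
    have "integrable lborel (\<lambda>y. C * \<phi> (x - y) + (norm (g y))\<^sup>2)"
      using integrable_\<phi>_shift L2_integrable[OF g] by simp
    then show ?thesis
    proof (rule Bochner_Integration.integrable_bound)
      show "AE y in lborel. norm (\<phi> (x - y) *\<^sub>R g y) \<le> norm (C * \<phi> (x - y) + (norm (g y))\<^sup>2)"
      proof (rule AE_I2)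
        fix y
        let ?p = "\<phi> (x - y)" and ?n = "norm (g y)"
        have "2 * ?p * ?n \<le> ?p\<^sup>2 + ?n\<^sup>2" using sum_squares_bound[of ?p ?n] by simp
        moreover have "?p\<^sup>2 \<le> C * ?p"
          using C nonneg[of "x - y"] by (simp add: power2_eq_square mult_right_mono)
        moreover have "0 \<le> ?p * ?n" using nonneg by simp
        ultimately have "?p * ?n \<le> C * ?p + ?n\<^sup>2" by linarith
        then show "norm (?p *\<^sub>R g y) \<le> norm (C * ?p + ?n\<^sup>2)" using nonneg by simp
      qed
    qed simp
  qed
  have "pairing v (conv g) = (LINT x|lborel. LINT y|lborel. \<phi> (x - y) * (v x \<bullet> g y))"
    unfolding pairing_def conv_def
    by (intro Bochner_Integration.integral_cong refl, subst integral_inner_right[symmetric]) (auto simp: int)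
  also have "\<dots> = moll_form v g"
    using lborel_pair.integral_fst'[OF moll_form_Cauchy_Schwarz(1)[OF assms]] by (simp add: moll_form_def)
  finally show ?thesis .
qed

lemma conv_near:
  assumes g: "continuous_on UNIV g" "integrable lborel g"
    and near: "\<And>x y. dist x y \<le> r \<Longrightarrow> norm (g x - g y) \<le> \<eta>"
    and bdd: "\<And>x. norm (g x) \<le> C"
  shows "norm (conv g x - g x) \<le> \<eta>"
proof -
  have [measurable]: "g \<in> borel_measurable borel" using g(1) by (rule borel_measurable_continuous_onI)
  have i1: "integrable lborel (\<lambda>y. \<phi> (x - y) *\<^sub>R g y)"
    by (rule integrable_scaleR_bounded[OF integrable_\<phi>_shift _ bdd]) simp
  have i2: "integrable lborel (\<lambda>y. \<phi> (x - y) *\<^sub>R g x)"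
    using integrable_\<phi>_shift by simp
  have "conv g x - g x = (LINT y|lborel. \<phi> (x - y) *\<^sub>R g y) - (LINT y|lborel. \<phi> (x - y) *\<^sub>R g x)"
    using integrable_\<phi>_shift by (simp add: conv_def integral_\<phi>_shift)
  also have "\<dots> = (LINT y|lborel. \<phi> (x - y) *\<^sub>R (g y - g x))"
    by (simp add: scaleR_diff_right i1 i2)
  finally have *: "conv g x - g x = (LINT y|lborel. \<phi> (x - y) *\<^sub>R (g y - g x))" .
  have "norm (LINT y|lborel. \<phi> (x - y) *\<^sub>R (g y - g x)) \<le> (LINT y|lborel. \<phi> (x - y) * \<eta>)"
  proof (rule Bochner_Integration.integral_norm_bound_integral)
    show "integrable lborel (\<lambda>y. \<phi> (x - y) *\<^sub>R (g y - g x))"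
      using i1 i2 by (simp add: scaleR_diff_right)
    show "norm (\<phi> (x - y) *\<^sub>R (g y - g x)) \<le> \<phi> (x - y) * \<eta>" for y
      using near[of y x] support(1)[of "x - y"] nonneg[of "x - y"]
      by (cases "norm (x - y) > r") (auto simp: dist_norm norm_minus_commute intro!: mult_left_mono)
  qed (use integrable_\<phi>_shift in simp)
  also have "\<dots> = \<eta>" by (simp add: integral_\<phi>_shift)
  finally show ?thesis using * by simp
qed

text \<open>Both \<open>moll_form\<close> and \<open>pairing\<close> are bounded by the product of
  norms, so replacing \<open>v\<close> by \<open>g\<close> costs the same in each, whence the factor
  2. For \<open>g\<close> itself, uniform closeness of \<open>conv g\<close> to \<open>g\<close> is
  integrated against the norm of \<open>g\<close>.\<close>

lemma moll_form_near_norm: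
  assumes v: "v \<in> L2" and g: "g \<in> test_sigma" and e: "L2_norm (\<lambda>x. v x - g x) \<le> e"
    and near: "\<And>x y. dist x y \<le> r \<Longrightarrow> norm (g x - g y) \<le> \<eta>"
  shows "\<bar>moll_form v v - (L2_norm v)\<^sup>2\<bar> \<le> 2 * (L2_norm v + L2_norm g) * e + \<eta> * (LINT x|lborel. norm (g x))"
proof -
  have gL: "g \<in> L2" using g by (rule test_sigma_L2)
  obtain R where R: "\<And>x. norm x > R \<Longrightarrow> g x = 0" using test_sigma_support[OF g] by metis
  have gc: "continuous_on UNIV g"
    using g smooth_on_iter_deriv(2)[of g "[]"] by (simp add: test_sigma_def)
  obtain C where C: "\<And>x. norm (g x) \<le> C" using continuous_support_bounded[OF gc R] by metis
  have gi: "integrable lborel g"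
    using C R by (intro integrable_bounded_support borel_measurable_continuous_onI gc)
  let ?d = "\<lambda>x. v x - g x"
  have dL: "?d \<in> L2" using v gL by (rule L2_diff)
  have split: "b v v - b g g = b v ?d + b ?d g"
    if "b v ?d = b v v - b v g" "b ?d g = b v g - b g g" for b :: "vec_field \<Rightarrow> vec_field \<Rightarrow> real"
    using that by simp
  have gap: "\<bar>b v v - b g g\<bar> \<le> (L2_norm v + L2_norm g) * e"
    if "b v v - b g g = b v ?d + b ?d g"
      "\<bar>b v ?d\<bar> \<le> L2_norm v * L2_norm ?d" "\<bar>b ?d g\<bar> \<le> L2_norm ?d * L2_norm g" for b :: "vec_field \<Rightarrow> vec_field \<Rightarrow> real"
  proof -
    have "L2_norm v * L2_norm ?d \<le> L2_norm v * e" "L2_norm ?d * L2_norm g \<le> e * L2_norm g"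
      using e by (auto intro: mult_left_mono mult_right_mono)
    then show ?thesis using that by (simp add: algebra_simps)
  qed
  have "\<bar>moll_form v v - moll_form g g\<bar> \<le> (L2_norm v + L2_norm g) * e"
    by (rule gap[OF split, of moll_form])
      (rule moll_form_diff_right moll_form_diff_left moll_form_Cauchy_Schwarz(2) v gL dL)+
  moreover have "\<bar>pairing v v - pairing g g\<bar> \<le> (L2_norm v + L2_norm g) * e"
    by (rule gap[OF split, of pairing])
      (rule pairing_diff_right pairing_diff_left abs_pairing_le v gL dL)+
  moreover have "\<bar>moll_form g g - pairing g g\<bar> \<le> \<eta> * (LINT x|lborel. norm (g x))"
  proof -
    have cL: "conv g \<in> L2" by (intro test_sigma_L2 conv_test_sigma g)
    have "moll_form g g - pairing g g = pairing g (\<lambda>x. conv g x - g x)"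
      by (simp add: pairing_diff_right gL cL pairing_conv)
    also have "norm \<dots> \<le> (LINT x|lborel. norm (g x) * \<eta>)"
      unfolding pairing_def
    proof (rule Bochner_Integration.integral_norm_bound_integral)
      show "integrable lborel (\<lambda>x. g x \<bullet> (conv g x - g x))"
        by (intro L2_integrable_inner L2_diff gL cL)
      show "norm (g x \<bullet> (conv g x - g x)) \<le> norm (g x) * \<eta>" for x
        using conv_near[OF gc gi near C, of x] 
        by (simp add: order_trans[OF Cauchy_Schwarz_ineq2] mult_left_mono)
    qed (use gi in simp)
    finally show ?thesis by (simp add: mult.commute)
  qed
  ultimately show ?thesis unfolding L2_norm_sq_pairing by (simp add: abs_le_iff algebra_simps)
qed

text \<open>The Duchon--Robert form of the energy flux: expanding the cubic expression, all terms
  but the flux itself vanish because \<open>K\<close> is odd and \<open>v\<close> is divergence-free.\<close>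

lemma flux_identity:
  assumes v: "v \<in> H_sigma" and v3: "integrable lborel (\<lambda>x. norm (v x) ^ 3)"
  shows "pairing (tensor v v) (conv_grad v) = - 1/4 * (LINT p|(lborel \<Otimes>\<^sub>M lborel).
      (norm (v (fst p) - v (snd p)))\<^sup>2 * ((v (fst p) - v (snd p)) \<bullet> K (fst p - snd p)))"
proof -
  let ?P = "lborel \<Otimes>\<^sub>M lborel :: ((real^3) \<times> (real^3)) measure"
  have vL: "v \<in> L2" using v by (simp add: H_sigma_def)
  note [measurable] = L2_measurable[OF vL]
  have Kn: "integrable lborel (\<lambda>z. norm (K z))" using K_integrable by simp
  have K_swap: "K (a - b) = - K (b - a)" for a b using odd[of "b - a"] by simp
  have W1: "integrable ?P (\<lambda>p. norm (v (fst p)) ^ 3 * norm (K (fst p - snd p)))"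
    by (rule integrable_product_kernel(1)[OF v3 Kn])
  have W2: "integrable ?P (\<lambda>p. norm (v (snd p)) ^ 3 * norm (K (fst p - snd p)))"
  proof -
    have "norm (K (a - b)) = norm (K (b - a))" for a b using K_swap[of a b] by simp
    then show ?thesis using lborel_pair_integrable_swap[OF W1] by simp
  qed
  have W: "integrable ?P (\<lambda>p. norm (v (fst p)) ^ 3 * norm (K (fst p - snd p)) + norm (v (snd p)) ^ 3 * norm (K (fst p - snd p)))"
    by (rule Bochner_Integration.integrable_add[OF W1 W2])
  \<comment> \<open>\<open>T1\<close> integrates to 0 because \<open>K\<close> has mean zero,
    \<open>T2\<close> because \<open>v\<close> is divergence-free, and \<open>T3\<close> gives the
    flux. Each must be integrable by itself, which is where the cubic integrability enters.\<close>
  define T1 where "T1 p = (norm (v (fst p)))\<^sup>2 * (v (fst p) \<bullet> K (fst p - snd p))" for p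
  define T2 where "T2 p = (norm (v (fst p)))\<^sup>2 * (v (snd p) \<bullet> K (fst p - snd p))" for p
  define T3 where "T3 p = (v (fst p) \<bullet> K (fst p - snd p)) * (v (fst p) \<bullet> v (snd p))" for p
  have cube: "a\<^sup>2 * b \<le> a ^ 3 + b ^ 3" if "0 \<le> a" "0 \<le> b" for a b :: real
  proof (cases "a \<le> b")
    case True
    have "a\<^sup>2 * b \<le> b\<^sup>2 * b" using True that by (intro mult_right_mono power_mono) auto
    then show ?thesis using that by (simp add: power2_eq_square power3_eq_cube add_increasing)
  next
    case False
    have "a\<^sup>2 * b \<le> a\<^sup>2 * a" using False that by (intro mult_left_mono) auto
    then show ?thesis using that by (simp add: power2_eq_square power3_eq_cube add_increasing2)
  qed
  have bnd: "norm (v x) * norm (v x) * norm (v y) * norm k \<le> norm (v x) ^ 3 * norm k + norm (v y) ^ 3 * norm k"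
    for x y and k :: "real^3"
    using mult_right_mono[OF cube[of "norm (v x)" "norm (v y)"], of "norm k"]
    by (simp add: power2_eq_square distrib_right)
  have m: "T1 \<in> borel_measurable ?P" "T2 \<in> borel_measurable ?P" "T3 \<in> borel_measurable ?P"
    unfolding T1_def T2_def T3_def by measurable
  have i1: "integrable ?P T1"
  proof (rule Bochner_Integration.integrable_bound[OF W1 m(1)], rule AE_I2)
    fix p
    show "norm (T1 p) \<le> norm (norm (v (fst p)) ^ 3 * norm (K (fst p - snd p)))"
      using mult_left_mono[OF Cauchy_Schwarz_ineq2[of "v (fst p)" "K (fst p - snd p)"], of "(norm (v (fst p)))\<^sup>2"]
      by (simp add: T1_def abs_mult power2_eq_square power3_eq_cube mult_ac)
  qed
  have i2: "integrable ?P T2"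
  proof (rule Bochner_Integration.integrable_bound[OF W m(2)], rule AE_I2)
    fix p
    have "norm (T2 p) \<le> (norm (v (fst p)))\<^sup>2 * (norm (v (snd p)) * norm (K (fst p - snd p)))"
      unfolding T2_def real_norm_def abs_mult abs_power2
      by (intro mult_mono Cauchy_Schwarz_ineq2) auto
    also have "\<dots> \<le> norm (v (fst p)) ^ 3 * norm (K (fst p - snd p)) + norm (v (snd p)) ^ 3 * norm (K (fst p - snd p))"
      using bnd[of "fst p" "snd p" "K (fst p - snd p)"] by (simp add: power2_eq_square mult_ac)
    finally show "norm (T2 p) \<le> norm (norm (v (fst p)) ^ 3 * norm (K (fst p - snd p)) + norm (v (snd p)) ^ 3 * norm (K (fst p - snd p)))"
      by simp
  qed
  have i3: "integrable ?P T3"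
  proof (rule Bochner_Integration.integrable_bound[OF W m(3)], rule AE_I2)
    fix p
    have "norm (T3 p) \<le> (norm (v (fst p)) * norm (K (fst p - snd p))) * (norm (v (fst p)) * norm (v (snd p)))"
      unfolding T3_def real_norm_def abs_mult by (intro mult_mono Cauchy_Schwarz_ineq2) auto
    also have "\<dots> \<le> norm (v (fst p)) ^ 3 * norm (K (fst p - snd p)) + norm (v (snd p)) ^ 3 * norm (K (fst p - snd p))"
      using bnd[of "fst p" "snd p" "K (fst p - snd p)"] by (simp add: mult_ac)
    finally show "norm (T3 p) \<le> norm (norm (v (fst p)) ^ 3 * norm (K (fst p - snd p)) + norm (v (snd p)) ^ 3 * norm (K (fst p - snd p)))"
      by simp
  qed
  have z1: "(LINT p|?P. T1 p) = 0"
  proof -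
    have "(LINT y|lborel. T1 (x, y)) = 0" for x
      using integral_inner_right[of "v x" lborel "\<lambda>y. K (x - y)"] integrable_K_shift
      by (simp add: T1_def integral_K_shift)
    then show ?thesis using lborel_pair.integral_fst'[OF i1] by simp
  qed
  have z2: "(LINT p|?P. T2 p) = 0"
  proof -
    have "(LINT y|lborel. T2 (x, y)) = 0" for x
      using integral_K_inner_eq_0[OF v, of x] by (simp add: T2_def inner_commute)
    then show ?thesis using lborel_pair.integral_fst'[OF i2] by simp
  qed
  have z3: "(LINT p|?P. T3 p) = pairing (tensor v v) (conv_grad v)"
  proof -
    have "(LINT p|?P. T3 p) = (LINT x|lborel. LINT y|lborel. T3 (x, y))"
      by (rule lborel_pair.integral_fst'[OF i3, symmetric])
    also have "\<dots> = pairing (tensor v v) (conv_grad v)"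
      by (simp add: pairing_def tensor_inner conv_grad_mult[OF vL] T3_def)
    finally show ?thesis .
  qed
  \<comment> \<open>The cubic expression is \<open>?S\<close> plus its image under swapping the
    points, since \<open>K\<close> changes sign under the swap. Each half integrates to -2 times the
    flux, which accounts for the factor -1/4.\<close>
  let ?S = "\<lambda>p. T1 p - T2 p - 2 * T3 p"
  have iS: "integrable ?P ?S" using i1 i2 i3 by simp
  have "(norm (v (fst p) - v (snd p)))\<^sup>2 * ((v (fst p) - v (snd p)) \<bullet> K (fst p - snd p))
      = ?S p + ?S (snd p, fst p)" for p
    unfolding T1_def T2_def T3_def fst_conv snd_conv K_swap[of "snd p" "fst p"]
    by (simp add: power2_norm_eq_inner inner_diff_left inner_diff_right inner_commute algebra_simps)
  then have "(LINT p|?P. (norm (v (fst p) - v (snd p)))\<^sup>2 * ((v (fst p) - v (snd p)) \<bullet> K (fst p - snd p)))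
      = (LINT p|?P. ?S p) + (LINT p|?P. ?S (snd p, fst p))"
    using iS lborel_pair_integrable_swap[OF iS] by (simp only: Bochner_Integration.integral_add)
  also have "(LINT p|?P. ?S (snd p, fst p)) = (LINT p|?P. ?S p)"
    by (rule lborel_pair_integral_swap) (use iS in auto)
  also have "(LINT p|?P. ?S p) = - 2 * pairing (tensor v v) (conv_grad v)"
    using i1 i2 i3 by (simp add: z1 z2 z3)
  finally show ?thesis by simp
qed

end

section \<open>The energy flux\<close>

text \<open>For p = 3 + 3 \<alpha> this is the cube of the Gagliardo seminorm of W^(\<alpha>,3).
  Values in \<open>ennreal\<close> allow it to be infinite at individual times.\<close>

definition gagliardo :: "real \<Rightarrow> vec_field \<Rightarrow> ennreal" where
  "gagliardo p v = (\<integral>\<^sup>+y. (\<integral>\<^sup>+x. ennreal (norm (v x - v y) ^ 3 / norm (x - y) powr p) \<partial>lborel) \<partial>lborel)"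

lemma gagliardo_product:
  assumes [measurable]: "v \<in> borel_measurable borel"
  shows "gagliardo p v = (\<integral>\<^sup>+z. ennreal (norm (v (fst z) - v (snd z)) ^ 3 / norm (fst z - snd z) powr p)
      \<partial>(lborel \<Otimes>\<^sub>M lborel))"
  unfolding gagliardo_def
  using lborel_pair.nn_integral_snd[of "\<lambda>z. ennreal (norm (v (fst z) - v (snd z)) ^ 3 / norm (fst z - snd z) powr p)"]
  by simp

lemma gagliardo_swap:
  assumes [measurable]: "v \<in> borel_measurable borel"
  shows "(\<integral>\<^sup>+x. (\<integral>\<^sup>+y. ennreal (norm (v x - v y) ^ 3 / norm (x - y) powr p) \<partial>lborel) \<partial>lborel) = gagliardo p v"
  using lborel.nn_integral_fst[of "\<lambda>z. ennreal (norm (v (fst z) - v (snd z)) ^ 3 / norm (fst z - snd z) powr p)" lborel]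
  by (simp add: gagliardo_product)

text \<open>For \<open>dist x y < 1\<close> either \<open>\<bar>v y\<bar> \<le> \<bar>v x\<bar> / 2\<close>, and then \<open>\<bar>v x\<bar>\<^sup>3 \<le> 8 \<bar>v x - v y\<bar>\<^sup>3\<close>,
  or \<open>\<bar>v x\<bar>\<^sup>3 \<le> 4 \<bar>v x\<bar> \<bar>v y\<bar>\<^sup>2\<close>. Averaging over the unit ball around \<open>x\<close> bounds \<open>\<bar>v x\<bar>\<^sup>3\<close>.\<close>

lemma L3_of_gagliardo:
  assumes v: "v \<in> L2" and p: "0 \<le> p" and fin: "gagliardo p v < \<infinity>"
  shows "integrable lborel (\<lambda>x. norm (v x) ^ 3)"
proof -
  note [measurable] = L2_measurable[OF v]
  let ?g = "\<lambda>x y. norm (v x - v y) ^ 3 / norm (x - y) powr p"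
  define V where "V = unit_ball_vol (real DIM(real^3))"
  have V: "0 < V" by (simp add: V_def)
  have ball: "emeasure lborel (ball x 1) = ennreal V" for x :: "real^3"
    by (simp add: emeasure_ball V_def)
  define N where "N = (L2_norm v)\<^sup>2"
  have N: "0 \<le> N" by (simp add: N_def)
  \<comment> \<open>The threshold for absorption: above \<open>L\<close> the term 4 |v x| N is at
    most half of V |v x|^3 and moves to the left-hand side; below \<open>L\<close> the cube is at
    most L |v x|^2.\<close>
  define L where "L = sqrt (8 * N / V)"
  have L: "0 \<le> L" "L\<^sup>2 = 8 * N / V" using N V by (simp_all add: L_def)
  define H where "H x = (\<integral>\<^sup>+y. ennreal (?g x y) \<partial>lborel)" for x
  have pw: "norm (v x) ^ 3 \<le> 8 * ?g x y + 4 * norm (v x) * (norm (v y))\<^sup>2" if y: "y \<in> ball x 1" for x y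
  proof (cases "norm (v y) \<le> norm (v x) / 2")
    case True
    \<comment> \<open>Inside the unit ball the denominator is at most 1, so dropping it only
      decreases the quotient; on the diagonal both sides are 0.\<close>
    have d: "norm (v x - v y) ^ 3 \<le> ?g x y"
    proof (cases "x = y")
      case False
      then have "0 < norm (x - y)" "norm (x - y) \<le> 1" using y by (auto simp: dist_norm)
      then have "0 < norm (x - y) powr p" "norm (x - y) powr p \<le> 1" using p by (auto intro: powr_le1)
      then show ?thesis by (simp add: le_divide_eq mult_left_le)
    qed simp
    have "norm (v x) \<le> 2 * norm (v x - v y)"
      using True norm_triangle_sub[of "v x" "v y"] by simp
    then have "norm (v x) ^ 3 \<le> (2 * norm (v x - v y)) ^ 3" by (intro power_mono) auto
    also have "\<dots> \<le> 8 * ?g x y" using d by (simp add: power_mult_distrib)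
    finally show ?thesis by (simp add: add_increasing2)
  next
    case False
    have "(norm (v x))\<^sup>2 \<le> (2 * norm (v y))\<^sup>2" using False by (intro power_mono) auto
    then have "norm (v x) * (norm (v x))\<^sup>2 \<le> norm (v x) * (4 * (norm (v y))\<^sup>2)"
      by (intro mult_left_mono) (auto simp: power_mult_distrib)
    then have "norm (v x) ^ 3 \<le> 4 * norm (v x) * (norm (v y))\<^sup>2"
      by (simp add: power3_eq_cube power2_eq_square mult_ac)
    then show ?thesis by (simp add: add_increasing)
  qed
  have avg: "ennreal (V * norm (v x) ^ 3) \<le> 8 * H x + ennreal (4 * norm (v x) * N)" for x
  proof -
    have "ennreal (V * norm (v x) ^ 3) = (\<integral>\<^sup>+y. ennreal (norm (v x) ^ 3) * indicator (ball x 1) y \<partial>lborel)"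
      using V by (subst nn_integral_cmult_indicator) (auto simp: ball mult.commute simp flip: ennreal_mult)
    also have "\<dots> \<le> (\<integral>\<^sup>+y. 8 * ennreal (?g x y) + ennreal (4 * norm (v x) * (norm (v y))\<^sup>2) \<partial>lborel)"
    proof (rule nn_integral_mono)
      fix y
      show "ennreal (norm (v x) ^ 3) * indicator (ball x 1) y
          \<le> 8 * ennreal (?g x y) + ennreal (4 * norm (v x) * (norm (v y))\<^sup>2)"
      proof (cases "y \<in> ball x 1")
        case True
        have "ennreal (norm (v x) ^ 3) \<le> ennreal (8 * ?g x y + 4 * norm (v x) * (norm (v y))\<^sup>2)"
          by (rule ennreal_leI[OF pw[OF True]])
        also have "\<dots> = 8 * ennreal (?g x y) + ennreal (4 * norm (v x) * (norm (v y))\<^sup>2)"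
          by (subst ennreal_plus) (auto simp: ennreal_mult simp del: times_divide_eq_right)
        finally show ?thesis using True by simp
      qed simp
    qed
    also have "\<dots> = 8 * H x + (\<integral>\<^sup>+y. ennreal (4 * norm (v x) * (norm (v y))\<^sup>2) \<partial>lborel)"
      by (subst nn_integral_add) (auto simp: H_def nn_integral_cmult)
    also have "(\<integral>\<^sup>+y. ennreal (4 * norm (v x) * (norm (v y))\<^sup>2) \<partial>lborel) = ennreal (4 * norm (v x) * N)"
      using L2_integrable[OF v] by (subst nn_integral_eq_integral) (auto simp: N_def L2_norm_sq)
    finally show ?thesis .
  qed
  have bnd: "ennreal (norm (v x) ^ 3) \<le> ennreal (16 / V) * H x + ennreal L * ennreal ((norm (v x))\<^sup>2)" for x
  proof (cases "H x")
    case (real h)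
    let ?a = "norm (v x)"
    have "8 * H x + ennreal (4 * ?a * N) = ennreal (8 * h + 4 * ?a * N)"
      using real N by (simp add: ennreal_mult)
    then have "ennreal (V * ?a ^ 3) \<le> ennreal (8 * h + 4 * ?a * N)"
      using avg[of x] by (simp only:)
    then have *: "V * ?a ^ 3 \<le> 8 * h + 4 * ?a * N"
      using real N by (subst (asm) ennreal_le_iff) auto
    have "?a ^ 3 \<le> 16 / V * h + L * ?a\<^sup>2"
    proof (cases "?a \<le> L")
      case True
      then have "?a * ?a\<^sup>2 \<le> L * ?a\<^sup>2" by (intro mult_right_mono) auto
      moreover have "0 \<le> 16 / V * h" using real V by simp
      moreover have "?a ^ 3 = ?a * ?a\<^sup>2" by (simp add: power3_eq_cube power2_eq_square)
      ultimately show ?thesis by linarith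
    next
      case False
      then have "L\<^sup>2 \<le> ?a\<^sup>2" using L by (intro power_mono) auto
      then have "8 * N \<le> V * ?a\<^sup>2" using L V by (simp add: field_simps)
      then have "?a * (8 * N) \<le> ?a * (V * ?a\<^sup>2)" by (intro mult_left_mono) auto
      moreover have "?a * (V * ?a\<^sup>2) = V * ?a ^ 3" by (simp add: power3_eq_cube power2_eq_square)
      ultimately have "V * ?a ^ 3 \<le> 16 * h" using * by linarith
      then have "?a ^ 3 \<le> 16 / V * h" using V by (simp add: field_simps)
      moreover have "0 \<le> L * ?a\<^sup>2" using L by simp
      ultimately show ?thesis by linarith
    qed
    then have "ennreal (?a ^ 3) \<le> ennreal (16 / V * h + L * ?a\<^sup>2)" by (rule ennreal_leI)
    also have "\<dots> = ennreal (16 / V) * H x + ennreal L * ennreal (?a\<^sup>2)"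
      using real L V by (simp add: ennreal_mult del: times_divide_eq_left)
    finally show ?thesis .
  next
    case top
    then show ?thesis using V by (simp add: ennreal_mult_top)
  qed
  have [measurable]: "H \<in> borel_measurable lborel"
    unfolding H_def[abs_def] by measurable
  have "(\<integral>\<^sup>+x. ennreal (norm (v x) ^ 3) \<partial>lborel)
      \<le> (\<integral>\<^sup>+x. ennreal (16 / V) * H x + ennreal L * ennreal ((norm (v x))\<^sup>2) \<partial>lborel)"
    by (intro nn_integral_mono bnd)
  also have "\<dots> = ennreal (16 / V) * (\<integral>\<^sup>+x. H x \<partial>lborel) + ennreal L * (\<integral>\<^sup>+x. ennreal ((norm (v x))\<^sup>2) \<partial>lborel)"
    by (simp add: nn_integral_add nn_integral_cmult)
  also have "(\<integral>\<^sup>+x. H x \<partial>lborel) = gagliardo p v"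
    unfolding H_def by (rule gagliardo_swap) simp
  also have "(\<integral>\<^sup>+x. ennreal ((norm (v x))\<^sup>2) \<partial>lborel) = ennreal N"
    using L2_integrable[OF v] by (subst nn_integral_eq_integral) (auto simp: N_def L2_norm_sq)
  also have "ennreal (16 / V) * gagliardo p v + ennreal L * ennreal N < \<infinity>"
    using fin by (simp add: ennreal_mult_less_top less_top)
  finally show ?thesis by (intro integrableI_nonneg) auto
qed

text \<open>\<open>g\<close> carries no measurability hypothesis, so the constant is divided out on
  the side of \<open>f\<close>. This matters in time, where measurability of the Gagliardo integral
  of \<open>u \<tau>\<close> is not known.\<close>

lemma nn_integral_le_cmult:
  assumes [measurable]: "f \<in> borel_measurable M" and c: "0 < c" and le: "\<And>x. f x \<le> ennreal c * g x"
  shows "(\<integral>\<^sup>+x. f x \<partial>M) \<le> ennreal c * (\<integral>\<^sup>+x. g x \<partial>M)"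
proof -
  have cc: "ennreal c * ennreal (1 / c) = 1" using c by (simp flip: ennreal_mult)
  have "(\<integral>\<^sup>+x. f x \<partial>M) = ennreal c * (\<integral>\<^sup>+x. ennreal (1 / c) * f x \<partial>M)"
    by (simp add: nn_integral_cmult cc mult.assoc[symmetric])
  also have "\<dots> \<le> ennreal c * (\<integral>\<^sup>+x. g x \<partial>M)"
  proof (intro mult_left_mono nn_integral_mono)
    fix x
    have "ennreal (1 / c) * f x \<le> ennreal (1 / c) * (ennreal c * g x)"
      by (intro mult_left_mono le) simp
    also have "\<dots> = g x" by (metis cc mult.assoc mult.commute mult_1)
    finally show "ennreal (1 / c) * f x \<le> g x" .
  qed simp
  finally show ?thesis .
qed

lemma abs_integral_le_nn_integral:
  "ennreal \<bar>integral\<^sup>L M f\<bar> \<le> (\<integral>\<^sup>+x. ennreal \<bar>f x\<bar> \<partial>M)" for f :: "'a \<Rightarrow> real"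
  using integral_norm_bound_ennreal[of M f] not_integrable_integral_eq[of M f]
  by (cases "integrable M f") auto

context mollifier
begin

text \<open>The hypothesis on \<kappa> says that \<open>K\<close> is dominated by \<kappa> times the
  singular Gagliardo weight. An infinite Gagliardo integral is harmless because \<kappa> is
  positive: the right-hand side is then infinite and not 0 times infinity.\<close>

lemma flux_bound:
  assumes v: "v \<in> H_sigma" and p: "0 \<le> p" and \<kappa>: "0 < \<kappa>" "\<And>z. norm (K z) * norm z powr p \<le> \<kappa>"
  shows "ennreal \<bar>pairing (tensor v v) (conv_grad v)\<bar> \<le> ennreal \<kappa> * gagliardo p v"
proof (cases "gagliardo p v < \<infinity>")
  case False
  then have "gagliardo p v = top" by (metis infinity_ennreal_def top.not_eq_extremum)
  then show ?thesis using \<kappa>(1) by (simp add: ennreal_mult_top)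
next
  case True
  let ?P = "lborel \<Otimes>\<^sub>M lborel :: ((real^3) \<times> (real^3)) measure"
  have vL: "v \<in> L2" using v by (simp add: H_sigma_def)
  note [measurable] = L2_measurable[OF vL]
  have v3: "integrable lborel (\<lambda>x. norm (v x) ^ 3)"
    by (rule L3_of_gagliardo[OF vL p True])
  let ?f = "\<lambda>z. (norm (v (fst z) - v (snd z)))\<^sup>2 * ((v (fst z) - v (snd z)) \<bullet> K (fst z - snd z))"
  have "\<bar>pairing (tensor v v) (conv_grad v)\<bar> \<le> \<bar>LINT z|?P. ?f z\<bar>"
    unfolding flux_identity[OF v v3] by (simp add: abs_mult)
  then have "ennreal \<bar>pairing (tensor v v) (conv_grad v)\<bar> \<le> (\<integral>\<^sup>+z. ennreal \<bar>?f z\<bar> \<partial>?P)"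
    by (intro order_trans[OF ennreal_leI abs_integral_le_nn_integral])
  also have "\<dots> \<le> ennreal \<kappa> * (\<integral>\<^sup>+z. ennreal (norm (v (fst z) - v (snd z)) ^ 3 / norm (fst z - snd z) powr p) \<partial>?P)"
  proof (rule nn_integral_le_cmult[OF _ \<kappa>(1)])
    fix z
    let ?d = "v (fst z) - v (snd z)" and ?w = "fst z - snd z"
    have "\<bar>?f z\<bar> \<le> (norm ?d)\<^sup>2 * (norm ?d * norm (K ?w))"
      unfolding abs_mult abs_power2 by (intro mult_left_mono Cauchy_Schwarz_ineq2) simp
    also have "\<dots> = norm ?d ^ 3 * norm (K ?w)" by (simp add: power2_eq_square power3_eq_cube)
    also have "\<dots> \<le> \<kappa> * (norm ?d ^ 3 / norm ?w powr p)"
    proof (cases "?w = 0")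
      case False
      then have "norm (K ?w) \<le> \<kappa> / norm ?w powr p" using \<kappa>(2)[of ?w] by (simp add: pos_le_divide_eq)
      then have "norm ?d ^ 3 * norm (K ?w) \<le> norm ?d ^ 3 * (\<kappa> / norm ?w powr p)"
        by (intro mult_left_mono) auto
      then show ?thesis by (simp add: mult.commute)
    qed simp
    finally have "ennreal \<bar>?f z\<bar> \<le> ennreal (\<kappa> * (norm ?d ^ 3 / norm ?w powr p))" by (rule ennreal_leI)
    then show "ennreal \<bar>?f z\<bar> \<le> ennreal \<kappa> * ennreal (norm ?d ^ 3 / norm ?w powr p)"
      using \<kappa>(1) by (simp add: ennreal_mult del: times_divide_eq_right)
  qed simp
  also have "\<dots> = ennreal \<kappa> * gagliardo p v" by (simp add: gagliardo_product)
  finally show ?thesis .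
qed

end

section \<open>The mollified energy balance\<close>

context mollifier
begin

text \<open>The field \<open>conv g\<close>, constant in time, is admissible. The convergence
  proviso has to be checked: the time derivative vanishes, and the nonlinear integral in space is
  bounded uniformly in time.\<close>

lemma mollified_weak_form_test:
  assumes T: "0 < T" and u: "weak_euler_solution T u" and t: "t \<in> {0..T}" and g: "g \<in> test_sigma"
  shows "moll_form (u t) g - moll_form (u 0) g
    = (LINT \<tau>:{0..t}|lborel. pairing (tensor (u \<tau>) (u \<tau>)) (conv_grad g))"
proof -
  have uC: "u \<in> C_weak T" using u by (simp add: weak_euler_solution_def)
  obtain M where M: "\<And>s. s \<in> {0..T} \<Longrightarrow> L2_norm (u s) \<le> M" using C_weak_bounded[OF uC] by blast
  have uL: "u s \<in> L2" if "s \<in> {0..T}" for s using C_weak_L2[OF uC that] .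
  have gL: "g \<in> L2" using g by (rule test_sigma_L2)
  note [measurable] = L2_measurable[OF gL]
  let ?\<psi> = "\<lambda>_::real. conv g"
  define c where "c = 9 * L2_norm K * L2_norm g"
  have c: "0 \<le> c" "\<And>x. norm (conv_grad g x) \<le> c"
    using conv_grad_bound[OF gL] by (simp_all add: c_def)
  have \<psi>: "?\<psi> \<in> schwartz_sigma_T T"
    by (intro schwartz_sigma_T_const T test_sigma_schwartz conv_test_sigma g)
  have td: "time_deriv T ?\<psi> s = (\<lambda>_. 0)" if "s \<in> {0..t}" for s
    using time_deriv_const[OF T, of s] that t by auto
  have "(\<integral>\<^sup>+\<tau>\<in>{0..t}. (\<integral>\<^sup>+x. ennreal \<bar>u \<tau> x \<bullet> time_deriv T ?\<psi> \<tau> x\<bar> \<partial>lborel) \<partial>lborel) = (\<integral>\<^sup>+\<tau>. 0 \<partial>(lborel::real measure))"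
    by (intro nn_integral_cong) (auto simp: td indicator_def)
  moreover have "(\<integral>\<^sup>+\<tau>\<in>{0..t}. (\<integral>\<^sup>+x. ennreal \<bar>tensor (u \<tau>) (u \<tau>) x \<bullet> grad (?\<psi> \<tau>) x\<bar> \<partial>lborel) \<partial>lborel)
      \<le> (\<integral>\<^sup>+\<tau>. ennreal (c * M\<^sup>2) * indicator {0..t} \<tau> \<partial>lborel)"
  proof (rule nn_integral_mono)
    fix \<tau>
    show "(\<integral>\<^sup>+x. ennreal \<bar>tensor (u \<tau>) (u \<tau>) x \<bullet> grad (?\<psi> \<tau>) x\<bar> \<partial>lborel) * indicator {0..t} \<tau>
        \<le> ennreal (c * M\<^sup>2) * indicator {0..t} \<tau>"
    proof (cases "\<tau> \<in> {0..t}")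
      case True
      then have \<tau>: "\<tau> \<in> {0..T}" using t by auto
      have "(\<integral>\<^sup>+x. ennreal \<bar>tensor (u \<tau>) (u \<tau>) x \<bullet> conv_grad g x\<bar> \<partial>lborel) \<le> ennreal (c * (L2_norm (u \<tau>))\<^sup>2)"
        by (rule pairing_tensor_bound(3)[OF uL[OF \<tau>] _ c(2)]) simp
      also have "\<dots> \<le> ennreal (c * M\<^sup>2)"
        by (intro ennreal_leI mult_left_mono power_mono M \<tau> c L2_norm_nonneg)
      finally show ?thesis using True by (simp add: grad_conv[OF g])
    qed simp
  qed
  moreover have "(\<integral>\<^sup>+\<tau>. ennreal (c * M\<^sup>2) * indicator {0..t} \<tau> \<partial>lborel) < \<infinity>"
    using t by (subst nn_integral_cmult_indicator) (auto simp: ennreal_mult_less_top)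
  ultimately have conv: "weak_form_converges T u ?\<psi> t"
    unfolding weak_form_converges_def by auto
  have "(LINT \<tau>:{0..t}|lborel. pairing (u \<tau>) (time_deriv T ?\<psi> \<tau>)) = (LINT \<tau>:{0..t}|lborel. 0)"
    by (rule set_lebesgue_integral_cong) (auto simp: td pairing_def)
  moreover have "pairing (u t) (?\<psi> t) - pairing (u 0) (?\<psi> 0)
        - (LINT \<tau>:{0..t}|lborel. pairing (u \<tau>) (time_deriv T ?\<psi> \<tau>))
      = (LINT \<tau>:{0..t}|lborel. pairing (tensor (u \<tau>) (u \<tau>)) (grad (?\<psi> \<tau>)))"
    using u t \<psi> conv unfolding weak_euler_solution_def by blast
  ultimately have "pairing (u t) (conv g) - pairing (u 0) (conv g)
      = (LINT \<tau>:{0..t}|lborel. pairing (tensor (u \<tau>) (u \<tau>)) (conv_grad g))"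
    by (simp add: grad_conv[OF g])
  then show ?thesis using uL t T gL by (simp add: pairing_conv)
qed

lemma set_integrable_flux:
  assumes u: "u \<in> C_weak T" and h: "h \<in> L2" and t: "t \<in> {0..T}"
  shows "set_integrable lborel {0..t} (\<lambda>\<tau>. pairing (tensor (u \<tau>) (u \<tau>)) (conv_grad h))"
proof -
  obtain M where M: "\<And>s. s \<in> {0..T} \<Longrightarrow> L2_norm (u s) \<le> M" using C_weak_bounded[OF u] by blast
  note [measurable] = L2_measurable[OF h]
  define c where "c = 9 * L2_norm K * L2_norm h"
  have c: "0 \<le> c" "\<And>x. norm (conv_grad h x) \<le> c"
    using conv_grad_bound[OF h] by (simp_all add: c_def)
  have "set_integrable lborel {0..T} (\<lambda>\<tau>. pairing (tensor (u \<tau>) (u \<tau>)) (conv_grad h))"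
    unfolding set_integrable_def
  proof (rule Bochner_Integration.integrable_bound)
    show "integrable lborel (\<lambda>\<tau>. indicator {0..T} \<tau> * (c * M\<^sup>2) :: real)"
      by (intro integrable_mult_left integrable_real_indicator) (use t in auto)
    show "(\<lambda>\<tau>. indicator {0..T} \<tau> *\<^sub>R pairing (tensor (u \<tau>) (u \<tau>)) (conv_grad h)) \<in> borel_measurable lborel"
      using quadratic_form_borel[OF u conv_grad_measurable c(2)] by simp
    show "AE \<tau> in lborel. norm (indicator {0..T} \<tau> *\<^sub>R pairing (tensor (u \<tau>) (u \<tau>)) (conv_grad h))
        \<le> norm (indicator {0..T} \<tau> * (c * M\<^sup>2))"
    proof (rule AE_I2)
      fix \<tau>
      show "norm (indicator {0..T} \<tau> *\<^sub>R pairing (tensor (u \<tau>) (u \<tau>)) (conv_grad h))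
          \<le> norm (indicator {0..T} \<tau> * (c * M\<^sup>2))"
      proof (cases "\<tau> \<in> {0..T}")
        case True
        have "\<bar>pairing (tensor (u \<tau>) (u \<tau>)) (conv_grad h)\<bar> \<le> c * (L2_norm (u \<tau>))\<^sup>2"
          by (rule pairing_tensor_bound(4)[OF C_weak_L2[OF u True] _ c(2)]) simp
        also have "\<dots> \<le> c * M\<^sup>2"
          by (intro mult_left_mono power_mono M True c L2_norm_nonneg)
        finally show ?thesis using True c by simp
      qed simp
    qed
  qed
  then show ?thesis by (rule set_integrable_subset) (use t in auto)
qed

text \<open>The defect \<open>?E\<close> is linear in \<open>h\<close>, zero on test fields and
  bounded by a multiple of the \<open>L2\<close> norm: 2 M from the two end times and the remaining
  term from the time integral. Density then gives 0.\<close>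

lemma mollified_weak_form:
  assumes T: "0 < T" and u: "weak_euler_solution T u" and t: "t \<in> {0..T}" and h: "h \<in> H_sigma"
  shows "moll_form (u t) h - moll_form (u 0) h
    = (LINT \<tau>:{0..t}|lborel. pairing (tensor (u \<tau>) (u \<tau>)) (conv_grad h))"
proof -
  have uC: "u \<in> C_weak T" using u by (simp add: weak_euler_solution_def)
  obtain M where M: "\<And>s. s \<in> {0..T} \<Longrightarrow> L2_norm (u s) \<le> M" using C_weak_bounded[OF uC] by blast
  have M0: "0 \<le> M" by (rule order_trans[OF L2_norm_nonneg M[of 0]]) (use T in simp)
  have uL: "u s \<in> L2" if "s \<in> {0..T}" for s using C_weak_L2[OF uC that] .
  have hL: "h \<in> L2" using h by (simp add: H_sigma_def)
  let ?F = "\<lambda>h \<tau>. pairing (tensor (u \<tau>) (u \<tau>)) (conv_grad h)"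
  let ?E = "\<lambda>h. moll_form (u t) h - moll_form (u 0) h - (LINT \<tau>:{0..t}|lborel. ?F h \<tau>)"
  have 0: "0 \<in> {0..T}" using T by simp
  have "\<bar>?E h\<bar> \<le> (2 * M + T * (9 * L2_norm K * M\<^sup>2)) * e" if e: "0 < e" for e
  proof -
    obtain g where g: "g \<in> test_sigma" and ge: "L2_norm (\<lambda>y. h y - g y) < e"
      using h e by (auto simp: H_sigma_def)
    have gL: "g \<in> L2" using g by (rule test_sigma_L2)
    let ?d = "\<lambda>y. h y - g y"
    have dL: "?d \<in> L2" by (intro L2_diff hL gL)
    note [measurable] = L2_measurable[OF hL] L2_measurable[OF gL]
    have m: "\<bar>moll_form (u s) ?d\<bar> \<le> M * e" if s: "s \<in> {0..T}" for s
    proof -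
      have "\<bar>moll_form (u s) ?d\<bar> \<le> L2_norm (u s) * L2_norm ?d"
        by (intro moll_form_Cauchy_Schwarz uL s dL)
      also have "\<dots> \<le> M * e" using M[OF s] ge M0 by (intro mult_mono) auto
      finally show ?thesis .
    qed
    have F_diff: "?F ?d \<tau> = ?F h \<tau> - ?F g \<tau>" if \<tau>: "\<tau> \<in> {0..T}" for \<tau>
      unfolding pairing_def conv_grad_diff[OF hL gL] inner_diff_right
      by (intro Bochner_Integration.integral_diff pairing_tensor_bound(1)[OF uL[OF \<tau>] _ conv_grad_bound] hL gL) auto
    have Fb: "\<bar>?F ?d \<tau>\<bar> \<le> 9 * L2_norm K * M\<^sup>2 * e" if \<tau>: "\<tau> \<in> {0..T}" for \<tau>
    proof -
      have "\<bar>?F ?d \<tau>\<bar> \<le> 9 * L2_norm K * L2_norm ?d * (L2_norm (u \<tau>))\<^sup>2"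
        by (rule pairing_tensor_bound(4)[OF uL[OF \<tau>] _ conv_grad_bound[OF dL]]) simp
      also have "\<dots> \<le> 9 * L2_norm K * e * M\<^sup>2"
        using M[OF \<tau>] ge e by (intro mult_mono power_mono) auto
      finally show ?thesis by (simp add: mult_ac)
    qed
    have id: "set_integrable lborel {0..t} (?F ?d)" by (rule set_integrable_flux[OF uC dL t])
    have I: "(LINT \<tau>:{0..t}|lborel. ?F h \<tau>) - (LINT \<tau>:{0..t}|lborel. ?F g \<tau>) = (LINT \<tau>:{0..t}|lborel. ?F ?d \<tau>)"
    proof -
      have "(LINT \<tau>:{0..t}|lborel. ?F ?d \<tau>) = (LINT \<tau>:{0..t}|lborel. ?F h \<tau> - ?F g \<tau>)"
        by (rule set_lebesgue_integral_cong) (use F_diff t in auto)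
      also have "\<dots> = (LINT \<tau>:{0..t}|lborel. ?F h \<tau>) - (LINT \<tau>:{0..t}|lborel. ?F g \<tau>)"
        by (intro set_integral_diff set_integrable_flux[OF uC _ t] hL gL)
      finally show ?thesis by simp
    qed
    have "\<bar>LINT \<tau>:{0..t}|lborel. ?F ?d \<tau>\<bar> \<le> (LINT \<tau>|lborel. indicator {0..t} \<tau> * (9 * L2_norm K * M\<^sup>2 * e))"
      unfolding set_lebesgue_integral_def real_norm_def[symmetric]
    proof (rule Bochner_Integration.integral_norm_bound_integral)
      show "integrable lborel (\<lambda>\<tau>. indicator {0..t} \<tau> * (9 * L2_norm K * M\<^sup>2 * e) :: real)"
        by (intro integrable_mult_left integrable_real_indicator) (use t in auto)
      show "norm (indicator {0..t} \<tau> *\<^sub>R ?F ?d \<tau>) \<le> indicator {0..t} \<tau> * (9 * L2_norm K * M\<^sup>2 * e)" for \<tau>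
        using Fb[of \<tau>] t by (cases "\<tau> \<in> {0..t}") auto
    qed (use id in \<open>simp add: set_integrable_def\<close>)
    also have "\<dots> = t * (9 * L2_norm K * M\<^sup>2 * e)" using t by simp
    also have "\<dots> \<le> T * (9 * L2_norm K * M\<^sup>2 * e)" using t e by (intro mult_right_mono) auto
    finally have I_le: "\<bar>LINT \<tau>:{0..t}|lborel. ?F ?d \<tau>\<bar> \<le> T * (9 * L2_norm K * M\<^sup>2 * e)" .
    have "?E h = ?E h - ?E g"
      using mollified_weak_form_test[OF T u t g] by simp
    also have "\<dots> = moll_form (u t) ?d - moll_form (u 0) ?d - (LINT \<tau>:{0..t}|lborel. ?F ?d \<tau>)"
      unfolding moll_form_diff_right[OF uL[OF t] hL gL] moll_form_diff_right[OF uL[OF 0] hL gL]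
      using I by linarith
    finally have "\<bar>?E h\<bar> \<le> M * e + M * e + T * (9 * L2_norm K * M\<^sup>2 * e)"
      using m[OF t] m[OF 0] I_le by linarith
    then show ?thesis by (simp add: algebra_simps)
  qed
  then have "?E h = 0"
    by (rule eq_zero_if_arbitrarily_small) (use T M0 in simp_all)
  then show ?thesis by simp
qed

text \<open>Only the field inside \<open>conv_grad\<close> varies, and it enters linearly, so weak
  continuity suffices: the mollified gradients converge pointwise and are uniformly bounded, and
  dominated convergence applies.\<close>

lemma flux_continuous:
  assumes u: "u \<in> C_weak T" and v: "v \<in> L2"
  shows "continuous_on {0..T} (\<lambda>s. pairing (tensor v v) (conv_grad (u s)))"
  unfolding continuous_on_sequentially
proof (intro allI ballI impI)
  fix s :: "nat \<Rightarrow> real" and a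
  assume a: "a \<in> {0..T}" and s: "(\<forall>n. s n \<in> {0..T}) \<and> s \<longlonglongrightarrow> a"
  obtain M where M: "\<And>s. s \<in> {0..T} \<Longrightarrow> L2_norm (u s) \<le> M" using C_weak_bounded[OF u] by blast
  have uL: "u s \<in> L2" if "s \<in> {0..T}" for s using C_weak_L2[OF u that] .
  have cm: "conv_grad (u s) \<in> borel_measurable borel" if "s \<in> {0..T}" for s
    by (intro conv_grad_measurable L2_measurable uL that)
  have le: "norm (conv_grad (u s) x) \<le> 9 * L2_norm K * M" if "s \<in> {0..T}" for s x
    by (rule order_trans[OF conv_grad_bound[OF uL[OF that]]]) (intro mult_left_mono M that, simp)
  have lim: "(\<lambda>n. conv_grad (u (s n)) x) \<longlonglongrightarrow> conv_grad (u a) x" for x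
  proof -
    have "(\<lambda>n. conv_grad (u (s n)) x $ i $ j) \<longlonglongrightarrow> conv_grad (u a) x $ i $ j" for i j
    proof -
      have "continuous_on {0..T} (\<lambda>t. pairing (u t) (\<lambda>y. K (x - y) $ i *\<^sub>R axis j 1))"
        using u L2_K_entry(1) by (auto simp: C_weak_def)
      then show ?thesis
        unfolding conv_grad_pairing using a s by (auto simp: continuous_on_sequentially o_def)
    qed
    then show ?thesis by (intro vec_tendstoI)
  qed
  have "(\<lambda>n. LINT x|lborel. tensor v v x \<bullet> conv_grad (u (s n)) x) \<longlonglongrightarrow> (LINT x|lborel. tensor v v x \<bullet> conv_grad (u a) x)"
  proof (rule integral_dominated_convergence[where w="\<lambda>x. 9 * L2_norm K * M * (norm (v x))\<^sup>2"])
    show "integrable lborel (\<lambda>x. 9 * L2_norm K * M * (norm (v x))\<^sup>2)"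
      using L2_integrable[OF v] by simp
    show "AE x in lborel. (\<lambda>n. tensor v v x \<bullet> conv_grad (u (s n)) x) \<longlonglongrightarrow> tensor v v x \<bullet> conv_grad (u a) x"
      by (intro AE_I2 tendsto_intros lim)
    show "(\<lambda>x. tensor v v x \<bullet> conv_grad (u a) x) \<in> borel_measurable lborel"
      by (rule borel_measurable_integrable[OF pairing_tensor_bound(1)[OF v cm[OF a] le[OF a]]])
    fix n
    have sn: "s n \<in> {0..T}" using s by blast
    show "(\<lambda>x. tensor v v x \<bullet> conv_grad (u (s n)) x) \<in> borel_measurable lborel"
      by (rule borel_measurable_integrable[OF pairing_tensor_bound(1)[OF v cm[OF sn] le[OF sn]]])
    show "AE x in lborel. norm (tensor v v x \<bullet> conv_grad (u (s n)) x) \<le> 9 * L2_norm K * M * (norm (v x))\<^sup>2"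
      using pairing_tensor_bound(2)[OF v cm[OF sn] le[OF sn]] by simp
  qed
  then show "((\<lambda>s. pairing (tensor v v) (conv_grad (u s))) \<circ> s) \<longlonglongrightarrow> pairing (tensor v v) (conv_grad (u a))"
    by (simp add: pairing_def o_def)
qed

lemma mollified_energy_balance:
  assumes T: "0 < T" and u: "weak_euler_solution T u" and t: "0 < t" "t \<le> T"
  shows "moll_form (u t) (u t) - moll_form (u 0) (u 0)
    = 2 * (LINT \<tau>:{0<..t}|lborel. pairing (tensor (u \<tau>) (u \<tau>)) (conv_grad (u \<tau>)))"
proof -
  have uC: "u \<in> C_weak T" using u by (simp add: weak_euler_solution_def)
  obtain M where M: "\<And>s. s \<in> {0..T} \<Longrightarrow> L2_norm (u s) \<le> M" using C_weak_bounded[OF uC] by blast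
  have M0: "0 \<le> M" by (rule order_trans[OF L2_norm_nonneg M[of 0]]) (use T in simp)
  have uL: "u s \<in> L2" if "s \<in> {0..t}" for s using C_weak_L2[OF uC, of s] that t by simp
  have uH: "u s \<in> H_sigma" if "s \<in> {0..t}" for s using uC that t by (simp add: C_weak_def)
  have le: "norm (conv_grad (u s) x) \<le> 9 * L2_norm K * M" if s: "s \<in> {0..t}" for s x
    by (rule order_trans[OF conv_grad_bound[OF uL[OF s]]], rule mult_left_mono, rule M) (use s t in auto)
  show ?thesis
  proof (rule symmetric_diagonal_increment[where C="9 * L2_norm K * M * M\<^sup>2"
        and F="\<lambda>a b. moll_form (u a) (u b)"
        and q="\<lambda>\<tau> s. pairing (tensor (u \<tau>) (u \<tau>)) (conv_grad (u s))"])
    show "moll_form (u a) (u b) = moll_form (u b) (u a)" if "a \<in> {0..t}" "b \<in> {0..t}" for a b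
      using that by (intro moll_form_commute uL)
    show "(\<lambda>\<tau>. indicator {0..t} \<tau> * pairing (tensor (u \<tau>) (u \<tau>)) (conv_grad (u s))) \<in> borel_measurable borel"
      if "s \<in> {0..t}" for s
      using borel_measurable_integrable[OF set_integrable_flux[OF uC uL[OF that], of t, unfolded set_integrable_def]] t by simp
    show "\<bar>pairing (tensor (u \<tau>) (u \<tau>)) (conv_grad (u s))\<bar> \<le> 9 * L2_norm K * M * M\<^sup>2"
      if \<tau>: "\<tau> \<in> {0..t}" and s: "s \<in> {0..t}" for \<tau> s
    proof -
      have "\<bar>pairing (tensor (u \<tau>) (u \<tau>)) (conv_grad (u s))\<bar> \<le> 9 * L2_norm K * M * (L2_norm (u \<tau>))\<^sup>2"
        by (rule pairing_tensor_bound(4)[OF uL[OF \<tau>] conv_grad_measurable le[OF s]])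
           (intro L2_measurable uL s)
      also have "\<dots> \<le> 9 * L2_norm K * M * M\<^sup>2"
        using M[of \<tau>] \<tau> t M0 by (intro mult_left_mono power_mono) auto
      finally show ?thesis .
    qed
    show "moll_form (u b) (u s) - moll_form (u 0) (u s)
        = (LINT \<tau>:{0..b}|lborel. pairing (tensor (u \<tau>) (u \<tau>)) (conv_grad (u s)))"
      if "b \<in> {0..t}" "s \<in> {0..t}" for b s
      using that t by (intro mollified_weak_form[OF T u] uH) auto
    show "continuous_on {0..t} (\<lambda>s. pairing (tensor (u \<tau>) (u \<tau>)) (conv_grad (u s)))"
      if "\<tau> \<in> {0..t}" for \<tau>
      by (rule continuous_on_subset[OF flux_continuous[OF uC uL[OF that]]]) (use t in auto)
  qed (fact t)
qed

lemma mollified_energy_bound: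
  assumes T: "0 < T" and u: "weak_euler_solution T u" and t: "t \<in> {0..T}"
    and p: "0 \<le> p" and \<kappa>: "0 < \<kappa>" "\<And>z. norm (K z) * norm z powr p \<le> \<kappa>"
  shows "ennreal \<bar>moll_form (u t) (u t) - moll_form (u 0) (u 0)\<bar>
    \<le> ennreal (2 * \<kappa>) * (\<integral>\<^sup>+\<tau>\<in>{0..T}. gagliardo p (u \<tau>) \<partial>lborel)"
proof (cases "t = 0")
  case True
  then show ?thesis by simp
next
  case False
  then have t': "0 < t" "t \<le> T" using t by auto
  have uC: "u \<in> C_weak T" using u by (simp add: weak_euler_solution_def)
  let ?q = "\<lambda>\<tau>. indicator {0<..t} \<tau> *\<^sub>R pairing (tensor (u \<tau>) (u \<tau>)) (conv_grad (u \<tau>))"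
  have "ennreal \<bar>LINT \<tau>|lborel. ?q \<tau>\<bar> \<le> ennreal \<kappa> * (\<integral>\<^sup>+\<tau>\<in>{0..T}. gagliardo p (u \<tau>) \<partial>lborel)"
  \<comment> \<open>A non-integrable flux would have integral 0 by convention, and the bound would
    hold trivially.\<close>
  proof (cases "integrable lborel ?q")
    case True
    have "ennreal \<bar>LINT \<tau>|lborel. ?q \<tau>\<bar> \<le> (\<integral>\<^sup>+\<tau>. ennreal \<bar>?q \<tau>\<bar> \<partial>lborel)"
      by (rule abs_integral_le_nn_integral)
    also have "\<dots> \<le> ennreal \<kappa> * (\<integral>\<^sup>+\<tau>\<in>{0..T}. gagliardo p (u \<tau>) \<partial>lborel)"
    proof (rule nn_integral_le_cmult[OF _ \<kappa>(1)])
      have [measurable]: "?q \<in> borel_measurable lborel" using True by simp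
      show "(\<lambda>\<tau>. ennreal \<bar>?q \<tau>\<bar>) \<in> borel_measurable lborel" by measurable
      fix \<tau>
      show "ennreal \<bar>?q \<tau>\<bar> \<le> ennreal \<kappa> * (gagliardo p (u \<tau>) * indicator {0..T} \<tau>)"
      proof (cases "\<tau> \<in> {0<..t}")
        case True
        then have "u \<tau> \<in> H_sigma" "\<tau> \<in> {0..T}" using uC t' by (auto simp: C_weak_def)
        then show ?thesis using flux_bound[OF _ p \<kappa>, of "u \<tau>"] True by simp
      qed simp
    qed
    finally show ?thesis .
  next
    case False
    then show ?thesis by (simp add: not_integrable_integral_eq)
  qed
  then have "2 * ennreal \<bar>LINT \<tau>|lborel. ?q \<tau>\<bar> \<le> 2 * (ennreal \<kappa> * (\<integral>\<^sup>+\<tau>\<in>{0..T}. gagliardo p (u \<tau>) \<partial>lborel))"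
    by (rule mult_left_mono) simp
  moreover have "ennreal \<bar>moll_form (u t) (u t) - moll_form (u 0) (u 0)\<bar> = 2 * ennreal \<bar>LINT \<tau>|lborel. ?q \<tau>\<bar>"
    unfolding mollified_energy_balance[OF T u t'] set_lebesgue_integral_def
    by (simp add: abs_mult ennreal_mult)
  ultimately show ?thesis using \<kappa>(1) by (simp add: ennreal_mult mult.assoc)
qed

end

section \<open>A concrete mollifier\<close>

text \<open>The remainder is at most (y - s)^2; when \<open>s\<close> and \<open>y\<close> have
  opposite signs this uses s * y <= 0. Squaring makes the positive part differentiable at 0.\<close>

lemma has_derivative_pos_part_square:
  "((\<lambda>s::real. (max 0 s)\<^sup>2) has_derivative (\<lambda>h. 2 * max 0 s * h)) (at s)"
  unfolding has_derivative_at_alt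
proof (intro conjI allI impI)
  show "bounded_linear (\<lambda>h. 2 * max 0 s * h)" by (rule bounded_linear_mult_right)
  fix e :: real assume e: "0 < e"
  have le: "\<bar>(max 0 y)\<^sup>2 - (max 0 s)\<^sup>2 - 2 * max 0 s * (y - s)\<bar> \<le> (y - s)\<^sup>2" for y
  proof -
    consider "0 \<le> s" "0 \<le> y" | "0 \<le> s" "y < 0" | "s < 0" "0 \<le> y" | "s < 0" "y < 0" by linarith
    then show ?thesis
    proof cases
      case 1
      then have "(max 0 y)\<^sup>2 - (max 0 s)\<^sup>2 - 2 * max 0 s * (y - s) = (y - s)\<^sup>2"
        by (simp add: power2_eq_square algebra_simps)
      then show ?thesis by simp
    next
      case 2
      have "s * y \<le> 0" using 2 by (simp add: mult_nonneg_nonpos)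
      moreover have "0 \<le> s * s" "0 \<le> y * y" by simp_all
      moreover have "(y - s)\<^sup>2 = y * y - 2 * (s * y) + s * s"
        by (simp add: power2_eq_square algebra_simps)
      moreover have "(max 0 y)\<^sup>2 - (max 0 s)\<^sup>2 - 2 * max 0 s * (y - s) = s * s - 2 * (s * y)"
        using 2 by (simp add: power2_eq_square algebra_simps)
      ultimately show ?thesis by linarith
    next
      case 3
      have "s * y \<le> 0" using 3 by (simp add: mult_nonpos_nonneg)
      then show ?thesis using 3 by (simp add: power2_eq_square algebra_simps)
    next
      case 4
      then show ?thesis by simp
    qed
  qed
  show "\<exists>d>0. \<forall>y. norm (y - s) < d \<longrightarrow>
      norm ((max 0 y)\<^sup>2 - (max 0 s)\<^sup>2 - 2 * max 0 s * (y - s)) \<le> e * norm (y - s)"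
  proof (intro exI[of _ e] conjI e allI impI)
    fix y assume y: "norm (y - s) < e"
    have "(y - s)\<^sup>2 = \<bar>y - s\<bar> * \<bar>y - s\<bar>" by (simp add: power2_eq_square)
    also have "\<dots> \<le> e * \<bar>y - s\<bar>" using y by (intro mult_right_mono) auto
    finally show "norm ((max 0 y)\<^sup>2 - (max 0 s)\<^sup>2 - 2 * max 0 s * (y - s)) \<le> e * norm (y - s)"
      using le[of y] by simp
  qed
qed

text \<open>The normalised square of the positive part of \<epsilon>^2 - |z|^2. Its gradient is of
  order \<epsilon>^(-4) by scaling in three dimensions, and |z|^p is at most \<epsilon>^p on its
  support. The point is that \<open>C\<close> does not depend on \<epsilon>.\<close>

lemma ex_mollifier:
  assumes p: "0 \<le> p"
  shows "\<exists>C>0. \<forall>\<epsilon>>0. \<exists>\<phi> K. mollifier \<phi> K \<epsilon> \<and> (\<forall>z. norm (K z) * norm z powr p \<le> C * \<epsilon> powr (p - 4))"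
proof -
  define V where "V = unit_ball_vol (real DIM(real^3))"
  have V: "0 < V" by (simp add: V_def)
  \<comment> \<open>On the ball of radius \<epsilon>/2 the bump is at least (3/4 \<epsilon>^2)^2 and
    the volume is V (\<epsilon>/2)^3, so the mass before normalisation is at least c
    \<epsilon>^7.\<close>
  define c where "c = (3/4)\<^sup>2 * (1/2)^3 * V"
  have c: "0 < c" using V by (simp add: c_def)
  have "\<exists>\<phi> K. mollifier \<phi> K \<epsilon> \<and> (\<forall>z. norm (K z) * norm z powr p \<le> 4 / c * \<epsilon> powr (p - 4))" if \<epsilon>: "0 < \<epsilon>" for \<epsilon>
  proof -
    define m where "m z = max 0 (\<epsilon>\<^sup>2 - z \<bullet> z)" for z :: "real^3"
    define I where "I = (LINT z|lborel. (m z)\<^sup>2)"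
    define \<phi> where "\<phi> z = (m z)\<^sup>2 / I" for z
    define K where "K z = (- 4 * m z / I) *\<^sub>R z" for z
    have m_cont: "continuous_on UNIV m" unfolding m_def[abs_def] by (intro continuous_intros)
    have m_0: "m z = 0" if "norm z > \<epsilon>" for z
    proof -
      have "\<epsilon>\<^sup>2 \<le> (norm z)\<^sup>2" using that \<epsilon> by (intro power_mono) auto
      then show ?thesis by (simp add: m_def power2_norm_eq_inner)
    qed
    have m_le: "0 \<le> m z" "m z \<le> \<epsilon>\<^sup>2" for z by (simp_all add: m_def)
    have m_sq: "(m z)\<^sup>2 \<le> (\<epsilon>\<^sup>2)\<^sup>2" for z by (rule power_mono[OF m_le(2,1)])
    have [measurable]: "m \<in> borel_measurable borel" by (rule borel_measurable_continuous_onI[OF m_cont])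
    have int: "integrable lborel (\<lambda>z. (m z)\<^sup>2)"
      by (rule integrable_bounded_support[where C="(\<epsilon>\<^sup>2)\<^sup>2" and R=\<epsilon>]) (use m_sq in \<open>auto simp: m_0\<close>)
    have I: "c * \<epsilon> ^ 7 \<le> I"
    proof -
      have "c * \<epsilon> ^ 7 = (3/4 * \<epsilon>\<^sup>2)\<^sup>2 * (V * (\<epsilon>/2) ^ 3)"
        by (simp add: c_def power_mult_distrib power_divide field_simps eval_nat_numeral)
      also have "V * (\<epsilon>/2) ^ 3 = measure lborel (ball (0::real^3) (\<epsilon>/2))"
        using \<epsilon> by (simp add: measure_def emeasure_ball V_def)
      also have "(3/4 * \<epsilon>\<^sup>2)\<^sup>2 * measure lborel (ball (0::real^3) (\<epsilon>/2))
          = (LINT z|lborel. (3/4 * \<epsilon>\<^sup>2)\<^sup>2 * indicator (ball (0::real^3) (\<epsilon>/2)) z)"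
        by simp
      also have "\<dots> \<le> I"
        unfolding I_def
      proof (rule integral_mono)
        show "integrable lborel (\<lambda>z. (3/4 * \<epsilon>\<^sup>2)\<^sup>2 * indicator (ball (0::real^3) (\<epsilon>/2)) z)"
          using emeasure_lborel_ball_finite[of "0::real^3" "\<epsilon>/2"]
          by (intro integrable_mult_right integrable_real_indicator) (auto simp: less_top)
        show "(3/4 * \<epsilon>\<^sup>2)\<^sup>2 * indicator (ball (0::real^3) (\<epsilon>/2)) z \<le> (m z)\<^sup>2" for z
        proof (cases "z \<in> ball 0 (\<epsilon>/2)")
          case True
          then have "(norm z)\<^sup>2 \<le> (\<epsilon>/2)\<^sup>2" by (intro power_mono) (auto simp: dist_norm)
          then have "3/4 * \<epsilon>\<^sup>2 \<le> \<epsilon>\<^sup>2 - z \<bullet> z" by (simp add: power2_norm_eq_inner power_divide)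
          also have "\<dots> \<le> m z" by (simp add: m_def)
          finally have "3/4 * \<epsilon>\<^sup>2 \<le> m z" .
          then show ?thesis using True by (auto intro!: power_mono)
        qed simp
      qed (fact int)
      finally show ?thesis .
    qed
    have I_pos: "0 < I" by (rule less_le_trans[OF _ I]) (use c \<epsilon> in simp)
    have "mollifier \<phi> K \<epsilon>"
    proof
      show "0 \<le> \<phi> z" "\<phi> (- z) = \<phi> z" "K (- z) = - K z" for z
        using I_pos by (simp_all add: \<phi>_def K_def m_def)
      show "\<phi> z = 0" "K z = 0" if "norm z > \<epsilon>" for z
        by (simp_all add: \<phi>_def K_def m_0 that)
      show "(LINT z|lborel. \<phi> z) = 1"
        using I_pos by (simp add: \<phi>_def I_def)
      show "continuous_on UNIV K"
        unfolding K_def[abs_def] using I_pos by (intro continuous_intros m_cont) auto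
      fix z :: "real^3"
      have "((\<lambda>z. \<epsilon>\<^sup>2 - z \<bullet> z) has_derivative (\<lambda>w. - 2 * (z \<bullet> w))) (at z)"
        by (auto intro!: derivative_eq_intros simp: inner_commute)
      from has_derivative_compose[OF this has_derivative_pos_part_square]
      have "((\<lambda>z. (m z)\<^sup>2) has_derivative (\<lambda>w. 2 * m z * (- 2 * (z \<bullet> w)))) (at z)"
        by (simp add: m_def)
      then have "((\<lambda>z. (m z)\<^sup>2 * (1 / I)) has_derivative (\<lambda>w. 2 * m z * (- 2 * (z \<bullet> w)) * (1 / I))) (at z)"
        by (rule has_derivative_mult_left)
      then show "(\<phi> has_derivative (\<lambda>w. K z \<bullet> w)) (at z)"
        by (simp add: \<phi>_def[abs_def] K_def mult.assoc)
    qed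
    moreover have "norm (K z) * norm z powr p \<le> 4 / c * \<epsilon> powr (p - 4)" for z
    proof (cases "norm z > \<epsilon>")
      case True
      then show ?thesis using c by (simp add: K_def m_0)
    next
      case False
      have "norm (K z) = 4 * m z * norm z / I" using I_pos m_le[of z] by (simp add: K_def abs_mult)
      also have "\<dots> \<le> 4 * \<epsilon>\<^sup>2 * \<epsilon> / (c * \<epsilon> ^ 7)"
        using False m_le[of z] I c \<epsilon> by (intro frac_le mult_mono) auto
      also have "\<dots> = 4 / c / \<epsilon> ^ 4" using \<epsilon> c by (simp add: field_simps eval_nat_numeral)
      finally have "norm (K z) * norm z powr p \<le> 4 / c / \<epsilon> ^ 4 * \<epsilon> powr p"
        using False p c by (intro mult_mono powr_mono2) auto
      also have "\<dots> = 4 / c * \<epsilon> powr (p - 4)"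
        using \<epsilon> by (simp add: powr_diff powr_numeral)
      finally show ?thesis .
    qed
    ultimately show ?thesis by blast
  qed
  moreover have "0 < 4 / c" using c by simp
  ultimately show ?thesis by blast
qed

text \<open>The threshold \<delta> is the modulus of continuity of one smooth approximation of
  \<open>v\<close>, so it serves all mollifiers of small radius at once. Thus one mollifier can
  later be used for two fields.\<close>

lemma moll_form_limit:
  assumes v: "v \<in> H_sigma" and e: "0 < e"
  shows "\<exists>\<delta>>0. \<forall>\<phi> K r. mollifier \<phi> K r \<and> r < \<delta> \<longrightarrow> \<bar>mollifier.moll_form \<phi> v v - (L2_norm v)\<^sup>2\<bar> \<le> e"
proof -
  have vL: "v \<in> L2" using v by (simp add: H_sigma_def)
  let ?N = "L2_norm v"
  \<comment> \<open>The cap 1 gives \<open>L2_norm g \<le> ?N + 1\<close>; the other bound then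
    keeps the approximation error below e/2.\<close>
  define e' where "e' = min 1 (e / (4 * (2 * ?N + 1)))"
  have N: "0 < 2 * ?N + 1" using L2_norm_nonneg[of v] by linarith
  have e': "0 < e'" "e' \<le> 1" using e N by (auto simp: e'_def)
  have "e' \<le> e / (4 * (2 * ?N + 1))" by (simp add: e'_def)
  then have e'_le: "2 * (2 * ?N + 1) * e' \<le> e / 2" using N by (simp add: field_simps)
  obtain g where g: "g \<in> test_sigma" and ge: "L2_norm (\<lambda>x. v x - g x) < e'"
    using v e'(1) by (auto simp: H_sigma_def)
  have gL: "g \<in> L2" using g by (rule test_sigma_L2)
  have "L2_norm (\<lambda>x. g x - v x) = L2_norm (\<lambda>x. v x - g x)" by (simp add: L2_norm_def norm_minus_commute)
  then have gN: "L2_norm g \<le> ?N + 1" using L2_norm_triangle[OF gL vL] ge e' by linarith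
  define A where "A = (LINT x|lborel. norm (g x))"
  have A: "0 \<le> A" by (simp add: A_def)
  define \<eta> where "\<eta> = e / (2 * (A + 1))"
  have \<eta>: "0 < \<eta>" using e A by (simp add: \<eta>_def)
  have \<eta>_le: "\<eta> * A \<le> e / 2"
  proof -
    have "\<eta> * A = A / (A + 1) * (e / 2)" by (simp add: \<eta>_def mult_ac)
    also have "\<dots> \<le> 1 * (e / 2)" using A e by (intro mult_right_mono) auto
    finally show ?thesis by simp
  qed
  obtain R where R: "\<And>x. norm x > R \<Longrightarrow> g x = 0" using test_sigma_support[OF g] by metis
  have gc: "continuous_on UNIV g"
    using g smooth_on_iter_deriv(2)[of g "[]"] by (simp add: test_sigma_def)
  obtain \<delta> where \<delta>: "0 < \<delta>" "\<And>x y. dist x y < \<delta> \<Longrightarrow> dist (g x) (g y) < \<eta>"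
    using continuous_support_uniformly[OF gc R \<eta>] by metis
  show ?thesis
  proof (intro exI[of _ \<delta>] conjI \<delta> allI impI, elim conjE)
    fix \<phi> K r assume "mollifier \<phi> K r" and r: "r < \<delta>"
    interpret mollifier \<phi> K r by fact
    have near: "norm (g x - g y) \<le> \<eta>" if "dist x y \<le> r" for x y
      using \<delta>(2)[of x y] that r by (simp add: dist_norm)
    have "\<bar>moll_form v v - ?N\<^sup>2\<bar> \<le> 2 * (?N + L2_norm g) * e' + \<eta> * A"
      unfolding A_def using ge by (intro moll_form_near_norm vL g near) auto
    also have "2 * (?N + L2_norm g) * e' \<le> 2 * (2 * ?N + 1) * e'"
      using gN e' by (intro mult_right_mono) auto
    finally show "\<bar>moll_form v v - ?N\<^sup>2\<bar> \<le> e" using e'_le \<eta>_le by linarith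
  qed
qed

section \<open>Energy conservation\<close>

theorem theorem10:
  fixes T \<alpha> :: real and u :: "real \<Rightarrow> real^3 \<Rightarrow> real^3"
  assumes "0 < T"
    and "weak_euler_solution T u"
    and "1 / 3 < \<alpha>"
    and "(\<integral>\<^sup>+t\<in>{0..T}. (\<integral>\<^sup>+x. ennreal (norm (u t x) ^ 3) \<partial>lborel) \<partial>lborel) < \<infinity>"
    and "(\<integral>\<^sup>+t\<in>{0..T}. (\<integral>\<^sup>+y. (\<integral>\<^sup>+x.
            ennreal (norm (u t x - u t y) ^ 3 / norm (x - y) powr (3 + 3 * \<alpha>))
          \<partial>lborel) \<partial>lborel) \<partial>lborel) < \<infinity>"
  shows "energy_conserved T u"
  unfolding energy_conserved_def
proof
  fix t assume t: "t \<in> {0..T}"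
  define p where "p = 3 + 3 * \<alpha>"
  \<comment> \<open>Here p - 4 = 3 \<alpha> - 1, and its positivity is the assumption \<alpha> >
    1/3.\<close>
  have p: "0 \<le> p" "0 < p - 4" using assms(3) by (simp_all add: p_def)
  have uC: "u \<in> C_weak T" using assms(2) by (simp add: weak_euler_solution_def)
  then have uH: "u t \<in> H_sigma" "u 0 \<in> H_sigma" using t by (auto simp: C_weak_def)
  obtain \<gamma> where \<gamma>: "0 \<le> \<gamma>" "(\<integral>\<^sup>+\<tau>\<in>{0..T}. gagliardo p (u \<tau>) \<partial>lborel) = ennreal \<gamma>"
    using assms(5) unfolding p_def gagliardo_def
    by (cases "\<integral>\<^sup>+\<tau>\<in>{0..T}. gagliardo p (u \<tau>) \<partial>lborel" rule: ennreal_cases)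
       (auto simp: p_def gagliardo_def)
  obtain C where C: "0 < C" and moll: "\<And>\<epsilon>. 0 < \<epsilon> \<Longrightarrow> \<exists>\<phi> K. mollifier \<phi> K \<epsilon>
      \<and> (\<forall>z. norm (K z) * norm z powr p \<le> C * \<epsilon> powr (p - 4))"
    using ex_mollifier[OF p(1)] by blast
  \<comment> \<open>One \<open>e\<close> for removing the mollifier at time \<open>t\<close>, one at
    time 0, and one for the flux.\<close>
  have "\<bar>(L2_norm (u t))\<^sup>2 - (L2_norm (u 0))\<^sup>2\<bar> \<le> 3 * e" if e: "0 < e" for e
  proof -
    obtain \<delta>\<^sub>1 where \<delta>\<^sub>1: "0 < \<delta>\<^sub>1" "\<And>\<phi> K r. \<lbrakk>mollifier \<phi> K r; r < \<delta>\<^sub>1\<rbrakk>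
        \<Longrightarrow> \<bar>mollifier.moll_form \<phi> (u t) (u t) - (L2_norm (u t))\<^sup>2\<bar> \<le> e"
      using moll_form_limit[OF uH(1) e] by blast
    obtain \<delta>\<^sub>2 where \<delta>\<^sub>2: "0 < \<delta>\<^sub>2" "\<And>\<phi> K r. \<lbrakk>mollifier \<phi> K r; r < \<delta>\<^sub>2\<rbrakk>
        \<Longrightarrow> \<bar>mollifier.moll_form \<phi> (u 0) (u 0) - (L2_norm (u 0))\<^sup>2\<bar> \<le> e"
      using moll_form_limit[OF uH(2) e] by blast
    define d where "d = e / (2 * C * \<gamma> + 1)"
    have pos: "0 < 2 * C * \<gamma> + 1" using C \<gamma>(1) by (simp add: add_nonneg_pos)
    have d: "0 < d" using e pos by (simp add: d_def)
    \<comment> \<open>The first bound brings the radius below both thresholds; the second makes its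
      power p - 4 at most \<open>d\<close>, which was chosen so that the flux term is at most
      \<open>e\<close>.\<close>
    define \<epsilon> where "\<epsilon> = min (min \<delta>\<^sub>1 \<delta>\<^sub>2 / 2) (d powr (1 / (p - 4)))"
    have \<epsilon>: "0 < \<epsilon>" "\<epsilon> < \<delta>\<^sub>1" "\<epsilon> < \<delta>\<^sub>2" using \<delta>\<^sub>1(1) \<delta>\<^sub>2(1) d by (auto simp: \<epsilon>_def min_def)
    have "\<epsilon> powr (p - 4) \<le> (d powr (1 / (p - 4))) powr (p - 4)"
      using \<epsilon>(1) p by (intro powr_mono2) (auto simp: \<epsilon>_def)
    also have "\<dots> = d" using p d by (simp add: powr_powr)
    finally have \<epsilon>_d: "\<epsilon> powr (p - 4) \<le> d" .
    obtain \<phi> K where mol: "mollifier \<phi> K \<epsilon>"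
      and K: "\<And>z. norm (K z) * norm z powr p \<le> C * \<epsilon> powr (p - 4)"
      using moll[OF \<epsilon>(1)] by blast
    interpret mollifier \<phi> K \<epsilon> by (fact mol)
    have "norm (K z) * norm z powr p \<le> C * d" for z
      using K[of z] mult_left_mono[OF \<epsilon>_d, of C] C by linarith
    then have "ennreal \<bar>moll_form (u t) (u t) - moll_form (u 0) (u 0)\<bar> \<le> ennreal (2 * (C * d)) * ennreal \<gamma>"
      using mollified_energy_bound[OF assms(1,2) t p(1), of "C * d"] C d unfolding \<gamma>(2) by simp
    then have "\<bar>moll_form (u t) (u t) - moll_form (u 0) (u 0)\<bar> \<le> 2 * (C * d) * \<gamma>"
      using C d \<gamma>(1) by (simp add: ennreal_le_iff flip: ennreal_mult)
    also have "\<dots> \<le> e"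
    proof -
      have "2 * (C * d) * \<gamma> \<le> (2 * C * \<gamma> + 1) * d" using d by (simp add: algebra_simps)
      also have "\<dots> = e" using pos by (simp add: d_def)
      finally show ?thesis .
    qed
    finally have "\<bar>moll_form (u t) (u t) - moll_form (u 0) (u 0)\<bar> \<le> e" .
    then show ?thesis using \<delta>\<^sub>1(2)[OF mol \<epsilon>(2)] \<delta>\<^sub>2(2)[OF mol \<epsilon>(3)] by linarith
  qed
  then have "(L2_norm (u t))\<^sup>2 - (L2_norm (u 0))\<^sup>2 = 0"
    by (rule eq_zero_if_arbitrarily_small) simp_all
  then show "L2_norm (u t) = L2_norm (u 0)"
    by (simp add: power2_eq_iff_nonneg)
qed

end
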